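(* Let $A$ be an Artin algebra, let $M$ be a (finitely generated) Gorenstein projective left $A$-module, and let $B=\mathrm{End}_A(M)$. Suppose that $A$ is a CM-finite $n$-Gorenstein algebra with $n\geq 2$, and let $E$ be a finitely generated left $A$-module such that $\mathcal{GP}(A)=\mathrm{add}\,({}_AE)$. Then $$\mathrm{gl.dim}\, B \leq n + \mathrm{pd}_B\,\mathrm{Hom}_A(M,E).$$
   Context: For an Artin algebra $A$, $A$-mod denotes the category of finitely generated left $A$-modules; all modules over Artin algebras are finitely generated left modules unless stated otherwise. For $M \in A$-mod, $B=\mathrm{End}_A(M)$ is taken with the multiplication for which $M$ is an $A$-$B$-bimodule (endomorphisms act on the right of $M$, i.e. the product $fg$ means "first $f$, then $g$"). For $X\in A$-mod, $\mathrm{Hom}_A(M,X)$ is then a left $B$-module via $(b\cdot f)(m)=f(mb)$. $\mathrm{pd}$ and $\mathrm{gl.dim}$ denote projective and global dimension, possibly $\infty$; the right-hand side of the inequality is allowed to be infinite. Gorenstein projective modules: $G\in A$-mod is Gorenstein projective if there is an exact sequence $\cdots\to P_1\to P_0\to P^0\to P^1\to\cdots$ of projective modules in $A$-mod such that $G\cong \mathrm{Im}(P_0\to P^0)$ and the sequence remains exact after applying $\mathrm{Hom}_A(-,Q)$ for every projective $Q\in A$-mod. $\mathcal{GP}(A)$ is the full subcategory of $A$-mod of Gorenstein projective modules. For $E\in A$-mod, $\mathrm{add}\,({}_AE)$ is the category of all direct summands of finite direct sums of copies of $E$. CM-finite: $A$ is CM-finite if $\mathcal{GP}(A)$ has only finitely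 many isomorphism classes of indecomposable objects; equivalently, $\mathcal{GP}(A)=\mathrm{add}\,({}_AE)$ for some $E\in A$-mod. $n$-Gorenstein: a left and right Noetherian ring $R$ is Gorenstein if the injective dimensions $\mathrm{id}\,({}_RR)$ and $\mathrm{id}\,(R_R)$ are both finite; a Gorenstein ring $R$ is $n$-Gorenstein if $\mathrm{id}\,({}_RR)\leq n$ (in which case also $\mathrm{id}\,(R_R)\leq n$). *)

theory Defs
  imports "HOL-Algebra.Module" "HOL-Algebra.Ideal" "HOL-Algebra.RingHom"
    "HOL-Library.Extended_Nat"
begin

section \<open>Left modules over a not necessarily commutative ring\<close>

text \<open>
  The locale \<^locale>\<open>module\<close> of HOL-Algebra requires a commutative base ring.  The following
  locale has the same axioms over an arbitrary ring; modules are still records of type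
  \<^type>\<open>module\<close> (whose fields for multiplication and one are irrelevant), and
  \<^locale>\<open>submodule\<close> can be used unchanged, since it makes no assumption on the base ring.
\<close>

locale left_module = R?: ring R + M?: abelian_group M
  for R (structure) and M (structure) +
  assumes smult_closed [simp, intro]:
      "\<lbrakk>a \<in> carrier R; x \<in> carrier M\<rbrakk> \<Longrightarrow> a \<odot>\<^bsub>M\<^esub> x \<in> carrier M"
    and smult_l_distr:
      "\<lbrakk>a \<in> carrier R; b \<in> carrier R; x \<in> carrier M\<rbrakk> \<Longrightarrow>
       (a \<oplus> b) \<odot>\<^bsub>M\<^esub> x = a \<odot>\<^bsub>M\<^esub> x \<oplus>\<^bsub>M\<^esub> b \<odot>\<^bsub>M\<^esub> x"
    and smult_r_distr:
      "\<lbrakk>a \<in> carrier R; x \<in> carrier M; y \<in> carrier M\<rbrakk> \<Longrightarrow>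
       a \<odot>\<^bsub>M\<^esub> (x \<oplus>\<^bsub>M\<^esub> y) = a \<odot>\<^bsub>M\<^esub> x \<oplus>\<^bsub>M\<^esub> a \<odot>\<^bsub>M\<^esub> y"
    and smult_assoc1:
      "\<lbrakk>a \<in> carrier R; b \<in> carrier R; x \<in> carrier M\<rbrakk> \<Longrightarrow>
       (a \<otimes> b) \<odot>\<^bsub>M\<^esub> x = a \<odot>\<^bsub>M\<^esub> (b \<odot>\<^bsub>M\<^esub> x)"
    and smult_one [simp]:
      "x \<in> carrier M \<Longrightarrow> \<one> \<odot>\<^bsub>M\<^esub> x = x"

lemma module_iff_left_module: "Module.module R M \<longleftrightarrow> cring R \<and> left_module R M"
  by (auto simp: Module.module_def left_module_def Module.module_axioms_def left_module_axioms_def cring_def)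

definition op_ring :: "('a, 'r) ring_scheme \<Rightarrow> ('a, 'r) ring_scheme" where
  "op_ring R = R\<lparr>mult := (\<lambda>x y. y \<otimes>\<^bsub>R\<^esub> x)\<rparr>"

definition regular_mod :: "('a, 'r) ring_scheme \<Rightarrow> ('a, 'a) module" where
  "regular_mod R = \<lparr>carrier = carrier R, mult = mult R, one = one R,
     zero = zero R, add = add R, smult = mult R\<rparr>"

definition module_span ::
    "('a, 'r) ring_scheme \<Rightarrow> ('a, 'x, 's) module_scheme \<Rightarrow> 'x set \<Rightarrow> 'x set" where
  "module_span R M S = \<Inter>{H. submodule H R M \<and> S \<subseteq> H}"

definition fg_module :: "('a, 'r) ring_scheme \<Rightarrow> ('a, 'x, 's) module_scheme \<Rightarrow> bool" where
  "fg_module R M \<longleftrightarrow> left_module R M \<and>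
     (\<exists>S. finite S \<and> S \<subseteq> carrier M \<and> module_span R M S = carrier M)"

definition zero_mod :: "('a, 'x, 's) module_scheme \<Rightarrow> bool" where
  "zero_mod M \<longleftrightarrow> carrier M = {\<zero>\<^bsub>M\<^esub>}"

text \<open>Homomorphisms are extensional functions, so that equality of homomorphisms is equality
  in HOL.\<close>

definition mod_hom ::
    "('a, 'r) ring_scheme \<Rightarrow> ('a, 'x, 's) module_scheme \<Rightarrow> ('a, 'y, 't) module_scheme \<Rightarrow>
     ('x \<Rightarrow> 'y) set" where
  "mod_hom R M N = {f \<in> carrier M \<rightarrow>\<^sub>E carrier N.
     (\<forall>x\<in>carrier M. \<forall>y\<in>carrier M. f (x \<oplus>\<^bsub>M\<^esub> y) = f x \<oplus>\<^bsub>N\<^esub> f y) \<and>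
     (\<forall>a\<in>carrier R. \<forall>x\<in>carrier M. f (a \<odot>\<^bsub>M\<^esub> x) = a \<odot>\<^bsub>N\<^esub> f x)}"

definition mod_iso ::
    "('a, 'r) ring_scheme \<Rightarrow> ('a, 'x, 's) module_scheme \<Rightarrow> ('a, 'y, 't) module_scheme \<Rightarrow> bool" where
  "mod_iso R M N \<longleftrightarrow> (\<exists>f\<in>mod_hom R M N. bij_betw f (carrier M) (carrier N))"


section \<open>A universe of modules\<close>

text \<open>
  HOL does not quantify over types inside a formula, so "all modules" over a ring with elements
  in \<open>'a\<close> means all modules whose carrier is a set of elements of the type below.  Every finitely
  generated module is isomorphic to such a module (lemma \<open>fg_module_universe\<close>).  The type also
  accommodates large modules: it contains copies of the left ideals, of a free cover of each of
  its own members, and of the modules in an injective coresolution of the regular module (these can be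
  chosen of cardinality at most the power set of the ring, or countable if the ring is finite).
\<close>

type_synonym 'a umod = "('a, (nat \<Rightarrow> 'a) set) module"

definition transport_mod :: "('x \<Rightarrow> 'y) \<Rightarrow> ('a, 'x, 's) module_scheme \<Rightarrow> ('a, 'y) module" where
  "transport_mod c M = (let g = the_inv_into (carrier M) c in
     \<lparr>carrier = c ` carrier M, mult = undefined, one = undefined, zero = c \<zero>\<^bsub>M\<^esub>,
      add = (\<lambda>u v. c (g u \<oplus>\<^bsub>M\<^esub> g v)), smult = (\<lambda>a u. c (a \<odot>\<^bsub>M\<^esub> g u))\<rparr>)"

context
  fixes R :: "('a, 'r) ring_scheme" and M :: "('a, 'x, 's) module_scheme" and c :: "'x \<Rightarrow> 'y"
  assumes mod: "left_module R M" and inj: "inj_on c (carrier M)"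
begin

interpretation left_module R M by (rule mod)

private lemma transport_simps:
  "carrier (transport_mod c M) = c ` carrier M"
  "\<zero>\<^bsub>transport_mod c M\<^esub> = c \<zero>\<^bsub>M\<^esub>"
  "\<lbrakk>x \<in> carrier M; y \<in> carrier M\<rbrakk> \<Longrightarrow> c x \<oplus>\<^bsub>transport_mod c M\<^esub> c y = c (x \<oplus>\<^bsub>M\<^esub> y)"
  "x \<in> carrier M \<Longrightarrow> a \<odot>\<^bsub>transport_mod c M\<^esub> c x = c (a \<odot>\<^bsub>M\<^esub> x)"
  by (auto simp: transport_mod_def Let_def the_inv_into_f_f[OF inj])

lemma transport_mod_left_module: "left_module R (transport_mod c M)"
proof -
  have "abelian_group (transport_mod c M)"
  proof (rule abelian_groupI, goal_cases)
    case (6 x)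
    then obtain u where "u \<in> carrier M" "x = c u" by (auto simp: transport_simps)
    then show ?case
      by (intro bexI[of _ "c (\<ominus>\<^bsub>M\<^esub> u)"]) (auto simp: transport_simps M.l_neg)
  qed (auto simp: transport_simps M.a_ac)
  then show ?thesis
    by (intro left_module.intro R.ring_axioms left_module_axioms.intro)
       (auto simp: transport_simps smult_l_distr smult_r_distr smult_assoc1)
qed

lemma transport_mod_hom: "restrict c (carrier M) \<in> mod_hom R M (transport_mod c M)"
  by (auto simp: mod_hom_def transport_simps)

lemma transport_mod_bij:
  "bij_betw (restrict c (carrier M)) (carrier M) (carrier (transport_mod c M))"
  using inj by (auto simp: bij_betw_def transport_simps inj_on_def)

lemma transport_mod_iso: "mod_iso R M (transport_mod c M)"
  unfolding mod_iso_def using transport_mod_hom transport_mod_bij by blast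

end

text \<open>An element of a finitely generated module is encoded by the set of its coordinate vectors
  with respect to a fixed generating family.\<close>

lemma fg_module_universe:
  fixes R :: "('a, 'r) ring_scheme" and M :: "('a, 'x, 's) module_scheme"
  assumes "fg_module R M"
  shows "\<exists>N :: 'a umod. left_module R N \<and> mod_iso R M N"
proof -
  interpret left_module R M using assms by (simp add: fg_module_def)
  obtain S where S: "finite S" "S \<subseteq> carrier M" "module_span R M S = carrier M"
    using assms by (auto simp: fg_module_def)
  obtain s where s: "bij_betw s {0..<card S} S"
    using ex_bij_betw_nat_finite[OF S(1)] by blast
  define m where "m = card S"
  have s_in: "s i \<in> carrier M" if "i < m" for i
    using s S(2) that by (auto simp: m_def bij_betw_def)
  define V where "V = {..<m} \<rightarrow> carrier R"
  define q where "q v = (\<Oplus>\<^bsub>M\<^esub>i\<in>{..<m}. v i \<odot>\<^bsub>M\<^esub> s i)" for v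
  have term_in: "(\<lambda>i. v i \<odot>\<^bsub>M\<^esub> s i) \<in> {..<m} \<rightarrow> carrier M" if "v \<in> V" for v
    using that s_in by (auto simp: V_def Pi_def)
  have q_in: "q v \<in> carrier M" if "v \<in> V" for v
    unfolding q_def by (rule M.finsum_closed) (rule term_in[OF that])
  have q_add: "q v \<oplus>\<^bsub>M\<^esub> q w = q (\<lambda>i. v i \<oplus>\<^bsub>R\<^esub> w i)" if "v \<in> V" "w \<in> V" for v w
  proof -
    have "q v \<oplus>\<^bsub>M\<^esub> q w = (\<Oplus>\<^bsub>M\<^esub>i\<in>{..<m}. v i \<odot>\<^bsub>M\<^esub> s i \<oplus>\<^bsub>M\<^esub> w i \<odot>\<^bsub>M\<^esub> s i)"
      unfolding q_def by (rule M.finsum_addf[symmetric]) (use term_in that in auto)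
    also have "\<dots> = q (\<lambda>i. v i \<oplus>\<^bsub>R\<^esub> w i)"
      unfolding q_def
      by (rule M.finsum_cong') (use that s_in in \<open>auto simp: V_def Pi_def smult_l_distr\<close>)
    finally show ?thesis .
  qed
  have s_null: "\<zero>\<^bsub>R\<^esub> \<odot>\<^bsub>M\<^esub> x = \<zero>\<^bsub>M\<^esub>" if "x \<in> carrier M" for x
    using smult_l_distr[of "\<zero>\<^bsub>R\<^esub>" "\<zero>\<^bsub>R\<^esub>" x] that
    by (metis M.add.r_cancel_one' R.l_zero R.zero_closed smult_closed)
  have r_null: "a \<odot>\<^bsub>M\<^esub> \<zero>\<^bsub>M\<^esub> = \<zero>\<^bsub>M\<^esub>" if "a \<in> carrier R" for a
    using smult_r_distr[of a "\<zero>\<^bsub>M\<^esub>" "\<zero>\<^bsub>M\<^esub>"] that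
    by (metis M.add.r_cancel_one' M.l_zero M.zero_closed smult_closed)
  have q_smult: "a \<odot>\<^bsub>M\<^esub> q v = q (\<lambda>i. a \<otimes>\<^bsub>R\<^esub> v i)" if "a \<in> carrier R" "v \<in> V" for a v
  proof -
    have *: "a \<odot>\<^bsub>M\<^esub> (\<Oplus>\<^bsub>M\<^esub>i\<in>F. f i) = (\<Oplus>\<^bsub>M\<^esub>i\<in>F. a \<odot>\<^bsub>M\<^esub> f i)"
      if "finite F" "f \<in> F \<rightarrow> carrier M" for F and f :: "nat \<Rightarrow> 'x"
      using that
    proof (induction F rule: finite_induct)
      case empty
      then show ?case using \<open>a \<in> carrier R\<close> by (simp add: r_null)
    next
      case (insert x F)
      then show ?case using \<open>a \<in> carrier R\<close> by (simp add: Pi_def smult_r_distr)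
    qed
    have "a \<odot>\<^bsub>M\<^esub> q v = (\<Oplus>\<^bsub>M\<^esub>i\<in>{..<m}. a \<odot>\<^bsub>M\<^esub> (v i \<odot>\<^bsub>M\<^esub> s i))"
      unfolding q_def by (rule *) (use term_in that in auto)
    also have "\<dots> = q (\<lambda>i. a \<otimes>\<^bsub>R\<^esub> v i)"
      unfolding q_def
      by (rule M.finsum_cong') (use that s_in in \<open>auto simp: V_def Pi_def smult_assoc1\<close>)
    finally show ?thesis .
  qed
  have q_zero: "q (\<lambda>i. \<zero>\<^bsub>R\<^esub>) = \<zero>\<^bsub>M\<^esub>"
  proof -
    have "q (\<lambda>i. \<zero>\<^bsub>R\<^esub>) = (\<Oplus>\<^bsub>M\<^esub>i\<in>{..<m}. \<zero>\<^bsub>M\<^esub>)"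
      unfolding q_def by (rule M.finsum_cong') (use s_in in \<open>auto simp: s_null\<close>)
    then show ?thesis by simp
  qed
  have "submodule (q ` V) R M"
  proof (intro submodule.intro submodule_axioms.intro M.add.subgroupI)
    show "q ` V \<subseteq> carrier M" using q_in by auto
    show "q ` V \<noteq> {}" by (auto simp: V_def intro!: exI[of _ "\<lambda>_. \<zero>\<^bsub>R\<^esub>"])
  next
    fix a assume "a \<in> q ` V"
    then obtain v where v: "v \<in> V" "a = q v" by auto
    have v': "(\<lambda>i. \<ominus>\<^bsub>R\<^esub> v i) \<in> V" using v by (auto simp: V_def)
    have "q (\<lambda>i. \<ominus>\<^bsub>R\<^esub> v i) \<oplus>\<^bsub>M\<^esub> a = q (\<lambda>i. \<ominus>\<^bsub>R\<^esub> v i \<oplus>\<^bsub>R\<^esub> v i)"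
      using q_add v v' by simp
    also have "\<dots> = q (\<lambda>i. \<zero>\<^bsub>R\<^esub>)"
      unfolding q_def
      by (rule M.finsum_cong') (use v s_in in \<open>auto simp: V_def Pi_def R.l_neg\<close>)
    finally have "\<ominus>\<^bsub>M\<^esub> a = q (\<lambda>i. \<ominus>\<^bsub>R\<^esub> v i)"
      using q_in v v' q_zero by (metis M.minus_equality)
    then show "\<ominus>\<^bsub>M\<^esub> a \<in> q ` V" using v' by simp
  next
    fix a b assume "a \<in> q ` V" "b \<in> q ` V"
    then obtain v w where vw: "v \<in> V" "a = q v" "w \<in> V" "b = q w" by auto
    then have "(\<lambda>i. v i \<oplus>\<^bsub>R\<^esub> w i) \<in> V" by (auto simp: V_def)
    then show "a \<oplus>\<^bsub>M\<^esub> b \<in> q ` V" using vw q_add by auto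
  next
    fix a x assume a: "a \<in> carrier R" and "x \<in> q ` V"
    then obtain v where v: "v \<in> V" "x = q v" by auto
    then have "(\<lambda>i. a \<otimes>\<^bsub>R\<^esub> v i) \<in> V" using a by (auto simp: V_def)
    then show "a \<odot>\<^bsub>M\<^esub> x \<in> q ` V" using v a q_smult by auto
  qed
  moreover have "S \<subseteq> q ` V"
  proof
    fix x assume "x \<in> S"
    then obtain j where j: "j < m" "x = s j"
      using s by (metis m_def bij_betw_imp_surj_on imageE atLeastLessThan_iff)
    define v where "v = (\<lambda>i. if j = i then \<one>\<^bsub>R\<^esub> else \<zero>\<^bsub>R\<^esub>)"
    have "q v = (\<Oplus>\<^bsub>M\<^esub>i\<in>{..<m}. if j = i then s i else \<zero>\<^bsub>M\<^esub>)"
      unfolding q_def v_def by (rule M.finsum_cong') (use s_in in \<open>auto simp: s_null\<close>)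
    also have "\<dots> = s j"
      by (rule M.finsum_singleton) (use j s_in in auto)
    finally have "x = q v" using j by simp
    moreover have "v \<in> V" by (auto simp: v_def V_def)
    ultimately show "x \<in> q ` V" by blast
  qed
  ultimately have surj: "carrier M \<subseteq> q ` V"
    unfolding S(3)[symmetric] module_span_def by blast
  define c where "c x = {v \<in> V. q v = x}" for x
  have "inj_on c (carrier M)"
  proof (rule inj_onI)
    fix x y assume "x \<in> carrier M" and eq: "c x = c y"
    then obtain v where "v \<in> V" "q v = x" using surj by blast
    then have "v \<in> c y" using eq by (auto simp: c_def)
    then show "x = y" using \<open>q v = x\<close> by (simp add: c_def)
  qed
  then show ?thesis
    using transport_mod_left_module transport_mod_iso left_module_axioms by blast
qed


section \<open>Artin algebras, endomorphism rings and Hom modules\<close>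

definition artinian_cring :: "('k, 'r) ring_scheme \<Rightarrow> bool" where
  "artinian_cring K \<longleftrightarrow> cring K \<and>
     (\<forall>I :: nat \<Rightarrow> 'k set. (\<forall>i. ideal (I i) K \<and> I (Suc i) \<subseteq> I i) \<longrightarrow> (\<exists>m. \<forall>i\<ge>m. I i = I m))"

definition restrict_scalars :: "('k \<Rightarrow> 'a) \<Rightarrow> ('a, 'x, 's) module_scheme \<Rightarrow> ('k, 'x) module" where
  "restrict_scalars \<phi> M = \<lparr>carrier = carrier M, mult = mult M, one = one M, zero = zero M,
     add = add M, smult = (\<lambda>k x. \<phi> k \<odot>\<^bsub>M\<^esub> x)\<rparr>"

definition artin_algebra ::
    "('k, 'r) ring_scheme \<Rightarrow> ('k \<Rightarrow> 'a) \<Rightarrow> ('a, 's) ring_scheme \<Rightarrow> bool" where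
  "artin_algebra K \<phi> A \<longleftrightarrow> artinian_cring K \<and> ring A \<and> \<phi> \<in> ring_hom K A \<and>
     (\<forall>k\<in>carrier K. \<forall>a\<in>carrier A. \<phi> k \<otimes>\<^bsub>A\<^esub> a = a \<otimes>\<^bsub>A\<^esub> \<phi> k) \<and>
     fg_module K (restrict_scalars \<phi> (regular_mod A))"

text \<open>The product \<open>f g\<close> in the endomorphism ring is "first \<open>f\<close>, then \<open>g\<close>".\<close>

definition end_ring :: "('a, 'r) ring_scheme \<Rightarrow> ('a, 'm, 's) module_scheme \<Rightarrow> ('m \<Rightarrow> 'm) ring" where
  "end_ring R M = \<lparr>carrier = mod_hom R M M,
     mult = (\<lambda>f g. compose (carrier M) g f),
     one = (\<lambda>x\<in>carrier M. x),
     zero = (\<lambda>x\<in>carrier M. \<zero>\<^bsub>M\<^esub>),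
     add = (\<lambda>f g. \<lambda>x\<in>carrier M. f x \<oplus>\<^bsub>M\<^esub> g x)\<rparr>"

definition hom_module ::
    "('a, 'r) ring_scheme \<Rightarrow> ('a, 'm, 's) module_scheme \<Rightarrow> ('a, 'x, 't) module_scheme \<Rightarrow>
     ('m \<Rightarrow> 'm, 'm \<Rightarrow> 'x) module" where
  "hom_module R M X = \<lparr>carrier = mod_hom R M X, mult = undefined, one = undefined,
     zero = (\<lambda>m\<in>carrier M. \<zero>\<^bsub>X\<^esub>),
     add = (\<lambda>f g. \<lambda>m\<in>carrier M. f m \<oplus>\<^bsub>X\<^esub> g m),
     smult = (\<lambda>b f. \<lambda>m\<in>carrier M. f (b m))\<rparr>"

context
  fixes R :: "('a, 'r) ring_scheme" and M :: "('a, 'm, 's) module_scheme"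
    and X :: "('a, 'x, 't) module_scheme"
  assumes modM: "left_module R M" and modX: "left_module R X"
begin

interpretation M: left_module R M by (rule modM)
interpretation X: left_module R X by (rule modX)

private lemma hom_add:
  assumes f: "f \<in> mod_hom R M X" and g: "g \<in> mod_hom R M X"
  shows "(\<lambda>m\<in>carrier M. f m \<oplus>\<^bsub>X\<^esub> g m) \<in> mod_hom R M X"
proof -
  have [simp]: "f m \<in> carrier X" "g m \<in> carrier X" if "m \<in> carrier M" for m
    using f g that by (auto simp: mod_hom_def)
  show ?thesis
    using f g unfolding mod_hom_def
    by (auto simp: M.smult_closed X.smult_r_distr X.add.m_ac)
qed

private lemma hom_minus:
  assumes f: "f \<in> mod_hom R M X"
  shows "(\<lambda>m\<in>carrier M. \<ominus>\<^bsub>X\<^esub> f m) \<in> mod_hom R M X"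
proof -
  have [simp]: "f m \<in> carrier X" if "m \<in> carrier M" for m
    using f that by (auto simp: mod_hom_def)
  have *: "\<ominus>\<^bsub>X\<^esub> (a \<odot>\<^bsub>X\<^esub> x) = a \<odot>\<^bsub>X\<^esub> (\<ominus>\<^bsub>X\<^esub> x)"
    if "a \<in> carrier R" "x \<in> carrier X" for a x
  proof -
    have z: "a \<odot>\<^bsub>X\<^esub> \<zero>\<^bsub>X\<^esub> = \<zero>\<^bsub>X\<^esub>"
      using X.smult_r_distr[of a "\<zero>\<^bsub>X\<^esub>" "\<zero>\<^bsub>X\<^esub>"] that
      by (metis X.add.r_cancel_one' X.M.l_zero X.M.zero_closed X.smult_closed)
    have "a \<odot>\<^bsub>X\<^esub> (\<ominus>\<^bsub>X\<^esub> x) \<oplus>\<^bsub>X\<^esub> a \<odot>\<^bsub>X\<^esub> x = \<zero>\<^bsub>X\<^esub>"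
      using that z by (simp add: X.smult_r_distr[symmetric] X.M.l_neg)
    then show ?thesis
      using that by (intro X.M.minus_equality) (auto simp: X.smult_closed)
  qed
  show ?thesis
    using f unfolding mod_hom_def
    by (auto simp: M.smult_closed X.smult_closed * X.M.minus_add X.M.a_comm)
qed

private lemma hom_zero: "(\<lambda>m\<in>carrier M. \<zero>\<^bsub>X\<^esub>) \<in> mod_hom R M X"
proof -
  have "a \<odot>\<^bsub>X\<^esub> \<zero>\<^bsub>X\<^esub> = \<zero>\<^bsub>X\<^esub>" if "a \<in> carrier R" for a
    using X.smult_r_distr[of a "\<zero>\<^bsub>X\<^esub>" "\<zero>\<^bsub>X\<^esub>"] that
    by (metis X.add.r_cancel_one' X.M.l_zero X.M.zero_closed X.smult_closed)
  then show ?thesis by (auto simp: mod_hom_def M.smult_closed)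
qed

private lemma homD:
  assumes "f \<in> mod_hom R M X"
  shows "m \<in> carrier M \<Longrightarrow> f m \<in> carrier X" "m \<notin> carrier M \<Longrightarrow> f m = undefined"
  using assms by (auto simp: mod_hom_def)

lemma hom_module_abelian_group: "abelian_group (hom_module R M X)"
proof (rule abelian_groupI, goal_cases)
  case (3 f g h)
  then show ?case
    by (intro ext) (auto simp: hom_module_def homD X.M.a_assoc restrict_def)
next
  case (4 f g)
  then show ?case
    by (intro ext) (auto simp: hom_module_def homD X.M.a_comm restrict_def)
next
  case (5 f)
  then show ?case
    by (intro ext) (auto simp: hom_module_def homD restrict_def)
next
  case (6 f)
  then have "(\<lambda>m\<in>carrier M. \<ominus>\<^bsub>X\<^esub> f m) \<in> mod_hom R M X"
    by (simp add: hom_module_def hom_minus)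
  then show ?case using 6
    by (intro bexI[of _ "\<lambda>m\<in>carrier M. \<ominus>\<^bsub>X\<^esub> f m"])
       (auto simp: hom_module_def homD X.M.l_neg restrict_def fun_eq_iff)
qed (auto simp: hom_module_def hom_add hom_zero)

end

lemma mod_hom_compose:
  assumes "f \<in> mod_hom R X Y" "g \<in> mod_hom R Y Z" "left_module R X"
  shows "compose (carrier X) g f \<in> mod_hom R X Z"
proof -
  interpret left_module R X by fact
  have "f x \<in> carrier Y" if "x \<in> carrier X" for x using assms that by (auto simp: mod_hom_def)
  then show ?thesis using assms
    by (auto simp: mod_hom_def compose_def)
qed

lemma end_ring_ring:
  assumes mod: "left_module R M"
  shows "ring (end_ring R M)"
proof -
  interpret left_module R M by fact
  have D: "m \<in> carrier M \<Longrightarrow> f m \<in> carrier M" "m \<notin> carrier M \<Longrightarrow> f m = undefined"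
    "m \<in> carrier M \<Longrightarrow> y \<in> carrier M \<Longrightarrow> f (m \<oplus>\<^bsub>M\<^esub> y) = f m \<oplus>\<^bsub>M\<^esub> f y"
    if "f \<in> mod_hom R M M" for f m y
    using that by (auto simp: mod_hom_def)
  have comp: "(\<lambda>m\<in>carrier M. g (f m)) \<in> mod_hom R M M"
    if "f \<in> mod_hom R M M" "g \<in> mod_hom R M M" for f g
    using mod_hom_compose[OF that mod] by (simp add: compose_def)
  have one: "(\<lambda>m\<in>carrier M. m) \<in> mod_hom R M M"
    by (auto simp: mod_hom_def)
  interpret H: abelian_group "hom_module R M M"
    by (rule hom_module_abelian_group; fact)
  have "abelian_group (end_ring R M)"
  proof (rule abelian_groupI, goal_cases)
    case 1
    then show ?case using H.a_closed by (simp add: end_ring_def hom_module_def)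
  next
    case 2
    then show ?case using H.zero_closed by (simp add: end_ring_def hom_module_def)
  next
    case 3
    then show ?case using H.a_assoc by (simp add: end_ring_def hom_module_def)
  next
    case 4
    then show ?case using H.a_comm by (simp add: end_ring_def hom_module_def)
  next
    case 5
    then show ?case using H.l_zero by (simp add: end_ring_def hom_module_def)
  next
    case (6 f)
    then show ?case using H.l_neg[of f] H.a_inv_closed[of f]
      by (auto simp: end_ring_def hom_module_def)
  qed
  moreover have "monoid (end_ring R M)"
    by (rule monoidI) (auto simp: end_ring_def comp[unfolded restrict_def] one[unfolded restrict_def]
        compose_def restrict_def fun_eq_iff D)
  ultimately show ?thesis
    by (rule ringI) (auto simp: end_ring_def compose_def restrict_def fun_eq_iff D)
qed

lemma hom_module_left_module:
  assumes modM: "left_module R M" and modX: "left_module R X"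
  shows "left_module (end_ring R M) (hom_module R M X)"
proof -
  interpret M: left_module R M by fact
  interpret X: left_module R X by fact
  have DX: "m \<in> carrier M \<Longrightarrow> f m \<in> carrier X" "m \<notin> carrier M \<Longrightarrow> f m = undefined"
    "m \<in> carrier M \<Longrightarrow> y \<in> carrier M \<Longrightarrow> f (m \<oplus>\<^bsub>M\<^esub> y) = f m \<oplus>\<^bsub>X\<^esub> f y"
    if "f \<in> mod_hom R M X" for f m y
    using that by (auto simp: mod_hom_def)
  have DM: "m \<in> carrier M \<Longrightarrow> f m \<in> carrier M" if "f \<in> mod_hom R M M" for f m
    using that by (auto simp: mod_hom_def)
  have comp: "(\<lambda>m\<in>carrier M. f (b m)) \<in> mod_hom R M X"
    if "b \<in> mod_hom R M M" "f \<in> mod_hom R M X" for b f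
    using mod_hom_compose[OF that modM] by (simp add: compose_def)
  have "left_module_axioms (end_ring R M) (hom_module R M X)"
  proof (rule left_module_axioms.intro, goal_cases)
    case 1
    then show ?case by (simp add: end_ring_def hom_module_def comp)
  qed (auto simp: end_ring_def hom_module_def compose_def restrict_def fun_eq_iff DX DM)
  then show ?thesis
    by (intro left_module.intro end_ring_ring hom_module_abelian_group modM modX)
qed


section \<open>Homological dimensions\<close>

definition projective_mod :: "('a, 'r) ring_scheme \<Rightarrow> 'a umod \<Rightarrow> bool" where
  "projective_mod R P \<longleftrightarrow> left_module R P \<and>
     (\<forall>(X :: 'a umod) (Y :: 'a umod) g h.
        left_module R X \<and> left_module R Y \<and>
        g \<in> mod_hom R X Y \<and> g ` carrier X = carrier Y \<and> h \<in> mod_hom R P Y \<longrightarrow>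
        (\<exists>k\<in>mod_hom R P X. compose (carrier P) g k = h))"

definition injective_mod :: "('a, 'r) ring_scheme \<Rightarrow> 'a umod \<Rightarrow> bool" where
  "injective_mod R I \<longleftrightarrow> left_module R I \<and>
     (\<forall>(X :: 'a umod) (Y :: 'a umod) g h.
        left_module R X \<and> left_module R Y \<and>
        g \<in> mod_hom R X Y \<and> inj_on g (carrier X) \<and> h \<in> mod_hom R X I \<longrightarrow>
        (\<exists>k\<in>mod_hom R Y I. compose (carrier X) k g = h))"

definition exact_at ::
    "('x \<Rightarrow> 'y) \<Rightarrow> ('y \<Rightarrow> 'z) \<Rightarrow> ('a, 'x, 'r) module_scheme \<Rightarrow> ('a, 'y, 's) module_scheme \<Rightarrow>
     ('a, 'z, 't) module_scheme \<Rightarrow> bool" where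
  "exact_at f g X Y Z \<longleftrightarrow> f ` carrier X = a_kernel Y Z g"

text \<open>\<open>0 \<rightarrow> P n \<rightarrow> \<dots> \<rightarrow> P 1 \<rightarrow> P 0 \<rightarrow> X \<rightarrow> 0\<close>, continued by zero modules to the left; all terms
  lie in the category of finitely generated modules.\<close>

definition proj_resolution ::
    "('a, 'r) ring_scheme \<Rightarrow> ('a, 'x, 's) module_scheme \<Rightarrow> nat \<Rightarrow> (nat \<Rightarrow> 'a umod) \<Rightarrow>
     (nat \<Rightarrow> (nat \<Rightarrow> 'a) set \<Rightarrow> (nat \<Rightarrow> 'a) set) \<Rightarrow> ((nat \<Rightarrow> 'a) set \<Rightarrow> 'x) \<Rightarrow> bool" where
  "proj_resolution R X n P d e \<longleftrightarrow>
     (\<forall>i. fg_module R (P i) \<and> projective_mod R (P i)) \<and> (\<forall>i>n. zero_mod (P i)) \<and>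
     e \<in> mod_hom R (P 0) X \<and> (\<forall>i. d i \<in> mod_hom R (P (Suc i)) (P i)) \<and>
     e ` carrier (P 0) = carrier X \<and>
     exact_at (d 0) e (P 1) (P 0) X \<and>
     (\<forall>i. exact_at (d (Suc i)) (d i) (P (Suc (Suc i))) (P (Suc i)) (P i))"

definition proj_dim :: "('a, 'r) ring_scheme \<Rightarrow> ('a, 'x, 's) module_scheme \<Rightarrow> enat" where
  "proj_dim R X = Inf {enat n | n. \<exists>P d e. proj_resolution R X n P d e}"

definition gl_dim :: "('a, 'r) ring_scheme \<Rightarrow> enat" where
  "gl_dim R = (SUP X \<in> {X :: 'a umod. fg_module R X}. proj_dim R X)"

text \<open>\<open>0 \<rightarrow> X \<rightarrow> I 0 \<rightarrow> I 1 \<rightarrow> \<dots> \<rightarrow> I n \<rightarrow> 0\<close>, continued by zero modules to the right.  Injective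
  modules are not required to be finitely generated.\<close>

definition inj_coresolution ::
    "('a, 'r) ring_scheme \<Rightarrow> ('a, 'x, 's) module_scheme \<Rightarrow> nat \<Rightarrow> (nat \<Rightarrow> 'a umod) \<Rightarrow>
     (nat \<Rightarrow> (nat \<Rightarrow> 'a) set \<Rightarrow> (nat \<Rightarrow> 'a) set) \<Rightarrow> ('x \<Rightarrow> (nat \<Rightarrow> 'a) set) \<Rightarrow> bool" where
  "inj_coresolution R X n I d e \<longleftrightarrow>
     (\<forall>i. injective_mod R (I i)) \<and> (\<forall>i>n. zero_mod (I i)) \<and>
     e \<in> mod_hom R X (I 0) \<and> (\<forall>i. d i \<in> mod_hom R (I i) (I (Suc i))) \<and>
     inj_on e (carrier X) \<and>
     exact_at e (d 0) X (I 0) (I 1) \<and>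
     (\<forall>i. exact_at (d i) (d (Suc i)) (I i) (I (Suc i)) (I (Suc (Suc i))))"

definition inj_dim :: "('a, 'r) ring_scheme \<Rightarrow> ('a, 'x, 's) module_scheme \<Rightarrow> enat" where
  "inj_dim R X = Inf {enat n | n. \<exists>I d e. inj_coresolution R X n I d e}"


section \<open>Gorenstein rings and Gorenstein projective modules\<close>

definition left_noetherian :: "('a, 'r) ring_scheme \<Rightarrow> bool" where
  "left_noetherian R \<longleftrightarrow> ring R \<and>
     (\<forall>I. submodule I R (regular_mod R) \<longrightarrow>
        (\<exists>S. finite S \<and> S \<subseteq> I \<and> module_span R (regular_mod R) S = I))"

text \<open>Right modules over \<open>R\<close> are left modules over the opposite ring.\<close>

definition gorenstein_ring :: "('a, 'r) ring_scheme \<Rightarrow> bool" where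
  "gorenstein_ring R \<longleftrightarrow> left_noetherian R \<and> left_noetherian (op_ring R) \<and>
     inj_dim R (regular_mod R) < \<infinity> \<and> inj_dim (op_ring R) (regular_mod (op_ring R)) < \<infinity>"

definition n_gorenstein_ring :: "nat \<Rightarrow> ('a, 'r) ring_scheme \<Rightarrow> bool" where
  "n_gorenstein_ring n R \<longleftrightarrow> gorenstein_ring R \<and> inj_dim R (regular_mod R) \<le> enat n"

text \<open>The complex \<open>\<dots> \<rightarrow> P\<^sub>1 \<rightarrow> P\<^sub>0 \<rightarrow> P\<^sup>0 \<rightarrow> P\<^sup>1 \<rightarrow> \<dots>\<close> is indexed by the integers, with \<open>P\<^sup>i\<close> in
  degree \<open>i\<close> and \<open>P\<^sub>i\<close> in degree \<open>-i-1\<close>, so that the map \<open>P\<^sub>0 \<rightarrow> P\<^sup>0\<close> is \<open>d (-1)\<close>.  The last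
  clause says that every cocycle of the complex \<open>Hom(P, Q)\<close> is a coboundary.\<close>

definition totally_acyclic ::
    "('a, 'r) ring_scheme \<Rightarrow> (int \<Rightarrow> 'a umod) \<Rightarrow>
     (int \<Rightarrow> (nat \<Rightarrow> 'a) set \<Rightarrow> (nat \<Rightarrow> 'a) set) \<Rightarrow> bool" where
  "totally_acyclic R P d \<longleftrightarrow>
     (\<forall>i. fg_module R (P i) \<and> projective_mod R (P i)) \<and>
     (\<forall>i. d i \<in> mod_hom R (P i) (P (i + 1))) \<and>
     (\<forall>i. exact_at (d i) (d (i + 1)) (P i) (P (i + 1)) (P (i + 2))) \<and>
     (\<forall>(Q :: 'a umod). fg_module R Q \<and> projective_mod R Q \<longrightarrow>
        (\<forall>i. \<forall>f\<in>mod_hom R (P (i + 1)) Q.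
           compose (carrier (P i)) f (d i) = (\<lambda>x\<in>carrier (P i). \<zero>\<^bsub>Q\<^esub>) \<longrightarrow>
           (\<exists>g\<in>mod_hom R (P (i + 2)) Q. f = compose (carrier (P (i + 1))) g (d (i + 1)))))"

definition gorenstein_projective ::
    "('a, 'r) ring_scheme \<Rightarrow> ('a, 'x, 's) module_scheme \<Rightarrow> bool" where
  "gorenstein_projective R G \<longleftrightarrow> fg_module R G \<and>
     (\<exists>P d. totally_acyclic R P d \<and>
        mod_iso R G ((P 0)\<lparr>carrier := d (-1) ` carrier (P (-1))\<rparr>))"

definition GP :: "('a, 'r) ring_scheme \<Rightarrow> 'a umod set" where
  "GP R = {X. gorenstein_projective R X}"


section \<open>Direct sums, additive closure and CM-finiteness\<close>

definition power_mod :: "('a, 'x, 's) module_scheme \<Rightarrow> nat \<Rightarrow> ('a, nat \<Rightarrow> 'x) module" where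
  "power_mod E m = \<lparr>carrier = {..<m} \<rightarrow>\<^sub>E carrier E, mult = undefined, one = undefined,
     zero = (\<lambda>i\<in>{..<m}. \<zero>\<^bsub>E\<^esub>),
     add = (\<lambda>v w. \<lambda>i\<in>{..<m}. v i \<oplus>\<^bsub>E\<^esub> w i),
     smult = (\<lambda>a v. \<lambda>i\<in>{..<m}. a \<odot>\<^bsub>E\<^esub> v i)\<rparr>"

definition internal_direct_sum ::
    "('a, 'r) ring_scheme \<Rightarrow> ('a, 'x, 's) module_scheme \<Rightarrow> 'x set \<Rightarrow> 'x set \<Rightarrow> bool" where
  "internal_direct_sum R M U V \<longleftrightarrow> submodule U R M \<and> submodule V R M \<and>
     U \<inter> V = {\<zero>\<^bsub>M\<^esub>} \<and> U <+>\<^bsub>M\<^esub> V = carrier M"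

definition direct_summand ::
    "('a, 'r) ring_scheme \<Rightarrow> ('a, 'x, 's) module_scheme \<Rightarrow> ('a, 'y, 't) module_scheme \<Rightarrow> bool" where
  "direct_summand R X Y \<longleftrightarrow>
     (\<exists>U V. internal_direct_sum R Y U V \<and> mod_iso R X (Y\<lparr>carrier := U\<rparr>))"

definition add_closure :: "('a, 'r) ring_scheme \<Rightarrow> ('a, 'e, 's) module_scheme \<Rightarrow> 'a umod set" where
  "add_closure R E = {X. fg_module R X \<and> (\<exists>m. direct_summand R X (power_mod E m))}"

definition indecomposable :: "('a, 'r) ring_scheme \<Rightarrow> ('a, 'x, 's) module_scheme \<Rightarrow> bool" where
  "indecomposable R X \<longleftrightarrow> left_module R X \<and> \<not> zero_mod X \<and>
     (\<forall>U V. internal_direct_sum R X U V \<longrightarrow> U = {\<zero>\<^bsub>X\<^esub>} \<or> V = {\<zero>\<^bsub>X\<^esub>})"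

definition cm_finite :: "('a, 'r) ring_scheme \<Rightarrow> bool" where
  "cm_finite R \<longleftrightarrow>
     (\<exists>\<S> :: 'a umod set. finite \<S> \<and>
        (\<forall>X\<in>GP R. indecomposable R X \<longrightarrow> (\<exists>Y\<in>\<S>. mod_iso R X Y)))"

end

theory Submission
  imports Defs
begin

text \<open>
  Let \<open>B\<close> be the endomorphism ring of \<open>M\<close>.  A finitely generated \<open>B\<close>-module \<open>X\<close> has a projective
  presentation of the form \<open>Hom(M, M\<^sup>s) \<rightarrow> Hom(M, M\<^sup>m) \<rightarrow> X \<rightarrow> 0\<close>, induced by a map \<open>f : M\<^sup>s \<rightarrow> M\<^sup>m\<close>, so
  that the second syzygy of \<open>X\<close> is \<open>Hom(M, ker f)\<close>.  Since \<open>A\<close> has injective dimension at most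
  \<open>n\<close> and Gorenstein projective modules have no higher extensions by \<open>A\<close>, we have
  \<open>Ext\<^sup>i(ker f, A) = 0\<close> for \<open>i > n - 2\<close>.  Taking kernels of right \<open>add E\<close>-approximations \<open>n - 2\<close> times
  leads to a module without any higher extensions by \<open>A\<close>; over a Gorenstein algebra such a module is
  Gorenstein projective, hence in \<open>add E\<close>.  As the approximations stay exact under \<open>Hom(M, -)\<close>, the
  projective dimension of \<open>Hom(M, ker f)\<close> is at most \<open>n - 2\<close> plus that of \<open>Hom(M, E)\<close>.

  \<open>Ext(-, A)\<close> is computed throughout from one fixed injective coresolution of \<open>A\<close>, which avoids
  comparing projective resolutions.  The coresolution of \<open>A\<close> as a right module enters only in the
  proof that a module without higher extensions by \<open>A\<close> is torsionless.
\<close>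

section \<open>Linear maps\<close>

text \<open>Three obstacles shape the proof. Finiteness: homomorphisms between finitely generated
  modules must form finitely generated \<open>K\<close>-modules, both for the approximations and for
  lifting \<open>B\<close>-module presentations to maps between powers of \<open>M\<close>; so the
  commutative Artinian ring \<open>K\<close> is shown to be Noetherian. Types:
  \<open>projective_mod\<close>, \<open>injective_mod\<close> and resolutions speak of modules in
  the universe, while kernels, products and Hom modules have other carriers; hence the transport
  lemmas, the injections \<open>c\<close> into the universe and the use of dual bases. Duality:
  building a complete resolution to the right requires embeddings into free modules, hence
  torsionlessness. The dual of a free resolution is an exact complex of right modules bounded on one
  side, and finite injective dimension on the right solves extension problems on it. The number
  \<open>n - 2\<close> arises thus: \<open>Ext\<^sup>n(-, A)\<close> turns monomorphisms into
  epimorphisms, so the image of \<open>f\<close>, a submodule of a power of \<open>M\<close>, has no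
  extensions by \<open>A\<close> in degree \<open>n\<close> or above; passing to the kernel of
  \<open>f\<close> gains another degree.\<close>

definition lin ::
    "('a, 'r) ring_scheme \<Rightarrow> ('a, 'x, 's) module_scheme \<Rightarrow> ('a, 'y, 't) module_scheme \<Rightarrow>
     ('x \<Rightarrow> 'y) \<Rightarrow> bool" where
  "lin R M N f \<longleftrightarrow> (\<forall>x\<in>carrier M. f x \<in> carrier N) \<and>
     (\<forall>x\<in>carrier M. \<forall>y\<in>carrier M. f (x \<oplus>\<^bsub>M\<^esub> y) = f x \<oplus>\<^bsub>N\<^esub> f y) \<and>
     (\<forall>a\<in>carrier R. \<forall>x\<in>carrier M. f (a \<odot>\<^bsub>M\<^esub> x) = a \<odot>\<^bsub>N\<^esub> f x)"

lemma linI: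
  assumes "\<And>x. x \<in> carrier M \<Longrightarrow> f x \<in> carrier N"
    and "\<And>x y. x \<in> carrier M \<Longrightarrow> y \<in> carrier M \<Longrightarrow> f (x \<oplus>\<^bsub>M\<^esub> y) = f x \<oplus>\<^bsub>N\<^esub> f y"
    and "\<And>a x. a \<in> carrier R \<Longrightarrow> x \<in> carrier M \<Longrightarrow> f (a \<odot>\<^bsub>M\<^esub> x) = a \<odot>\<^bsub>N\<^esub> f x"
  shows "lin R M N f"
  using assms by (auto simp: lin_def)

lemma lin_closed: "lin R M N f \<Longrightarrow> x \<in> carrier M \<Longrightarrow> f x \<in> carrier N"
  by (auto simp: lin_def)

lemma lin_add:
  "lin R M N f \<Longrightarrow> x \<in> carrier M \<Longrightarrow> y \<in> carrier M \<Longrightarrow> f (x \<oplus>\<^bsub>M\<^esub> y) = f x \<oplus>\<^bsub>N\<^esub> f y"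
  by (auto simp: lin_def)

lemma lin_smult:
  "lin R M N f \<Longrightarrow> a \<in> carrier R \<Longrightarrow> x \<in> carrier M \<Longrightarrow> f (a \<odot>\<^bsub>M\<^esub> x) = a \<odot>\<^bsub>N\<^esub> f x"
  by (auto simp: lin_def)

text \<open>Extensionality is the only difference between the two notions. Without it, composites,
  sums and inclusions are plain lambda terms; \<open>lin_restrict\<close> leads back to
  \<open>mod_hom\<close> at the few places where the given definitions ask for it.\<close>

lemma mod_hom_lin: "f \<in> mod_hom R M N \<longleftrightarrow> lin R M N f \<and> f \<in> extensional (carrier M)"
  by (auto simp: lin_def mod_hom_def PiE_def)

lemma lin_cong:
  assumes "lin R M N f" "\<And>x. x \<in> carrier M \<Longrightarrow> f x = g x" "left_module R M"
  shows "lin R M N g"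
proof -
  interpret left_module R M by fact
  show ?thesis using assms(1) by (intro linI) (simp_all add: lin_def assms(2)[symmetric])
qed

lemma lin_restrict:
  assumes "lin R M N f" "left_module R M"
  shows "restrict f (carrier M) \<in> mod_hom R M N"
  using lin_cong[OF assms(1) _ assms(2), of "restrict f (carrier M)"] by (auto simp: mod_hom_lin)

lemma lin_comp: "lin R M N f \<Longrightarrow> lin R N P g \<Longrightarrow> lin R M P (\<lambda>x. g (f x))"
  by (auto simp: lin_def)

lemma lin_id: "lin R M M (\<lambda>x. x)"
  by (auto simp: lin_def)

context left_module
begin

lemma smult_l_null [simp]: "x \<in> carrier M \<Longrightarrow> \<zero> \<odot>\<^bsub>M\<^esub> x = \<zero>\<^bsub>M\<^esub>"
  using smult_l_distr[of \<zero> \<zero> x] by (metis M.add.r_cancel_one' R.l_zero R.zero_closed smult_closed)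

lemma smult_r_null [simp]: "a \<in> carrier R \<Longrightarrow> a \<odot>\<^bsub>M\<^esub> \<zero>\<^bsub>M\<^esub> = \<zero>\<^bsub>M\<^esub>"
  using smult_r_distr[of a "\<zero>\<^bsub>M\<^esub>" "\<zero>\<^bsub>M\<^esub>"]
  by (metis M.add.r_cancel_one' M.l_zero M.zero_closed smult_closed)

lemma smult_r_minus:
  "a \<in> carrier R \<Longrightarrow> x \<in> carrier M \<Longrightarrow> a \<odot>\<^bsub>M\<^esub> (\<ominus>\<^bsub>M\<^esub> x) = \<ominus>\<^bsub>M\<^esub> (a \<odot>\<^bsub>M\<^esub> x)"
  by (rule M.minus_equality[symmetric]) (simp_all add: smult_r_distr[symmetric] M.l_neg)

lemma smult_l_minus:
  "a \<in> carrier R \<Longrightarrow> x \<in> carrier M \<Longrightarrow> (\<ominus> a) \<odot>\<^bsub>M\<^esub> x = \<ominus>\<^bsub>M\<^esub> (a \<odot>\<^bsub>M\<^esub> x)"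
  by (rule M.minus_equality[symmetric]) (simp_all add: smult_l_distr[symmetric] R.l_neg)

lemma minus_smult_one: "x \<in> carrier M \<Longrightarrow> \<ominus>\<^bsub>M\<^esub> x = (\<ominus> \<one>) \<odot>\<^bsub>M\<^esub> x"
  by (simp add: smult_l_minus)

lemma eq_iff_diff: "x \<in> carrier M \<Longrightarrow> y \<in> carrier M \<Longrightarrow> x = y \<longleftrightarrow> x \<ominus>\<^bsub>M\<^esub> y = \<zero>\<^bsub>M\<^esub>"
  by (metis M.add.inv_closed M.minus_equality M.minus_minus M.r_neg a_minus_def)

lemma add_diff: "x \<in> carrier M \<Longrightarrow> y \<in> carrier M \<Longrightarrow> x \<oplus>\<^bsub>M\<^esub> (y \<ominus>\<^bsub>M\<^esub> x) = y"
  by (metis M.add.inv_closed M.add.m_assoc M.add.m_comm M.l_zero M.r_neg a_minus_def)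

lemma diff_add: "x \<in> carrier M \<Longrightarrow> y \<in> carrier M \<Longrightarrow> (y \<ominus>\<^bsub>M\<^esub> x) \<oplus>\<^bsub>M\<^esub> x = y"
  by (simp add: M.a_assoc M.l_neg a_minus_def)

lemma add_minus_cancel: "x \<in> carrier M \<Longrightarrow> y \<in> carrier M \<Longrightarrow> (x \<oplus>\<^bsub>M\<^esub> y) \<ominus>\<^bsub>M\<^esub> y = x"
  by (simp add: M.a_assoc M.r_neg a_minus_def)

lemma minus_zero: "x \<in> carrier M \<Longrightarrow> x \<ominus>\<^bsub>M\<^esub> \<zero>\<^bsub>M\<^esub> = x"
  by (simp add: a_minus_def)

end

lemma lin_zero:
  assumes "lin R M N f" "left_module R M" "left_module R N"
  shows "f \<zero>\<^bsub>M\<^esub> = \<zero>\<^bsub>N\<^esub>"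
proof -
  interpret M: left_module R M by fact
  interpret N: left_module R N by fact
  have "f (\<zero>\<^bsub>R\<^esub> \<odot>\<^bsub>M\<^esub> \<zero>\<^bsub>M\<^esub>) = \<zero>\<^bsub>R\<^esub> \<odot>\<^bsub>N\<^esub> f \<zero>\<^bsub>M\<^esub>"
    by (rule lin_smult[OF assms(1)]) auto
  then show ?thesis using lin_closed[OF assms(1)] by simp
qed

lemma lin_minus:
  assumes "lin R M N f" "left_module R M" "left_module R N" "x \<in> carrier M"
  shows "f (\<ominus>\<^bsub>M\<^esub> x) = \<ominus>\<^bsub>N\<^esub> f x"
proof -
  interpret M: left_module R M by fact
  interpret N: left_module R N by fact
  show ?thesis using lin_closed[OF assms(1)] assms(4)
    by (simp add: M.minus_smult_one N.minus_smult_one lin_smult[OF assms(1)])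
qed

lemma lin_diff:
  assumes "lin R M N f" "left_module R M" "left_module R N" "x \<in> carrier M" "y \<in> carrier M"
  shows "f (x \<ominus>\<^bsub>M\<^esub> y) = f x \<ominus>\<^bsub>N\<^esub> f y"
proof -
  interpret M: left_module R M by fact
  show ?thesis using assms by (simp add: a_minus_def lin_add[OF assms(1)] lin_minus[OF assms(1)])
qed

lemma lin_zero_map: "left_module R M \<Longrightarrow> left_module R N \<Longrightarrow> lin R M N (\<lambda>x. \<zero>\<^bsub>N\<^esub>)"
proof -
  assume "left_module R M" "left_module R N"
  then interpret N: left_module R N by simp
  show ?thesis by (auto simp: lin_def)
qed

lemma lin_plus:
  assumes f: "lin R M N f" and g: "lin R M N g" and N: "left_module R N"
  shows "lin R M N (\<lambda>x. f x \<oplus>\<^bsub>N\<^esub> g x)"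
proof -
  interpret N: left_module R N by fact
  show ?thesis using lin_closed[OF f] lin_closed[OF g]
    by (intro linI) (simp_all add: lin_add[OF f] lin_add[OF g] lin_smult[OF f] lin_smult[OF g]
        N.smult_r_distr N.M.a_ac)
qed

lemma lin_uminus:
  assumes f: "lin R M N f" and N: "left_module R N"
  shows "lin R M N (\<lambda>x. \<ominus>\<^bsub>N\<^esub> f x)"
proof -
  interpret N: left_module R N by fact
  show ?thesis using lin_closed[OF f]
    by (intro linI) (simp_all add: lin_add[OF f] lin_smult[OF f] N.smult_r_minus N.M.minus_add N.M.a_comm)
qed

lemma lin_sub:
  assumes f: "lin R M N f" and g: "lin R M N g" and N: "left_module R N"
  shows "lin R M N (\<lambda>x. f x \<ominus>\<^bsub>N\<^esub> g x)"
  unfolding a_minus_def by (intro lin_plus lin_uminus assms)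

lemma lin_inj_iff:
  assumes f: "lin R M N f" and M: "left_module R M" and N: "left_module R N"
  shows "inj_on f (carrier M) \<longleftrightarrow> (\<forall>x\<in>carrier M. f x = \<zero>\<^bsub>N\<^esub> \<longrightarrow> x = \<zero>\<^bsub>M\<^esub>)"
proof -
  interpret M: left_module R M by fact
  interpret N: left_module R N by fact
  show ?thesis
  proof
    assume "inj_on f (carrier M)"
    then show "\<forall>x\<in>carrier M. f x = \<zero>\<^bsub>N\<^esub> \<longrightarrow> x = \<zero>\<^bsub>M\<^esub>"
      using lin_zero[OF assms] by (auto simp: inj_on_def)
  next
    assume R: "\<forall>x\<in>carrier M. f x = \<zero>\<^bsub>N\<^esub> \<longrightarrow> x = \<zero>\<^bsub>M\<^esub>"
    show "inj_on f (carrier M)"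
    proof (rule inj_onI)
      fix x y assume xy: "x \<in> carrier M" "y \<in> carrier M" "f x = f y"
      then have "f (x \<ominus>\<^bsub>M\<^esub> y) = \<zero>\<^bsub>N\<^esub>"
        using lin_closed[OF f] N.eq_iff_diff[of "f x" "f y"] by (simp add: lin_diff[OF assms])
      then show "x = y" using R xy M.eq_iff_diff[of x y] by simp
    qed
  qed
qed

lemma lin_inverse:
  assumes f: "lin R M N f" and M: "left_module R M"
    and g: "\<And>y. y \<in> carrier N \<Longrightarrow> g y \<in> carrier M" "\<And>y. y \<in> carrier N \<Longrightarrow> f (g y) = y"
    and inj: "inj_on f (carrier M)"
  shows "lin R N M g"
proof -
  interpret M: left_module R M by fact
  have gf: "g (f x) = x" if "x \<in> carrier M" for x
    using that g[of "f x"] lin_closed[OF f] inj by (auto simp: inj_on_def)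
  show ?thesis
  proof (rule linI)
    fix x y assume xy: "x \<in> carrier N" "y \<in> carrier N"
    have "f (g x \<oplus>\<^bsub>M\<^esub> g y) = x \<oplus>\<^bsub>N\<^esub> y" using xy g by (simp add: lin_add[OF f])
    then show "g (x \<oplus>\<^bsub>N\<^esub> y) = g x \<oplus>\<^bsub>M\<^esub> g y" using gf xy g(1) by (metis M.M.a_closed)
  next
    fix a x assume xy: "a \<in> carrier R" "x \<in> carrier N"
    have "f (a \<odot>\<^bsub>M\<^esub> g x) = a \<odot>\<^bsub>N\<^esub> x" using xy g by (simp add: lin_smult[OF f])
    then show "g (a \<odot>\<^bsub>N\<^esub> x) = a \<odot>\<^bsub>M\<^esub> g x" using gf xy g(1) by (metis M.smult_closed)
  qed (use g in auto)
qed

section \<open>Submodules\<close>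

context left_module
begin

lemma submoduleI:
  assumes "H \<subseteq> carrier M" "\<zero>\<^bsub>M\<^esub> \<in> H"
    and "\<And>a b. a \<in> H \<Longrightarrow> b \<in> H \<Longrightarrow> a \<oplus>\<^bsub>M\<^esub> b \<in> H"
    and "\<And>a x. a \<in> carrier R \<Longrightarrow> x \<in> H \<Longrightarrow> a \<odot>\<^bsub>M\<^esub> x \<in> H"
  shows "submodule H R M"
proof (intro submodule.intro submodule_axioms.intro M.add.subgroupI)
  fix a assume "a \<in> H"
  then have "\<ominus>\<^bsub>M\<^esub> a = (\<ominus> \<one>) \<odot>\<^bsub>M\<^esub> a" using assms(1) by (auto simp: minus_smult_one)
  then show "\<ominus>\<^bsub>M\<^esub> a \<in> H" using assms(4) \<open>a \<in> H\<close> by simp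
qed (use assms in auto)

lemma submoduleD:
  assumes "submodule H R M"
  shows "H \<subseteq> carrier M" "\<zero>\<^bsub>M\<^esub> \<in> H" "\<And>a b. a \<in> H \<Longrightarrow> b \<in> H \<Longrightarrow> a \<oplus>\<^bsub>M\<^esub> b \<in> H"
    "\<And>a x. a \<in> carrier R \<Longrightarrow> x \<in> H \<Longrightarrow> a \<odot>\<^bsub>M\<^esub> x \<in> H"
  using submodule.axioms[OF assms] subgroup.subset[of H "add_monoid M"] subgroup.one_closed[of H "add_monoid M"]
    subgroup.m_closed[of H "add_monoid M"] by (auto simp: submodule_axioms_def)

lemma submodule_minus: "submodule H R M \<Longrightarrow> a \<in> H \<Longrightarrow> \<ominus>\<^bsub>M\<^esub> a \<in> H"
  using submoduleD[of H] by (metis R.add.inv_closed R.one_closed minus_smult_one subsetD)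

lemma submodule_diff: "submodule H R M \<Longrightarrow> a \<in> H \<Longrightarrow> b \<in> H \<Longrightarrow> a \<ominus>\<^bsub>M\<^esub> b \<in> H"
  using submodule_minus submoduleD(3) by (metis a_minus_def)

lemma submodule_left_module:
  assumes "submodule H R M"
  shows "left_module R (M\<lparr>carrier := H\<rparr>)"
proof -
  note H = submoduleD[OF assms]
  have "abelian_group (M\<lparr>carrier := H\<rparr>)"
  proof (rule abelian_groupI, goal_cases)
    case (6 x)
    then show ?case using submodule_minus[OF assms] H(1) M.l_neg by (auto intro!: bexI[of _ "\<ominus>\<^bsub>M\<^esub> x"])
  next
    case (3 x y z) then show ?case using H(1) by (simp add: M.a_assoc subset_iff)
  next
    case (4 x y) then show ?case using H(1) by (simp add: M.a_comm subset_iff)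
  qed (use H in auto)
  then show ?thesis
    using H(1) smult_l_distr smult_r_distr smult_assoc1 H
    by (intro left_module.intro R.ring_axioms left_module_axioms.intro) (auto simp: subset_iff)
qed

lemma carrier_submodule: "submodule (carrier M) R M"
  by (rule submoduleI) auto

lemma zero_submodule: "submodule {\<zero>\<^bsub>M\<^esub>} R M"
  by (rule submoduleI) auto

end

lemma lin_incl: "U \<subseteq> carrier M \<Longrightarrow> lin R (M\<lparr>carrier := U\<rparr>) M (\<lambda>x. x)"
  by (auto simp: lin_def)

lemma lin_codom:
  "lin R N M f \<Longrightarrow> (\<And>x. x \<in> carrier N \<Longrightarrow> f x \<in> U) \<Longrightarrow> lin R N (M\<lparr>carrier := U\<rparr>) f"
  by (auto simp: lin_def)

lemma lin_dom: "lin R M N f \<Longrightarrow> U \<subseteq> carrier M \<Longrightarrow> lin R (M\<lparr>carrier := U\<rparr>) N f"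
  by (simp add: lin_def subset_iff)

definition ker ::
    "('a, 'x, 's) module_scheme \<Rightarrow> ('a, 'y, 't) module_scheme \<Rightarrow> ('x \<Rightarrow> 'y) \<Rightarrow> 'x set" where
  "ker M N f = {x \<in> carrier M. f x = \<zero>\<^bsub>N\<^esub>}"

lemma a_kernel_ker: "a_kernel M N f = ker M N f"
  by (simp add: a_kernel_def kernel_def ker_def)

lemma ker_submodule:
  assumes f: "lin R M N f" and M: "left_module R M" and N: "left_module R N"
  shows "submodule (ker M N f) R M"
proof -
  interpret M: left_module R M by fact
  interpret N: left_module R N by fact
  show ?thesis
    by (rule M.submoduleI) (auto simp: ker_def lin_zero[OF assms] lin_add[OF f] lin_smult[OF f])
qed

lemma image_submodule:
  assumes f: "lin R M N f" and M: "left_module R M" and N: "left_module R N" and U: "submodule U R M"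
  shows "submodule (f ` U) R N"
proof -
  interpret M: left_module R M by fact
  interpret N: left_module R N by fact
  note U' = M.submoduleD[OF U]
  show ?thesis
  proof (rule N.submoduleI)
    show "f ` U \<subseteq> carrier N" using U' lin_closed[OF f] by auto
    show "\<zero>\<^bsub>N\<^esub> \<in> f ` U" using lin_zero[OF f M N] U' by force
  next
    fix a b assume "a \<in> f ` U" "b \<in> f ` U"
    then obtain x y where "x \<in> U" "y \<in> U" "a = f x" "b = f y" by auto
    then have "a \<oplus>\<^bsub>N\<^esub> b = f (x \<oplus>\<^bsub>M\<^esub> y)" "x \<oplus>\<^bsub>M\<^esub> y \<in> U" using lin_add[OF f] U' by (auto simp: subset_iff)
    then show "a \<oplus>\<^bsub>N\<^esub> b \<in> f ` U" by blast
  next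
    fix a b assume "a \<in> carrier R" "b \<in> f ` U"
    then obtain x where "x \<in> U" "b = f x" by auto
    then have "a \<odot>\<^bsub>N\<^esub> b = f (a \<odot>\<^bsub>M\<^esub> x)" "a \<odot>\<^bsub>M\<^esub> x \<in> U"
      using lin_smult[OF f] U' \<open>a \<in> carrier R\<close> by (auto simp: subset_iff)
    then show "a \<odot>\<^bsub>N\<^esub> b \<in> f ` U" by blast
  qed
qed

lemma ker_left_module:
  assumes "lin R M N f" "left_module R M" "left_module R N"
  shows "left_module R (M\<lparr>carrier := ker M N f\<rparr>)"
  using left_module.submodule_left_module[OF assms(2) ker_submodule[OF assms]] .

lemma image_left_module:
  assumes "lin R M N f" "left_module R M" "left_module R N"
  shows "left_module R (N\<lparr>carrier := f ` carrier M\<rparr>)"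
  using left_module.submodule_left_module[OF assms(3)
      image_submodule[OF assms left_module.carrier_submodule[OF assms(2)]]] .

text \<open>Universal property of a cokernel without a quotient construction: the value at
  \<open>y\<close> is that of \<open>f\<close> at any preimage, and two preimages differ by an
  element killed by \<open>p\<close>, hence by \<open>f\<close>.\<close>

lemma lin_factor:
  assumes p: "lin R P X p" and P: "left_module R P" and X: "left_module R X" and N: "left_module R N"
    and surj: "p ` carrier P = carrier X"
    and f: "lin R P N f" and van: "\<And>x. x \<in> carrier P \<Longrightarrow> p x = \<zero>\<^bsub>X\<^esub> \<Longrightarrow> f x = \<zero>\<^bsub>N\<^esub>"
  shows "\<exists>g. lin R X N g \<and> (\<forall>x\<in>carrier P. g (p x) = f x)"
proof -
  interpret P: left_module R P by fact
  interpret X: left_module R X by fact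
  interpret N: left_module R N by fact
  define s where "s = inv_into (carrier P) p"
  have s: "s y \<in> carrier P \<and> p (s y) = y" if "y \<in> carrier X" for y
    using that surj by (auto simp: s_def inv_into_into f_inv_into_f)
  have *: "f x = f y" if "x \<in> carrier P" "y \<in> carrier P" "p x = p y" for x y
  proof -
    have "p (x \<ominus>\<^bsub>P\<^esub> y) = \<zero>\<^bsub>X\<^esub>"
      using that lin_closed[OF p] X.eq_iff_diff[of "p x" "p y"] by (simp add: lin_diff[OF p P X])
    then have "f (x \<ominus>\<^bsub>P\<^esub> y) = \<zero>\<^bsub>N\<^esub>" using van that by simp
    then show ?thesis
      using that lin_closed[OF f] N.eq_iff_diff[of "f x" "f y"] by (simp add: lin_diff[OF f P N])
  qed
  have gp: "f (s (p x)) = f x" if "x \<in> carrier P" for x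
    using *[of "s (p x)" x] s[of "p x"] that lin_closed[OF p] by auto
  have "lin R X N (\<lambda>y. f (s y))"
  proof (rule linI)
    fix x y assume xy: "x \<in> carrier X" "y \<in> carrier X"
    have "p (s x \<oplus>\<^bsub>P\<^esub> s y) = x \<oplus>\<^bsub>X\<^esub> y" using s xy by (simp add: lin_add[OF p])
    then show "f (s (x \<oplus>\<^bsub>X\<^esub> y)) = f (s x) \<oplus>\<^bsub>N\<^esub> f (s y)"
      using gp[of "s x \<oplus>\<^bsub>P\<^esub> s y"] s xy by (simp add: lin_add[OF f])
  next
    fix a x assume xy: "a \<in> carrier R" "x \<in> carrier X"
    have "p (a \<odot>\<^bsub>P\<^esub> s x) = a \<odot>\<^bsub>X\<^esub> x" using s xy by (simp add: lin_smult[OF p])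
    then show "f (s (a \<odot>\<^bsub>X\<^esub> x)) = a \<odot>\<^bsub>N\<^esub> f (s x)"
      using gp[of "a \<odot>\<^bsub>P\<^esub> s x"] s xy by (simp add: lin_smult[OF f])
  qed (use s lin_closed[OF f] in auto)
  then show ?thesis using gp by (intro exI[of _ "\<lambda>y. f (s y)"]) auto
qed

section \<open>Finite sums\<close>

text \<open>A recursive sum in place of \<open>finsum\<close>: it does not mention the carrier, so
  passing to a submodule or restricting scalars leaves it literally unchanged.\<close>

primrec msum :: "('a, 'x, 's) module_scheme \<Rightarrow> nat \<Rightarrow> (nat \<Rightarrow> 'x) \<Rightarrow> 'x" where
  "msum M 0 f = \<zero>\<^bsub>M\<^esub>"
| "msum M (Suc m) f = msum M m f \<oplus>\<^bsub>M\<^esub> f m"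

lemma msum_cong: "(\<And>i. i < m \<Longrightarrow> f i = g i) \<Longrightarrow> msum M m f = msum M m g"
  by (induction m) auto

lemma msum_carrier_upd [simp]: "msum (M\<lparr>carrier := U\<rparr>) m f = msum M m f"
  by (induction m) auto

lemma msum_lin:
  assumes f: "lin R M N f" and M: "left_module R M" and N: "left_module R N"
    and "\<And>i. i < m \<Longrightarrow> x i \<in> carrier M"
  shows "msum M m x \<in> carrier M" "f (msum M m x) = msum N m (\<lambda>i. f (x i))"
proof -
  interpret M: left_module R M by fact
  have "msum M m x \<in> carrier M \<and> f (msum M m x) = msum N m (\<lambda>i. f (x i))"
    using assms(4)
  proof (induction m)
    case 0 show ?case by (simp add: lin_zero[OF f M N])
  next
    case (Suc m) then show ?case by (simp add: lin_add[OF f])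
  qed
  then show "msum M m x \<in> carrier M" "f (msum M m x) = msum N m (\<lambda>i. f (x i))" by auto
qed

context left_module
begin

lemma msum_closed [intro]: "(\<And>i. i < m \<Longrightarrow> f i \<in> carrier M) \<Longrightarrow> msum M m f \<in> carrier M"
  by (induction m) auto

lemma msum_in_submodule:
  "submodule H R M \<Longrightarrow> (\<And>i. i < m \<Longrightarrow> f i \<in> H) \<Longrightarrow> msum M m f \<in> H"
  by (induction m) (auto simp: submoduleD)

lemma msum_add:
  "(\<And>i. i < m \<Longrightarrow> f i \<in> carrier M) \<Longrightarrow> (\<And>i. i < m \<Longrightarrow> g i \<in> carrier M) \<Longrightarrow>
   msum M m (\<lambda>i. f i \<oplus>\<^bsub>M\<^esub> g i) = msum M m f \<oplus>\<^bsub>M\<^esub> msum M m g"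
  by (induction m) (auto simp: M.a_ac msum_closed)

lemma msum_smult:
  "(\<And>i. i < m \<Longrightarrow> f i \<in> carrier M) \<Longrightarrow> a \<in> carrier R \<Longrightarrow>
   msum M m (\<lambda>i. a \<odot>\<^bsub>M\<^esub> f i) = a \<odot>\<^bsub>M\<^esub> msum M m f"
  by (induction m) (auto simp: smult_r_distr msum_closed)

lemma msum_zero: "(\<And>i. i < m \<Longrightarrow> f i = \<zero>\<^bsub>M\<^esub>) \<Longrightarrow> msum M m f = \<zero>\<^bsub>M\<^esub>"
  by (induction m) auto

lemma msum_single:
  assumes "j < m" "x \<in> carrier M" "f j = x" "\<And>i. i < m \<Longrightarrow> i \<noteq> j \<Longrightarrow> f i = \<zero>\<^bsub>M\<^esub>"
  shows "msum M m f = x"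
  using assms
proof (induction m)
  case (Suc m)
  show ?case
  proof (cases "j = m")
    case True
    then have "msum M m f = \<zero>\<^bsub>M\<^esub>" using Suc.prems by (intro msum_zero) auto
    then show ?thesis using True Suc.prems by simp
  next
    case False
    then show ?thesis using Suc by simp
  qed
qed simp

lemma msum_append:
  assumes "\<And>i. i < m \<Longrightarrow> f i \<in> carrier M" "\<And>i. i < k \<Longrightarrow> g i \<in> carrier M"
  shows "msum M (m + k) (\<lambda>i. if i < m then f i else g (i - m)) = msum M m f \<oplus>\<^bsub>M\<^esub> msum M k g"
  using assms(2)
proof (induction k)
  case 0
  have "msum M m (\<lambda>i. if i < m then f i else g (i - m)) = msum M m f" by (rule msum_cong) simp
  then show ?case using assms(1) by (simp add: msum_closed)
next
  case (Suc k) then show ?case using assms(1) by (simp add: msum_closed M.a_assoc)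
qed

end

lemma lin_msum:
  assumes "\<And>i. i < m \<Longrightarrow> lin R M N (f i)" "left_module R M" "left_module R N"
  shows "lin R M N (\<lambda>x. msum N m (\<lambda>i. f i x))"
  using assms(1) by (induction m) (simp_all add: lin_plus lin_zero_map assms(2,3))

section \<open>Generators\<close>

definition lcomb_gen ::
    "('a, 'r) ring_scheme \<Rightarrow> ('a, 'x, 's) module_scheme \<Rightarrow> 'x set \<Rightarrow> nat \<Rightarrow> (nat \<Rightarrow> 'x) \<Rightarrow> bool" where
  "lcomb_gen R M U m x \<longleftrightarrow> (\<forall>i<m. x i \<in> U) \<and>
     (\<forall>u\<in>U. \<exists>c. (\<forall>i<m. c i \<in> carrier R) \<and> u = msum M m (\<lambda>i. c i \<odot>\<^bsub>M\<^esub> x i))"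

text \<open>Stated for a subset \<open>U\<close> so that a submodule and its ambient module share
  one record; \<open>fg_iff\<close> is the link to \<open>fg_module\<close>.\<close>

definition fgen :: "('a, 'r) ring_scheme \<Rightarrow> ('a, 'x, 's) module_scheme \<Rightarrow> 'x set \<Rightarrow> bool" where
  "fgen R M U \<longleftrightarrow> (\<exists>m x. lcomb_gen R M U m x)"

lemma fgenI:
  assumes "\<And>i. i < m \<Longrightarrow> x i \<in> U"
    and "\<And>u. u \<in> U \<Longrightarrow> \<exists>c. (\<forall>i<m. c i \<in> carrier R) \<and> u = msum M m (\<lambda>i. c i \<odot>\<^bsub>M\<^esub> x i)"
  shows "fgen R M U"
  using assms unfolding fgen_def lcomb_gen_def by blast

lemma fgenE:
  assumes "fgen R M U"
  obtains m x where "\<forall>i<m. x i \<in> U"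
    "\<forall>u\<in>U. \<exists>c. (\<forall>i<m. c i \<in> carrier R) \<and> u = msum M m (\<lambda>i. c i \<odot>\<^bsub>M\<^esub> x i)"
  using assms unfolding fgen_def lcomb_gen_def by blast

lemma fgen_upd [simp]: "fgen R (M\<lparr>carrier := V\<rparr>) U = fgen R M U"
  by (simp add: fgen_def lcomb_gen_def)

context left_module
begin

lemma span_submodule: "S \<subseteq> carrier M \<Longrightarrow> submodule (module_span R M S) R M"
  using submoduleD carrier_submodule by (intro submoduleI) (auto simp: module_span_def)

lemma lcomb_submodule:
  assumes "\<And>i. i < m \<Longrightarrow> x i \<in> carrier M"
  shows "submodule {u. \<exists>c. (\<forall>i<m. c i \<in> carrier R) \<and> u = msum M m (\<lambda>i. c i \<odot>\<^bsub>M\<^esub> x i)} R M"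
    (is "submodule ?U R M")
proof (rule submoduleI)
  show "?U \<subseteq> carrier M" using assms by (auto intro!: msum_closed)
  have "\<zero>\<^bsub>M\<^esub> = msum M m (\<lambda>i. \<zero> \<odot>\<^bsub>M\<^esub> x i)" using assms by (intro msum_zero[symmetric]) simp
  then show "\<zero>\<^bsub>M\<^esub> \<in> ?U" by (intro CollectI exI[of _ "\<lambda>i. \<zero>"]) simp
next
  fix a b assume "a \<in> ?U" "b \<in> ?U"
  then obtain c d where c: "\<forall>i<m. c i \<in> carrier R" "a = msum M m (\<lambda>i. c i \<odot>\<^bsub>M\<^esub> x i)"
    and d: "\<forall>i<m. d i \<in> carrier R" "b = msum M m (\<lambda>i. d i \<odot>\<^bsub>M\<^esub> x i)" by blast
  have "a \<oplus>\<^bsub>M\<^esub> b = msum M m (\<lambda>i. c i \<odot>\<^bsub>M\<^esub> x i \<oplus>\<^bsub>M\<^esub> d i \<odot>\<^bsub>M\<^esub> x i)"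
    using c d assms by (simp add: msum_add)
  also have "\<dots> = msum M m (\<lambda>i. (c i \<oplus> d i) \<odot>\<^bsub>M\<^esub> x i)"
    using c d assms by (intro msum_cong) (simp add: smult_l_distr)
  finally show "a \<oplus>\<^bsub>M\<^esub> b \<in> ?U" using c d by (intro CollectI exI[of _ "\<lambda>i. c i \<oplus> d i"]) simp
next
  fix a b assume a: "a \<in> carrier R" and "b \<in> ?U"
  then obtain c where c: "\<forall>i<m. c i \<in> carrier R" "b = msum M m (\<lambda>i. c i \<odot>\<^bsub>M\<^esub> x i)" by blast
  have "a \<odot>\<^bsub>M\<^esub> b = msum M m (\<lambda>i. a \<odot>\<^bsub>M\<^esub> (c i \<odot>\<^bsub>M\<^esub> x i))"
    using a c assms by (simp add: msum_smult)
  also have "\<dots> = msum M m (\<lambda>i. (a \<otimes> c i) \<odot>\<^bsub>M\<^esub> x i)"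
    using a c assms by (intro msum_cong) (simp add: smult_assoc1)
  finally show "a \<odot>\<^bsub>M\<^esub> b \<in> ?U" using a c by (intro CollectI exI[of _ "\<lambda>i. a \<otimes> c i"]) simp
qed

lemma lcomb_unit:
  assumes "\<And>i. i < m \<Longrightarrow> x i \<in> carrier M" "j < m"
  shows "\<exists>c. (\<forall>i<m. c i \<in> carrier R) \<and> x j = msum M m (\<lambda>i. c i \<odot>\<^bsub>M\<^esub> x i)"
proof -
  have "msum M m (\<lambda>i. (if i = j then \<one> else \<zero>) \<odot>\<^bsub>M\<^esub> x i) = x j"
    by (rule msum_single[OF assms(2)]) (use assms in auto)
  then show ?thesis by (intro exI[of _ "\<lambda>i. if i = j then \<one> else \<zero>"]) auto
qed

text \<open>The linear combinations of a finite family form a submodule containing it, so they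
  contain the span, which is an intersection of such submodules.\<close>

lemma fg_module_iff: "fg_module R M \<longleftrightarrow> fgen R M (carrier M)"
proof
  assume "fg_module R M"
  then obtain S where S: "finite S" "S \<subseteq> carrier M" "module_span R M S = carrier M"
    by (auto simp: fg_module_def)
  obtain s where s: "bij_betw s {0..<card S} S"
    using ex_bij_betw_nat_finite[OF S(1)] by blast
  define m where "m = card S"
  have s_in: "s i \<in> carrier M" if "i < m" for i
    using s S(2) that by (auto simp: m_def bij_betw_def)
  let ?U = "{u. \<exists>c. (\<forall>i<m. c i \<in> carrier R) \<and> u = msum M m (\<lambda>i. c i \<odot>\<^bsub>M\<^esub> s i)}"
  have sub: "submodule ?U R M" by (rule lcomb_submodule) (rule s_in)
  have "S \<subseteq> ?U"
  proof
    fix y assume "y \<in> S"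
    then obtain j where "j < m" "y = s j"
      using s by (metis m_def bij_betw_imp_surj_on imageE atLeastLessThan_iff)
    then show "y \<in> ?U" using lcomb_unit[of m s j] s_in by auto
  qed
  then have "carrier M \<subseteq> ?U" using sub unfolding S(3)[symmetric] module_span_def by blast
  then show "fgen R M (carrier M)" using s_in by (intro fgenI[of m s]) auto
next
  assume "fgen R M (carrier M)"
  then obtain m x where x: "\<forall>i<m. x i \<in> carrier M"
    "\<forall>u\<in>carrier M. \<exists>c. (\<forall>i<m. c i \<in> carrier R) \<and> u = msum M m (\<lambda>i. c i \<odot>\<^bsub>M\<^esub> x i)"
    by (rule fgenE)
  have S: "x ` {..<m} \<subseteq> carrier M" using x by auto
  have sp: "submodule (module_span R M (x ` {..<m})) R M" by (rule span_submodule[OF S])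
  have "x i \<in> module_span R M (x ` {..<m})" if "i < m" for i
    using that by (auto simp: module_span_def)
  then have *: "msum M m (\<lambda>i. c i \<odot>\<^bsub>M\<^esub> x i) \<in> module_span R M (x ` {..<m})"
    if "\<forall>i<m. c i \<in> carrier R" for c
    using that by (intro msum_in_submodule[OF sp] submoduleD(4)[OF sp]) auto
  have "carrier M \<subseteq> module_span R M (x ` {..<m})"
  proof
    fix u assume "u \<in> carrier M"
    then obtain c where "\<forall>i<m. c i \<in> carrier R" "u = msum M m (\<lambda>i. c i \<odot>\<^bsub>M\<^esub> x i)"
      using x(2) by blast
    then show "u \<in> module_span R M (x ` {..<m})" using * by simp
  qed
  then have "module_span R M (x ` {..<m}) = carrier M" using submoduleD(1)[OF sp] by auto
  then show "fg_module R M"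
    unfolding fg_module_def using S left_module_axioms by blast
qed

end

lemma fg_iff: "fg_module R M \<longleftrightarrow> left_module R M \<and> fgen R M (carrier M)"
  using left_module.fg_module_iff fg_module_def by blast

lemma fg_left_module: "fg_module R M \<Longrightarrow> left_module R M"
  by (simp add: fg_module_def)

lemma fg_image:
  assumes f: "lin R M N f" and N: "left_module R N" and fg: "fg_module R M"
    and surj: "f ` carrier M = carrier N"
  shows "fg_module R N"
proof -
  have M: "left_module R M" using fg by (simp add: fg_module_def)
  interpret M: left_module R M by fact
  obtain m x where x: "\<forall>i<m. x i \<in> carrier M"
    "\<forall>u\<in>carrier M. \<exists>c. (\<forall>i<m. c i \<in> carrier R) \<and> u = msum M m (\<lambda>i. c i \<odot>\<^bsub>M\<^esub> x i)"
    using fg unfolding fg_iff fgen_def lcomb_gen_def by blast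
  have "fgen R N (carrier N)"
  proof (rule fgenI[of m "\<lambda>i. f (x i)"])
    fix u assume "u \<in> carrier N"
    then obtain v where v: "v \<in> carrier M" "u = f v" using surj by auto
    obtain c where c: "\<forall>i<m. c i \<in> carrier R" "v = msum M m (\<lambda>i. c i \<odot>\<^bsub>M\<^esub> x i)" using x(2) v by blast
    have "f v = msum N m (\<lambda>i. f (c i \<odot>\<^bsub>M\<^esub> x i))"
      unfolding c(2) by (rule msum_lin(2)[OF f M N]) (use c x in auto)
    also have "\<dots> = msum N m (\<lambda>i. c i \<odot>\<^bsub>N\<^esub> f (x i))"
      by (rule msum_cong) (use c x lin_smult[OF f] in auto)
    finally show "\<exists>c. (\<forall>i<m. c i \<in> carrier R) \<and> u = msum N m (\<lambda>i. c i \<odot>\<^bsub>N\<^esub> f (x i))"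
      using c v by blast
  qed (use x lin_closed[OF f] in auto)
  then show ?thesis using N by (simp add: fg_iff)
qed

section \<open>Powers and free covers\<close>

lemma regular_left_module: "ring R \<Longrightarrow> left_module R (regular_mod R)"
proof -
  assume "ring R"
  then interpret ring R .
  have "abelian_group (regular_mod R)"
  proof (rule abelian_groupI, goal_cases)
    case (6 x)
    then show ?case by (intro bexI[of _ "\<ominus>\<^bsub>R\<^esub> x"]) (auto simp: regular_mod_def l_neg)
  qed (auto simp: regular_mod_def a_ac)
  then show ?thesis
    by (intro left_module.intro ring_axioms left_module_axioms.intro)
       (auto simp: regular_mod_def l_distr r_distr m_assoc)
qed

lemma power_mod_simps:
  "v \<in> carrier (power_mod M m) \<longleftrightarrow> v \<in> {..<m} \<rightarrow>\<^sub>E carrier M"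
  "i < m \<Longrightarrow> (v \<oplus>\<^bsub>power_mod M m\<^esub> w) i = v i \<oplus>\<^bsub>M\<^esub> w i"
  "i < m \<Longrightarrow> (a \<odot>\<^bsub>power_mod M m\<^esub> v) i = a \<odot>\<^bsub>M\<^esub> v i"
  "i < m \<Longrightarrow> \<zero>\<^bsub>power_mod M m\<^esub> i = \<zero>\<^bsub>M\<^esub>"
  by (auto simp: power_mod_def)

lemma power_mod_eqI:
  assumes "v \<in> carrier (power_mod M m)" "w \<in> carrier (power_mod M m)" "\<And>i. i < m \<Longrightarrow> v i = w i"
  shows "v = w"
proof (rule PiE_ext)
  show "v \<in> {..<m} \<rightarrow>\<^sub>E carrier M" "w \<in> {..<m} \<rightarrow>\<^sub>E carrier M"
    using assms(1,2) by (simp_all add: power_mod_def)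
qed (use assms(3) in auto)

lemma power_modD: "v \<in> carrier (power_mod M m) \<Longrightarrow> i < m \<Longrightarrow> v i \<in> carrier M"
  by (auto simp: power_mod_def)

lemma power_modI:
  "(\<And>i. i < m \<Longrightarrow> f i \<in> carrier M) \<Longrightarrow> (\<lambda>i\<in>{..<m}. f i) \<in> carrier (power_mod M m)"
  by (auto simp: power_mod_def)

lemma power_left_module:
  assumes "left_module R M"
  shows "left_module R (power_mod M m)"
proof -
  interpret left_module R M by fact
  have add: "v \<oplus>\<^bsub>power_mod M m\<^esub> w \<in> carrier (power_mod M m)"
    if "v \<in> carrier (power_mod M m)" "w \<in> carrier (power_mod M m)" for v w
    using power_modD[OF that(1)] power_modD[OF that(2)] by (auto simp: power_mod_def)
  have smult: "a \<odot>\<^bsub>power_mod M m\<^esub> v \<in> carrier (power_mod M m)"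
    if "a \<in> carrier R" "v \<in> carrier (power_mod M m)" for a v
    using power_modD[OF that(2)] that(1) by (auto simp: power_mod_def)
  have zero: "\<zero>\<^bsub>power_mod M m\<^esub> \<in> carrier (power_mod M m)" by (auto simp: power_mod_def)
  have "abelian_group (power_mod M m)"
  proof (rule abelian_groupI, goal_cases)
    case (3 x y z)
    then show ?case
      by (intro power_mod_eqI[of _ M m] add) (simp_all add: power_mod_simps(2-4) power_modD M.a_assoc)
  next
    case (4 x y)
    then show ?case
      by (intro power_mod_eqI[of _ M m] add) (simp_all add: power_mod_simps(2-4) power_modD M.a_comm)
  next
    case (5 x)
    then show ?case
      by (intro power_mod_eqI[of _ M m] add zero) (simp_all add: power_mod_simps(2-4) power_modD)
  next
    case (6 x)
    have i: "(\<lambda>i\<in>{..<m}. \<ominus>\<^bsub>M\<^esub> x i) \<in> carrier (power_mod M m)"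
      using power_modD[OF 6] by (intro power_modI) simp
    have "(\<lambda>i\<in>{..<m}. \<ominus>\<^bsub>M\<^esub> x i) \<oplus>\<^bsub>power_mod M m\<^esub> x = \<zero>\<^bsub>power_mod M m\<^esub>"
      using 6 i by (intro power_mod_eqI[of _ M m] add zero) (simp_all add: power_mod_simps(2-4) power_modD M.l_neg)
    then show ?case using i by blast
  qed (use add zero in auto)
  then show ?thesis
  proof (intro left_module.intro R.ring_axioms left_module_axioms.intro, goal_cases)
    case (3 a b x)
    then show ?case
      by (intro power_mod_eqI[of _ M m] add smult)
        (simp_all add: power_mod_simps(2-4) power_modD smult_l_distr)
  next
    case (4 a x y)
    then show ?case
      by (intro power_mod_eqI[of _ M m] add smult)
        (simp_all add: power_mod_simps(2-4) power_modD smult_r_distr)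
  next
    case (5 a b x)
    then show ?case
      by (intro power_mod_eqI[of _ M m] add smult)
        (simp_all add: power_mod_simps(2-4) power_modD smult_assoc1)
  next
    case (6 x)
    then show ?case
      by (intro power_mod_eqI[of _ M m] add smult) (simp_all add: power_mod_simps(2-4) power_modD)
  qed (use smult in auto)
qed

lemma power_proj_lin: "i < m \<Longrightarrow> lin R (power_mod M m) M (\<lambda>v. v i)"
  by (auto simp: lin_def power_mod_simps)

lemma power_tuple_lin:
  assumes X: "left_module R X" and M: "left_module R M" and f: "\<And>i. i < m \<Longrightarrow> lin R X M (f i)"
  shows "lin R X (power_mod M m) (\<lambda>x. \<lambda>i\<in>{..<m}. f i x)"
proof -
  interpret X: left_module R X by fact
  interpret P: left_module R "power_mod M m" by (rule power_left_module[OF M])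
  have c: "(\<lambda>i\<in>{..<m}. f i x) \<in> carrier (power_mod M m)" if "x \<in> carrier X" for x
    by (rule power_modI) (rule lin_closed[OF f that])
  show ?thesis
  proof (rule linI[OF c])
    fix x y assume xy: "x \<in> carrier X" "y \<in> carrier X"
    show "(\<lambda>i\<in>{..<m}. f i (x \<oplus>\<^bsub>X\<^esub> y)) = (\<lambda>i\<in>{..<m}. f i x) \<oplus>\<^bsub>power_mod M m\<^esub> (\<lambda>i\<in>{..<m}. f i y)"
      by (rule power_mod_eqI[OF c[OF X.M.a_closed[OF xy]] P.M.a_closed[OF c[OF xy(1)] c[OF xy(2)]]])
        (simp add: power_mod_simps(2) lin_add[OF f xy])
  next
    fix a x assume ax: "a \<in> carrier R" "x \<in> carrier X"
    show "(\<lambda>i\<in>{..<m}. f i (a \<odot>\<^bsub>X\<^esub> x)) = a \<odot>\<^bsub>power_mod M m\<^esub> (\<lambda>i\<in>{..<m}. f i x)"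
      by (rule power_mod_eqI[OF c[OF X.smult_closed[OF ax]] P.smult_closed[OF ax(1) c[OF ax(2)]]])
        (simp add: power_mod_simps(3) lin_smult[OF f ax])
  qed
qed

lemma regular_simps [simp]:
  "carrier (regular_mod R) = carrier R" "a \<odot>\<^bsub>regular_mod R\<^esub> b = a \<otimes>\<^bsub>R\<^esub> b"
  "a \<oplus>\<^bsub>regular_mod R\<^esub> b = a \<oplus>\<^bsub>R\<^esub> b" "\<zero>\<^bsub>regular_mod R\<^esub> = \<zero>\<^bsub>R\<^esub>"
  by (simp_all add: regular_mod_def)

lemma lin_coeff_smult:
  assumes c: "lin R P (regular_mod R) c" and Y: "left_module R Y" and y: "y \<in> carrier Y"
  shows "lin R P Y (\<lambda>v. c v \<odot>\<^bsub>Y\<^esub> y)"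
proof -
  interpret Y: left_module R Y by fact
  show ?thesis using lin_closed[OF c] y
    by (intro linI) (simp_all add: lin_add[OF c] lin_smult[OF c] Y.smult_l_distr Y.smult_assoc1)
qed

lemma free_cover:
  assumes "fg_module R X"
  shows "\<exists>m p. lin R (power_mod (regular_mod R) m) X p \<and> p ` carrier (power_mod (regular_mod R) m) = carrier X"
proof -
  have X: "left_module R X" using assms by (rule fg_left_module)
  interpret X: left_module R X by fact
  have R: "ring R" by (rule X.R.ring_axioms)
  obtain m x where x: "\<forall>i<m. x i \<in> carrier X"
    "\<forall>u\<in>carrier X. \<exists>c. (\<forall>i<m. c i \<in> carrier R) \<and> u = msum X m (\<lambda>i. c i \<odot>\<^bsub>X\<^esub> x i)"
    using assms unfolding fg_iff fgen_def lcomb_gen_def by blast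
  let ?P = "power_mod (regular_mod R) m" and ?p = "\<lambda>v. msum X m (\<lambda>i. v i \<odot>\<^bsub>X\<^esub> x i)"
  have P: "left_module R ?P" by (intro power_left_module regular_left_module R)
  have p: "lin R ?P X ?p"
    by (rule lin_msum[OF _ P X], rule lin_coeff_smult[OF power_proj_lin X]) (use x in auto)
  have "carrier X \<subseteq> ?p ` carrier ?P"
  proof
    fix u assume "u \<in> carrier X"
    then obtain c where c: "\<forall>i<m. c i \<in> carrier R" "u = msum X m (\<lambda>i. c i \<odot>\<^bsub>X\<^esub> x i)" using x(2) by blast
    have "(\<lambda>i\<in>{..<m}. c i) \<in> carrier ?P" using c(1) by (intro power_modI) simp
    moreover have "u = ?p (\<lambda>i\<in>{..<m}. c i)" unfolding c(2) by (rule msum_cong) simp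
    ultimately show "u \<in> ?p ` carrier ?P" by (intro image_eqI[of u ?p "\<lambda>i\<in>{..<m}. c i"])
  qed
  then show ?thesis using p lin_closed[OF p] by blast
qed

context left_module
begin

lemma submodule_inter: "submodule U R M \<Longrightarrow> submodule V R M \<Longrightarrow> submodule (U \<inter> V) R M"
  using submoduleD[of U] submoduleD[of V] by (intro submoduleI) (simp_all add: le_infI1)

lemma fgen_zero: "fgen R M {\<zero>\<^bsub>M\<^esub>}"
  by (rule fgenI[of 0]) auto

text \<open>The generators of \<open>U\<close> are the \<open>g j\<close>, followed by generators of
  \<open>U'\<close> for the remainders.\<close>

lemma fgen_step:
  assumes U: "submodule U R M" and U': "fgen R M U'" "U' \<subseteq> U" and g: "\<And>j. j < s \<Longrightarrow> g j \<in> U"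
    and red: "\<And>u. u \<in> U \<Longrightarrow> \<exists>a. (\<forall>j<s. a j \<in> carrier R) \<and> u \<ominus>\<^bsub>M\<^esub> msum M s (\<lambda>j. a j \<odot>\<^bsub>M\<^esub> g j) \<in> U'"
  shows "fgen R M U"
proof -
  note UD = submoduleD[OF U]
  obtain t y where y: "\<forall>i<t. y i \<in> U'"
    "\<forall>u\<in>U'. \<exists>c. (\<forall>i<t. c i \<in> carrier R) \<and> u = msum M t (\<lambda>i. c i \<odot>\<^bsub>M\<^esub> y i)"
    using U'(1) unfolding fgen_def lcomb_gen_def by blast
  have yM: "y i \<in> carrier M" if "i < t" for i using y(1) U'(2) UD(1) that by blast
  have gM: "g i \<in> carrier M" if "i < s" for i using g UD(1) that by blast
  show ?thesis
  proof (rule fgenI[of "s + t" "\<lambda>i. if i < s then g i else y (i - s)"])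
    fix i assume "i < s + t"
    then show "(if i < s then g i else y (i - s)) \<in> U" using g y(1) U'(2) by auto
  next
    fix u assume u: "u \<in> U"
    obtain a where a: "\<forall>j<s. a j \<in> carrier R" "u \<ominus>\<^bsub>M\<^esub> msum M s (\<lambda>j. a j \<odot>\<^bsub>M\<^esub> g j) \<in> U'"
      using red[OF u] by blast
    then obtain c where c: "\<forall>i<t. c i \<in> carrier R"
      "u \<ominus>\<^bsub>M\<^esub> msum M s (\<lambda>j. a j \<odot>\<^bsub>M\<^esub> g j) = msum M t (\<lambda>i. c i \<odot>\<^bsub>M\<^esub> y i)"
      using y(2) by blast
    let ?d = "\<lambda>i. if i < s then a i else c (i - s)"
    have "msum M (s + t) (\<lambda>i. ?d i \<odot>\<^bsub>M\<^esub> (if i < s then g i else y (i - s))) =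
      msum M (s + t) (\<lambda>i. if i < s then a i \<odot>\<^bsub>M\<^esub> g i else c (i - s) \<odot>\<^bsub>M\<^esub> y (i - s))"
      by (rule msum_cong) simp
    also have "\<dots> = msum M s (\<lambda>j. a j \<odot>\<^bsub>M\<^esub> g j) \<oplus>\<^bsub>M\<^esub> msum M t (\<lambda>i. c i \<odot>\<^bsub>M\<^esub> y i)"
      by (rule msum_append) (use a c gM yM in auto)
    also have "\<dots> = u"
      unfolding c(2)[symmetric] using a gM UD(1) u by (intro add_diff) (auto intro!: msum_closed)
    finally show "\<exists>c. (\<forall>i<s + t. c i \<in> carrier R) \<and>
        u = msum M (s + t) (\<lambda>i. c i \<odot>\<^bsub>M\<^esub> (if i < s then g i else y (i - s)))"
      using a(1) c(1) by (intro exI[of _ ?d]) auto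
  qed
qed

end

text \<open>Preimages of generators of the image, together with generators of the kernel, generate
  \<open>U\<close>.\<close>

lemma fgen_ext:
  assumes f: "lin R M N f" and M: "left_module R M" and N: "left_module R N" and U: "submodule U R M"
    and im: "fgen R N (f ` U)" and k: "fgen R M {u \<in> U. f u = \<zero>\<^bsub>N\<^esub>}"
  shows "fgen R M U"
proof -
  interpret M: left_module R M by fact
  interpret N: left_module R N by fact
  note UD = M.submoduleD[OF U]
  obtain s z where z: "\<forall>i<s. z i \<in> f ` U"
    "\<forall>u\<in>f ` U. \<exists>c. (\<forall>i<s. c i \<in> carrier R) \<and> u = msum N s (\<lambda>i. c i \<odot>\<^bsub>N\<^esub> z i)"
    using im unfolding fgen_def lcomb_gen_def by blast
  obtain g where g: "\<And>i. i < s \<Longrightarrow> g i \<in> U" "\<And>i. i < s \<Longrightarrow> z i = f (g i)"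
    using z(1) unfolding image_iff Bex_def by metis
  have gM: "g i \<in> carrier M" if "i < s" for i using g UD(1) that by blast
  show ?thesis
  proof (rule M.fgen_step[OF U k _ g(1)])
    fix u assume u: "u \<in> U"
    then obtain c where c: "\<forall>i<s. c i \<in> carrier R" "f u = msum N s (\<lambda>i. c i \<odot>\<^bsub>N\<^esub> z i)" using z(2) by blast
    let ?v = "msum M s (\<lambda>i. c i \<odot>\<^bsub>M\<^esub> g i)"
    have vU: "?v \<in> U" by (rule M.msum_in_submodule[OF U]) (use UD(4) c g in auto)
    have "f ?v = msum N s (\<lambda>i. f (c i \<odot>\<^bsub>M\<^esub> g i))"
      by (rule msum_lin[OF f M N]) (use c gM in auto)
    also have "\<dots> = f u" unfolding c(2) by (rule msum_cong) (use c g gM lin_smult[OF f] in auto)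
    finally have "f (u \<ominus>\<^bsub>M\<^esub> ?v) = \<zero>\<^bsub>N\<^esub>"
      using u vU UD(1) lin_closed[OF f] N.eq_iff_diff[of "f u" "f u"] by (simp add: lin_diff[OF f M N] subset_iff)
    then show "\<exists>a. (\<forall>j<s. a j \<in> carrier R) \<and> u \<ominus>\<^bsub>M\<^esub> msum M s (\<lambda>j. a j \<odot>\<^bsub>M\<^esub> g j) \<in> {u \<in> U. f u = \<zero>\<^bsub>N\<^esub>}"
      using c M.submodule_diff[OF U u vU] by blast
  qed auto
qed

section \<open>Noetherian modules and commutative Artinian rings\<close>

definition noeth_mod :: "('a, 'r) ring_scheme \<Rightarrow> ('a, 'x, 's) module_scheme \<Rightarrow> bool" where
  "noeth_mod R M \<longleftrightarrow> left_module R M \<and> (\<forall>U. submodule U R M \<longrightarrow> fgen R M U)"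

text \<open>Induction on a number \<open>t\<close> such that the first \<open>t\<close> coordinates
  determine the elements of the submodule. Projection to the last of these has finitely generated
  image, and elements of its kernel are determined by one coordinate less.\<close>

lemma noeth_power:
  assumes "noeth_mod R N"
  shows "noeth_mod R (power_mod N T)"
proof -
  have N: "left_module R N" using assms by (simp add: noeth_mod_def)
  let ?P = "power_mod N T"
  have P: "left_module R ?P" by (rule power_left_module[OF N])
  interpret P: left_module R ?P by fact
  have "fgen R ?P U" if "submodule U R ?P" "t \<le> T" "\<And>u. u \<in> U \<Longrightarrow> \<forall>i<t. u i = \<zero>\<^bsub>N\<^esub> \<Longrightarrow> u = \<zero>\<^bsub>?P\<^esub>" for U t
    using that
  proof (induction t arbitrary: U)
    case 0
    then have "U = {\<zero>\<^bsub>?P\<^esub>}" using P.submoduleD(2) by force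
    then show ?case using P.fgen_zero by simp
  next
    case (Suc t)
    have pt: "lin R ?P N (\<lambda>v. v t)" by (rule power_proj_lin) (use Suc in auto)
    let ?V = "{u \<in> U. u t = \<zero>\<^bsub>N\<^esub>}"
    have "?V = U \<inter> ker ?P N (\<lambda>v. v t)" using P.submoduleD(1)[OF Suc.prems(1)] by (auto simp: ker_def)
    moreover have "submodule (U \<inter> ker ?P N (\<lambda>v. v t)) R ?P"
      by (rule P.submodule_inter[OF Suc.prems(1) ker_submodule[OF pt P N]])
    ultimately have V: "submodule ?V R ?P" by simp
    have "fgen R ?P ?V"
      by (rule Suc.IH[OF V]) (use Suc.prems in \<open>auto simp: less_Suc_eq\<close>)
    moreover have "fgen R N ((\<lambda>v. v t) ` U)"
      using assms image_submodule[OF pt P N Suc.prems(1)] by (simp add: noeth_mod_def)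
    ultimately show ?case by (intro fgen_ext[OF pt P N Suc.prems(1)])
  qed
  moreover have "u = \<zero>\<^bsub>?P\<^esub>" if "u \<in> carrier ?P" "\<forall>i<T. u i = \<zero>\<^bsub>N\<^esub>" for u
    by (rule power_mod_eqI[OF that(1)]) (use that in \<open>simp_all add: power_mod_simps(4)\<close>)
  ultimately have "fgen R ?P U" if "submodule U R ?P" for U
    using that P.submoduleD(1)[OF that] by blast
  then show ?thesis using P by (simp add: noeth_mod_def)
qed

lemma noeth_image:
  assumes N: "noeth_mod R N" and p: "lin R N M p" "p ` carrier N = carrier M" and M: "left_module R M"
  shows "noeth_mod R M"
  unfolding noeth_mod_def
proof (intro conjI allI impI M)
  fix U assume U: "submodule U R M"
  have NL: "left_module R N" using N by (simp add: noeth_mod_def)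
  interpret N: left_module R N by (rule NL)
  note UD = left_module.submoduleD[OF M U]
  let ?V = "{x \<in> carrier N. p x \<in> U}"
  have V: "submodule ?V R N"
    by (rule N.submoduleI) (auto simp: lin_zero[OF p(1) NL M] lin_add[OF p(1)] lin_smult[OF p(1)] UD)
  have VL: "left_module R (N\<lparr>carrier := ?V\<rparr>)" by (rule N.submodule_left_module[OF V])
  have UL: "left_module R (M\<lparr>carrier := U\<rparr>)" by (rule left_module.submodule_left_module[OF M U])
  have fg: "fg_module R (N\<lparr>carrier := ?V\<rparr>)" using N V VL by (simp add: fg_iff noeth_mod_def)
  have l: "lin R (N\<lparr>carrier := ?V\<rparr>) (M\<lparr>carrier := U\<rparr>) p"
    by (rule lin_codom[OF lin_dom[OF p(1)]]) auto
  have "U \<subseteq> p ` ?V"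
  proof
    fix u assume u: "u \<in> U"
    then have "u \<in> p ` carrier N" unfolding p(2) using UD(1) by blast
    then obtain x where "u = p x" "x \<in> carrier N" by (rule imageE)
    then show "u \<in> p ` ?V" using u by simp
  qed
  then have "p ` ?V = U" by auto
  then have "fg_module R (M\<lparr>carrier := U\<rparr>)" using fg_image[OF l UL fg] by simp
  then show "fgen R M U" by (simp add: fg_iff)
qed

section \<open>Commutative Artinian rings are Noetherian\<close>

lemma cring_submodule_ideal:
  assumes "cring K" "submodule I K (regular_mod K)"
  shows "ideal I K"
proof -
  interpret cring K by fact
  interpret N: left_module K "regular_mod K" by (rule regular_left_module) (rule ring_axioms)
  note ID = N.submoduleD[OF assms(2)]
  have sub: "I \<subseteq> carrier K" using ID(1) by (simp add: regular_mod_def)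
  show ?thesis
  proof (rule idealI[OF ring_axioms])
    have "\<ominus>\<^bsub>K\<^esub> a \<in> I" if "a \<in> I" for a
      using ID(4)[of "\<ominus>\<^bsub>K\<^esub> \<one>\<^bsub>K\<^esub>" a] that sub by (auto simp: regular_mod_def l_minus)
    then show "subgroup I (add_monoid K)"
      using sub ID(2,3) by (intro add.subgroupI) (auto simp: regular_mod_def)
  next
    fix a x assume ax: "a \<in> I" "x \<in> carrier K"
    then show "x \<otimes>\<^bsub>K\<^esub> a \<in> I" using ID(4)[of x a] by (simp add: regular_mod_def)
    then show "a \<otimes>\<^bsub>K\<^esub> x \<in> I" using ax sub by (auto simp: m_comm)
  qed
qed

text \<open>Otherwise dependent choice would produce a strictly descending sequence of
  ideals.\<close>

lemma artinian_minimal: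
  assumes K: "artinian_cring K" and I: "I \<in> \<S>" and \<S>: "\<And>J. J \<in> \<S> \<Longrightarrow> submodule J K (regular_mod K)"
  shows "\<exists>J\<in>\<S>. \<forall>J'\<in>\<S>. J' \<subseteq> J \<longrightarrow> J' = J"
proof (rule ccontr)
  assume "\<not> ?thesis"
  then have *: "\<exists>J'. J' \<in> \<S> \<and> J' \<subset> J" if "J \<in> \<S>" for J using that by blast
  have "\<exists>f. \<forall>i::nat. f i \<in> \<S> \<and> f (Suc i) \<subset> f i"
    by (rule dependent_nat_choice) (use I * in auto)
  then obtain f :: "nat \<Rightarrow> _" where f: "\<And>i. f i \<in> \<S>" "\<And>i. f (Suc i) \<subset> f i" by blast
  have "\<exists>m. \<forall>i\<ge>m. f i = f m"
    using K f cring_submodule_ideal[OF _ \<S>] unfolding artinian_cring_def by (meson psubset_imp_subset)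
  then obtain m where "f (Suc m) = f m" by (metis le_Suc_eq order_refl)
  then show False using f(2)[of m] by simp
qed

text \<open>
  In an ideal \<open>I\<close> that is minimal among the ideals that are not finitely generated, every scalar
  acts as zero or invertibly, so that \<open>I\<close> is in effect a vector space all of whose proper
  subspaces are finite-dimensional.
\<close>

lemma (in cring) artinian_noeth:
  assumes R: "artinian_cring R"
  shows "noeth_mod R (regular_mod R)"
proof (rule ccontr)
  let ?N = "regular_mod R"
  have N: "left_module R ?N" by (rule regular_left_module) (rule ring_axioms)
  interpret N: left_module R ?N by fact
  have Ns: "carrier ?N = carrier R" "\<zero>\<^bsub>?N\<^esub> = \<zero>" "\<And>a b. a \<odot>\<^bsub>?N\<^esub> b = a \<otimes> b" "\<And>a b. a \<oplus>\<^bsub>?N\<^esub> b = a \<oplus> b"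
    by (simp_all add: regular_mod_def)
  assume "\<not> noeth_mod R ?N"
  then obtain I0 where "I0 \<in> {I. submodule I R ?N \<and> \<not> fgen R ?N I}" using N by (auto simp: noeth_mod_def)
  from artinian_minimal[OF R this] obtain I where I: "submodule I R ?N" "\<not> fgen R ?N I"
    and min: "\<And>J. submodule J R ?N \<Longrightarrow> \<not> fgen R ?N J \<Longrightarrow> J \<subseteq> I \<Longrightarrow> J = I" by blast
  note ID = N.submoduleD[OF I(1), unfolded Ns]
  have IK: "x \<in> carrier R" if "x \<in> I" for x using that ID(1) by auto
  have mul: "lin R ?N ?N (\<lambda>x. a \<otimes> x)" if "a \<in> carrier R" for a
    using that by (auto simp: lin_def Ns r_distr m_lcomm)
  \<comment> \<open>If neither alternative holds, both the kernel and the image of multiplication by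
    \<open>a\<close> on \<open>I\<close> are proper submodules of \<open>I\<close>. They are
    finitely generated by minimality, and then so is \<open>I\<close>.\<close>
  have dich: "(\<forall>x\<in>I. a \<otimes> x = \<zero>) \<or> (\<lambda>x. a \<otimes> x) ` I = I" if a: "a \<in> carrier R" for a
  proof (rule ccontr)
    assume H: "\<not> ?thesis"
    let ?k = "{x \<in> I. a \<otimes> x = \<zero>\<^bsub>?N\<^esub>}"
    have im: "submodule ((\<lambda>x. a \<otimes> x) ` I) R ?N" by (rule image_submodule[OF mul[OF a] N N I(1)])
    have "?k = I \<inter> ker ?N ?N (\<lambda>x. a \<otimes> x)" using IK by (auto simp: ker_def Ns)
    then have k: "submodule ?k R ?N"
      using N.submodule_inter[OF I(1) ker_submodule[OF mul[OF a] N N]] by simp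
    have "(\<lambda>x. a \<otimes> x) ` I \<subseteq> I" using ID(4)[OF a] by auto
    then have "fgen R ?N ((\<lambda>x. a \<otimes> x) ` I)" using min[OF im] H by blast
    moreover have "?k \<noteq> I" using H by (auto simp: Ns)
    then have "fgen R ?N ?k" using min[OF k] by blast
    ultimately show False using fgen_ext[OF mul[OF a] N N I(1)] I(2) by blast
  qed
  \<comment> \<open>The ideals generated by the powers of \<open>a\<close> become stationary, which
    gives \<open>b\<close> with \<open>a\<^sup>m = b a\<^sup>m\<^sup>+\<^sup>1\<close>. As every
    element of \<open>I\<close> is a multiple of \<open>a\<^sup>m\<close> within \<open>I\<close>,
    the product \<open>b a\<close> acts as the identity on \<open>I\<close>.\<close>
  have inv: "\<exists>b\<in>carrier R. \<forall>x\<in>I. b \<otimes> (a \<otimes> x) = x"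
    if a: "a \<in> carrier R" and aI: "(\<lambda>x. a \<otimes> x) ` I = I" for a
  proof -
    have inc: "(\<lambda>r. r \<otimes> a [^] Suc m) ` carrier R \<subseteq> (\<lambda>r. r \<otimes> a [^] m) ` carrier R" for m :: nat
    proof
      fix y assume "y \<in> (\<lambda>r. r \<otimes> a [^] Suc m) ` carrier R"
      then obtain r where "r \<in> carrier R" "y = r \<otimes> a [^] Suc m" by blast
      then have "y = (r \<otimes> a) \<otimes> a [^] m" "r \<otimes> a \<in> carrier R" using a by (auto simp: m_ac)
      then show "y \<in> (\<lambda>r. r \<otimes> a [^] m) ` carrier R" by blast
    qed
    have "\<exists>J\<in>range (\<lambda>m::nat. (\<lambda>r. r \<otimes> a [^] m) ` carrier R).
      \<forall>J'\<in>range (\<lambda>m::nat. (\<lambda>r. r \<otimes> a [^] m) ` carrier R). J' \<subseteq> J \<longrightarrow> J' = J"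
    proof (rule artinian_minimal[OF R rangeI[of _ 0]])
      fix J assume "J \<in> range (\<lambda>m::nat. (\<lambda>r. r \<otimes> a [^] m) ` carrier R)"
      then obtain m :: nat where J: "J = (\<lambda>r. r \<otimes> a [^] m) ` carrier ?N" by (auto simp: Ns)
      have "lin R ?N ?N (\<lambda>r. r \<otimes> a [^] m)"
        using a by (intro linI) (simp_all add: Ns l_distr m_assoc)
      from image_submodule[OF this N N N.carrier_submodule] show "submodule J R ?N" unfolding J .
    qed
    then obtain m :: nat where "\<forall>J'\<in>range (\<lambda>m::nat. (\<lambda>r. r \<otimes> a [^] m) ` carrier R).
        J' \<subseteq> (\<lambda>r. r \<otimes> a [^] m) ` carrier R \<longrightarrow> J' = (\<lambda>r. r \<otimes> a [^] m) ` carrier R"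
      by (elim bexE rangeE) simp
    from bspec[OF this rangeI[of _ "Suc m"]] inc[of m]
    have "(\<lambda>r. r \<otimes> a [^] Suc m) ` carrier R = (\<lambda>r. r \<otimes> a [^] m) ` carrier R"
      by (rule mp)
    moreover have "\<one> \<otimes> a [^] m \<in> (\<lambda>r. r \<otimes> a [^] m) ` carrier R" by (rule imageI) simp
    ultimately have "\<one> \<otimes> a [^] m \<in> (\<lambda>r. r \<otimes> a [^] Suc m) ` carrier R" by (rule ssubst)
    then obtain b where b: "b \<in> carrier R" "a [^] m = b \<otimes> a [^] Suc m" using a by auto
    have pw: "(\<lambda>x. a [^] (k::nat) \<otimes> x) ` I = I" for k
    proof (induction k)
      case 0 then show ?case using IK by (auto simp: image_iff)
    next
      case (Suc k)
      have "(\<lambda>x. a [^] Suc k \<otimes> x) ` I = (\<lambda>x. a [^] k \<otimes> (a \<otimes> x)) ` I"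
        by (rule image_cong) (use a IK in \<open>auto simp: m_assoc\<close>)
      also have "\<dots> = (\<lambda>x. a [^] k \<otimes> x) ` ((\<lambda>x. a \<otimes> x) ` I)" by (simp add: image_image)
      finally show ?case using aI Suc by simp
    qed
    have "b \<otimes> (a \<otimes> x) = x" if "x \<in> I" for x
    proof -
      have "x \<in> (\<lambda>x. a [^] m \<otimes> x) ` I" unfolding pw by (rule that)
      then obtain y where y: "x = a [^] m \<otimes> y" "y \<in> I" by (rule imageE)
      have "b \<otimes> (a \<otimes> x) = (b \<otimes> a [^] Suc m) \<otimes> y"
        unfolding y(1) using a b(1) IK[OF y(2)] by (simp add: m_ac)
      then show ?thesis unfolding b(2)[symmetric] y(1) .
    qed
    then show ?thesis using b(1) by blast
  qed
  have "I \<noteq> {\<zero>}" using I(2) N.fgen_zero by (auto simp: Ns)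
  then obtain x where x: "x \<in> I" "x \<noteq> \<zero>" using ID(2) by blast
  \<comment> \<open>A maximal submodule of \<open>I\<close> that avoids \<open>x\<close> plays the
    part of a hyperplane complementary to the line through \<open>x\<close>. It is proper, hence
    finitely generated, and adding \<open>x\<close> will be shown to exhaust
    \<open>I\<close>.\<close>
  define \<W> where "\<W> = {W. submodule W R ?N \<and> W \<subseteq> I \<and> x \<notin> W}"
  have "\<exists>W\<in>\<W>. \<forall>X\<in>\<W>. W \<subseteq> X \<longrightarrow> X = W"
  proof (rule subset_Zorn_nonempty)
    show "\<W> \<noteq> {}" using N.zero_submodule x ID(2) by (auto simp: \<W>_def Ns)
  next
    fix C assume C: "C \<noteq> {}" "subset.chain \<W> C"
    have CW: "W \<in> C \<Longrightarrow> submodule W R ?N \<and> W \<subseteq> I \<and> x \<notin> W" for W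
      using C(2) by (auto simp: subset.chain_def \<W>_def)
    have tot: "W \<in> C \<Longrightarrow> W' \<in> C \<Longrightarrow> W \<subseteq> W' \<or> W' \<subseteq> W" for W W'
      using C(2) unfolding subset.chain_def by blast
    have "submodule (\<Union>C) R ?N"
    proof (rule N.submoduleI)
      show "\<Union>C \<subseteq> carrier ?N" using CW N.submoduleD(1) by blast
      show "\<zero>\<^bsub>?N\<^esub> \<in> \<Union>C" using C(1) CW N.submoduleD(2) by blast
    next
      fix a b assume "a \<in> \<Union>C" "b \<in> \<Union>C"
      then obtain W where "W \<in> C" "a \<in> W" "b \<in> W" using tot by blast
      then show "a \<oplus>\<^bsub>?N\<^esub> b \<in> \<Union>C" using CW N.submoduleD(3) by blast
    next
      fix a b assume "a \<in> carrier R" "b \<in> \<Union>C"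
      then show "a \<odot>\<^bsub>?N\<^esub> b \<in> \<Union>C" using CW N.submoduleD(4) by blast
    qed
    then show "\<Union>C \<in> \<W>" using CW by (auto simp: \<W>_def)
  qed
  then obtain W where W: "W \<in> \<W>" and mx: "\<forall>X\<in>\<W>. W \<subseteq> X \<longrightarrow> X = W" by (rule bexE)
  have Wmax: "X = W" if "submodule X R ?N" "X \<subseteq> I" "x \<notin> X" "W \<subseteq> X" for X
    using mx that by (simp add: \<W>_def)
  have W: "submodule W R ?N" "W \<subseteq> I" "x \<notin> W" using W by (simp_all add: \<W>_def)
  note WD = N.submoduleD[OF W(1), unfolded Ns]
  have Wfg: "fgen R ?N W" using min[OF W(1) _ W(2)] W(3) x(1) by blast
  have "fgen R ?N I"
  proof (rule N.fgen_step[OF I(1) Wfg W(2), of 1 "\<lambda>_. x"])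
    fix y assume y: "y \<in> I"
    have yK: "y \<in> carrier R" "x \<in> carrier R" using y x IK by auto
    have "\<exists>a\<in>carrier R. y \<ominus> a \<otimes> x \<in> W"
    proof (cases "y \<in> W")
      case True then show ?thesis using yK by (intro bexI[of _ "\<zero>"]) (simp_all add: a_minus_def)
    next
      case False
      let ?X = "{w \<oplus> c \<otimes> y | w c. w \<in> W \<and> c \<in> carrier R}"
      have WK: "w \<in> carrier R" if "w \<in> W" for w using that WD(1) by auto
      have X: "submodule ?X R ?N"
      proof (rule N.submoduleI)
        show "?X \<subseteq> carrier ?N" using WK yK by (auto simp: Ns)
        show "\<zero>\<^bsub>?N\<^esub> \<in> ?X" unfolding Ns using WD(2) yK
          by (intro CollectI exI[of _ "\<zero>"]) simp
      next
        fix a b assume "a \<in> ?X" "b \<in> ?X"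
        then obtain w c w' c' where *: "a = w \<oplus> c \<otimes> y" "b = w' \<oplus> c' \<otimes> y" "w \<in> W" "w' \<in> W"
          "c \<in> carrier R" "c' \<in> carrier R" by blast
        have "a \<oplus> b = (w \<oplus> w') \<oplus> (c \<oplus> c') \<otimes> y"
          using * WK yK by (simp add: l_distr a_ac)
        then show "a \<oplus>\<^bsub>?N\<^esub> b \<in> ?X" unfolding Ns using * WD(3) by blast
      next
        fix a b assume a: "a \<in> carrier R" and "b \<in> ?X"
        then obtain w c where *: "b = w \<oplus> c \<otimes> y" "w \<in> W" "c \<in> carrier R" by blast
        have "a \<otimes> b = a \<otimes> w \<oplus> (a \<otimes> c) \<otimes> y"
          using * a WK yK by (simp add: r_distr m_assoc)
        then show "a \<odot>\<^bsub>?N\<^esub> b \<in> ?X" unfolding Ns using * a WD(4) m_closed by blast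
      qed
      have XI: "?X \<subseteq> I" using W(2) ID(3,4) y by blast
      have yX: "y \<in> ?X" using WD(2) yK by (intro CollectI exI[of _ "\<zero>"] exI[of _ "\<one>"]) simp
      have WX: "W \<subseteq> ?X"
      proof
        fix w assume "w \<in> W"
        then show "w \<in> ?X" using WK yK by (intro CollectI exI[of _ w] exI[of _ "\<zero>"]) simp
      qed
      have "x \<in> ?X" using Wmax[OF X XI _ WX] yX False by blast
      then obtain w c where wc: "x = w \<oplus> c \<otimes> y" "w \<in> W" "c \<in> carrier R" by blast
      \<comment> \<open>If \<open>c\<close> killed \<open>I\<close>, then \<open>x = w\<close> would
        lie in \<open>W\<close>. So \<open>c\<close> acts invertibly, and \<open>x = w + c y\<close>
        can be solved for \<open>y\<close> modulo \<open>W\<close>.\<close>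
      have "\<not> (\<forall>x\<in>I. c \<otimes> x = \<zero>)" using wc W(3) WK y by (auto intro!: bexI[of _ y])
      then obtain b where b: "b \<in> carrier R" "\<And>x. x \<in> I \<Longrightarrow> b \<otimes> (c \<otimes> x) = x"
        using dich[OF wc(3)] inv[OF wc(3)] by blast
      have wI: "w \<in> carrier R" using wc WK by auto
      have "b \<otimes> x = b \<otimes> w \<oplus> y" unfolding wc(1) using b y wc yK wI by (simp add: r_distr)
      then have "y \<ominus> b \<otimes> x = (\<ominus> b) \<otimes> w"
        using b(1) yK wI by (simp add: a_minus_def minus_add l_minus a_ac r_neg1 r_neg2 r_neg)
      then show ?thesis using b(1) WD(4)[of "\<ominus> b" w] wc(2) by (intro bexI[of _ b]) simp_all
    qed
    then obtain a where "a \<in> carrier R" "y \<ominus> a \<otimes> x \<in> W" by blast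
    moreover have "y \<ominus>\<^bsub>?N\<^esub> z = y \<ominus> z" for z
      by (simp add: a_minus_def a_inv_def m_inv_def regular_mod_def)
    ultimately show "\<exists>a. (\<forall>j<1. a j \<in> carrier R) \<and> y \<ominus>\<^bsub>?N\<^esub> msum ?N 1 (\<lambda>j. a j \<odot>\<^bsub>?N\<^esub> x) \<in> W"
      using yK by (intro exI[of _ "\<lambda>_. a"]) (simp add: Ns)
  qed (use x in auto)
  then show False using I(2) by blast
qed

section \<open>Modules over an Artin algebra\<close>

lemma restrict_scalars_simps [simp]:
  "carrier (restrict_scalars \<phi> M) = carrier M" "\<zero>\<^bsub>restrict_scalars \<phi> M\<^esub> = \<zero>\<^bsub>M\<^esub>"
  "x \<oplus>\<^bsub>restrict_scalars \<phi> M\<^esub> y = x \<oplus>\<^bsub>M\<^esub> y" "k \<odot>\<^bsub>restrict_scalars \<phi> M\<^esub> x = \<phi> k \<odot>\<^bsub>M\<^esub> x"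
  by (simp_all add: restrict_scalars_def)

lemma msum_restrict_scalars [simp]: "msum (restrict_scalars \<phi> M) m f = msum M m f"
  by (induction m) auto

lemma restrict_scalars_left_module:
  assumes "ring K" "\<phi> \<in> ring_hom K A" and M: "left_module A M"
  shows "left_module K (restrict_scalars \<phi> M)"
proof -
  interpret left_module A M by fact
  interpret K: ring K by fact
  interpret h: ring_hom_ring K A \<phi>
    by (intro ring_hom_ringI2 assms(2) K.ring_axioms R.ring_axioms)
  have "abelian_group (restrict_scalars \<phi> M)"
  proof (rule abelian_groupI, goal_cases)
    case (6 x)
    then show ?case by (intro bexI[of _ "\<ominus>\<^bsub>M\<^esub> x"]) (auto simp: M.l_neg)
  qed (auto simp: M.a_ac)
  then show ?thesis
    by (intro left_module.intro K.ring_axioms left_module_axioms.intro)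
       (simp_all add: smult_l_distr smult_r_distr smult_assoc1)
qed

lemma restrict_scalars_lin:
  assumes "\<phi> \<in> ring_hom K A" "lin A M N f"
  shows "lin K (restrict_scalars \<phi> M) (restrict_scalars \<phi> N) f"
  using assms ring_hom_closed[OF assms(1)] by (auto simp: lin_def)

context
  fixes K :: "('k, 'r) ring_scheme" and A :: "('a, 's) ring_scheme" and \<phi> :: "'k \<Rightarrow> 'a"
  assumes AA: "artin_algebra K \<phi> A"
begin

lemma artin_algebraD:
  shows "artinian_cring K" "ring A" "ring K" "\<phi> \<in> ring_hom K A"
    "\<And>k a. k \<in> carrier K \<Longrightarrow> a \<in> carrier A \<Longrightarrow> \<phi> k \<otimes>\<^bsub>A\<^esub> a = a \<otimes>\<^bsub>A\<^esub> \<phi> k"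
    "\<And>k. k \<in> carrier K \<Longrightarrow> \<phi> k \<in> carrier A"
    "fg_module K (restrict_scalars \<phi> (regular_mod A))"
  using AA by (auto simp: artin_algebra_def artinian_cring_def cring_def ring_hom_closed)

lemma K_cring: "cring K"
  using artin_algebraD(1) by (simp add: artinian_cring_def)

text \<open>\<open>A\<close> is a quotient of a power of \<open>K\<close> and \<open>X\<close> is a
  quotient of a power of \<open>A\<close>; the Noetherian property of \<open>K\<close> passes to
  powers and quotients.\<close>

lemma noeth_restrict_scalars:
  assumes fg: "fg_module A X"
  shows "noeth_mod K (restrict_scalars \<phi> X)"
proof -
  let ?A = "restrict_scalars \<phi> (regular_mod A)"
  have KX: "left_module K (restrict_scalars \<phi> X)"
    by (rule restrict_scalars_left_module[OF artin_algebraD(3,4) fg_left_module[OF fg]])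
  obtain s q where q: "lin K (power_mod (regular_mod K) s) ?A q" "q ` carrier (power_mod (regular_mod K) s) = carrier ?A"
    using free_cover[OF artin_algebraD(7)] by blast
  have "noeth_mod K ?A"
    by (rule noeth_image[OF noeth_power[OF cring.artinian_noeth[OF K_cring artin_algebraD(1)]] q fg_left_module[OF artin_algebraD(7)]])
  then have nA: "noeth_mod K (power_mod ?A m)" for m by (rule noeth_power)
  obtain m p where p: "lin A (power_mod (regular_mod A) m) X p" "p ` carrier (power_mod (regular_mod A) m) = carrier X"
    using free_cover[OF fg] by blast
  have "lin K (power_mod ?A m) (restrict_scalars \<phi> X) p"
    using restrict_scalars_lin[OF artin_algebraD(4) p(1)] by (simp add: lin_def power_mod_def)
  then show ?thesis by (rule noeth_image[OF nA _ _ KX]) (use p(2) in \<open>simp add: power_mod_def\<close>)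
qed

lemma fg_submodule:
  assumes fg: "fg_module A X" and U: "submodule U A X"
  shows "fg_module A (X\<lparr>carrier := U\<rparr>)"
proof -
  have X: "left_module A X" using fg by (rule fg_left_module)
  interpret X: left_module A X by fact
  let ?X = "restrict_scalars \<phi> X"
  have KX: "left_module K ?X" by (rule restrict_scalars_left_module[OF artin_algebraD(3,4) X])
  note UD = X.submoduleD[OF U]
  have "submodule U K ?X"
    using UD artin_algebraD(6) by (intro left_module.submoduleI[OF KX]) simp_all
  then have "fgen K ?X U" using noeth_restrict_scalars[OF fg] by (simp add: noeth_mod_def)
  then obtain s z where z: "\<forall>i<s. z i \<in> U"
    "\<forall>u\<in>U. \<exists>c. (\<forall>i<s. c i \<in> carrier K) \<and> u = msum X s (\<lambda>i. \<phi> (c i) \<odot>\<^bsub>X\<^esub> z i)"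
    unfolding fgen_def lcomb_gen_def by auto
  have "fgen A X U"
  proof (rule fgenI[of s z])
    fix u assume "u \<in> U"
    then obtain c where "\<forall>i<s. c i \<in> carrier K" "u = msum X s (\<lambda>i. \<phi> (c i) \<odot>\<^bsub>X\<^esub> z i)" using z(2) by blast
    then show "\<exists>c. (\<forall>i<s. c i \<in> carrier A) \<and> u = msum X s (\<lambda>i. c i \<odot>\<^bsub>X\<^esub> z i)"
      using artin_algebraD(6) by (intro exI[of _ "\<lambda>i. \<phi> (c i)"]) simp
  qed (use z in auto)
  then show ?thesis using X.submodule_left_module[OF U] by (simp add: fg_iff)
qed

lemma scalar_lin:
  assumes X: "left_module A X" and k: "k \<in> carrier K"
  shows "lin A X X (\<lambda>x. \<phi> k \<odot>\<^bsub>X\<^esub> x)"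
proof -
  interpret X: left_module A X by fact
  note kA = artin_algebraD(6)[OF k]
  show ?thesis
  proof (rule linI)
    fix a x assume ax: "a \<in> carrier A" "x \<in> carrier X"
    then show "\<phi> k \<odot>\<^bsub>X\<^esub> (a \<odot>\<^bsub>X\<^esub> x) = a \<odot>\<^bsub>X\<^esub> (\<phi> k \<odot>\<^bsub>X\<^esub> x)"
      using kA artin_algebraD(5)[OF k ax(1)] by (simp add: X.smult_assoc1[symmetric])
  qed (use kA in \<open>simp_all add: X.smult_r_distr\<close>)
qed

text \<open>Evaluation at generators of \<open>X\<close> embeds \<open>Hom(X, Y)\<close> into a power of \<open>Y\<close>, over \<open>K\<close>.\<close>

lemma hom_subset_fgen:
  assumes X: "fg_module A X" and Y: "fg_module A Y" and L: "\<And>f. f \<in> L \<Longrightarrow> lin A X Y f"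
    and zero: "(\<lambda>x\<in>carrier X. \<zero>\<^bsub>Y\<^esub>) \<in> L"
    and add: "\<And>f g. f \<in> L \<Longrightarrow> g \<in> L \<Longrightarrow> (\<lambda>x\<in>carrier X. f x \<oplus>\<^bsub>Y\<^esub> g x) \<in> L"
    and smult: "\<And>k f. k \<in> carrier K \<Longrightarrow> f \<in> L \<Longrightarrow> (\<lambda>x\<in>carrier X. \<phi> k \<odot>\<^bsub>Y\<^esub> f x) \<in> L"
  shows "\<exists>s t. (\<forall>i<s. t i \<in> L) \<and> (\<forall>f\<in>L. \<exists>k. (\<forall>i<s. k i \<in> carrier K) \<and>
     (\<forall>x\<in>carrier X. f x = msum Y s (\<lambda>i. \<phi> (k i) \<odot>\<^bsub>Y\<^esub> t i x)))"
proof -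
  have XA: "left_module A X" and YA: "left_module A Y" using X Y by (auto intro: fg_left_module)
  interpret X: left_module A X by fact
  interpret Y: left_module A Y by fact
  let ?Y = "restrict_scalars \<phi> Y"
  obtain m x where x: "\<forall>i<m. x i \<in> carrier X"
    "\<forall>u\<in>carrier X. \<exists>c. (\<forall>i<m. c i \<in> carrier A) \<and> u = msum X m (\<lambda>i. c i \<odot>\<^bsub>X\<^esub> x i)"
    using X unfolding fg_iff fgen_def lcomb_gen_def by blast
  let ?P = "power_mod ?Y m"
  have nP: "noeth_mod K ?P" by (rule noeth_power[OF noeth_restrict_scalars[OF Y]])
  then have P: "left_module K ?P" by (simp add: noeth_mod_def)
  interpret P: left_module K ?P by fact
  define ev where "ev f = (\<lambda>i\<in>{..<m}. f (x i))" for f :: "'b \<Rightarrow> 'd"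
  have LY: "f (x i) \<in> carrier Y" if "f \<in> L" "i < m" for f i
    using L[OF that(1)] x(1) that(2) by (auto dest: lin_closed)
  have evP: "ev f \<in> carrier ?P" if "f \<in> L" for f
    unfolding ev_def by (rule power_modI) (use LY that in auto)
  have ev_add: "ev f \<oplus>\<^bsub>?P\<^esub> ev g = ev (\<lambda>x\<in>carrier X. f x \<oplus>\<^bsub>Y\<^esub> g x)" if "f \<in> L" "g \<in> L" for f g
    using x(1) evP[OF that(1)] evP[OF that(2)] evP[OF add[OF that]]
    by (intro power_mod_eqI[of _ ?Y m]) (simp_all add: power_mod_simps(2-4) ev_def)
  have ev_smult: "k \<odot>\<^bsub>?P\<^esub> ev f = ev (\<lambda>x\<in>carrier X. \<phi> k \<odot>\<^bsub>Y\<^esub> f x)" if "k \<in> carrier K" "f \<in> L" for k f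
    using x(1) evP[OF that(2)] evP[OF smult[OF that]] P.smult_closed[OF that(1) evP[OF that(2)]]
    by (intro power_mod_eqI[of _ ?Y m]) (simp_all add: power_mod_simps(2-4) ev_def)
  have ev_zero: "\<zero>\<^bsub>?P\<^esub> = ev (\<lambda>x\<in>carrier X. \<zero>\<^bsub>Y\<^esub>)"
    using x(1) evP[OF zero] by (intro power_mod_eqI[of _ ?Y m]) (simp_all add: power_mod_simps(2-4) ev_def)
  have "submodule (ev ` L) K ?P"
  proof (rule P.submoduleI)
    show "ev ` L \<subseteq> carrier ?P" using evP by auto
    show "\<zero>\<^bsub>?P\<^esub> \<in> ev ` L" unfolding ev_zero using zero by (rule imageI)
  next
    fix a b assume "a \<in> ev ` L" "b \<in> ev ` L"
    then obtain f g where "f \<in> L" "g \<in> L" "a = ev f" "b = ev g" by (elim imageE)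
    then show "a \<oplus>\<^bsub>?P\<^esub> b \<in> ev ` L" using add by (simp add: ev_add)
  next
    fix k b assume "k \<in> carrier K" "b \<in> ev ` L"
    then obtain g where "k \<in> carrier K" "g \<in> L" "b = ev g" by (elim imageE)
    then show "k \<odot>\<^bsub>?P\<^esub> b \<in> ev ` L" using smult by (simp add: ev_smult)
  qed
  then have "fgen K ?P (ev ` L)" using nP by (simp add: noeth_mod_def)
  then obtain s z where z: "\<forall>i<s. z i \<in> ev ` L"
    "\<forall>u\<in>ev ` L. \<exists>c. (\<forall>i<s. c i \<in> carrier K) \<and> u = msum ?P s (\<lambda>i. c i \<odot>\<^bsub>?P\<^esub> z i)"
    unfolding fgen_def lcomb_gen_def by auto
  define t where "t i = inv_into L ev (z i)" for i
  have t: "t i \<in> L" "ev (t i) = z i" if "i < s" for i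
    using z(1) that unfolding t_def by (simp_all add: inv_into_into f_inv_into_f)
  have "\<exists>k. (\<forall>i<s. k i \<in> carrier K) \<and> (\<forall>x\<in>carrier X. f x = msum Y s (\<lambda>i. \<phi> (k i) \<odot>\<^bsub>Y\<^esub> t i x))"
    if f: "f \<in> L" for f
  proof -
    have "ev f \<in> ev ` L" using f by (rule imageI)
    then obtain k where k: "\<forall>i<s. k i \<in> carrier K" "ev f = msum ?P s (\<lambda>i. k i \<odot>\<^bsub>?P\<^esub> z i)" using z(2) by blast
    let ?g = "\<lambda>x. msum Y s (\<lambda>i. \<phi> (k i) \<odot>\<^bsub>Y\<^esub> t i x)"
    \<comment> \<open>Multiplication by \<open>\<phi> (k i)\<close> is \<open>A\<close>-linear
      because \<open>\<phi>\<close> has central image. Hence the combination \<open>?g\<close> is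
      \<open>A\<close>-linear, and agreement with \<open>f\<close> at the generators
      \<open>x j\<close> is enough.\<close>
    have ts: "lin A X Y (\<lambda>x. \<phi> (k i) \<odot>\<^bsub>Y\<^esub> t i x)" if "i < s" for i
      by (rule lin_comp[OF L[OF t(1)[OF that]] scalar_lin[OF YA]]) (use k(1) that in blast)
    have g: "lin A X Y ?g" by (rule lin_msum[OF ts XA YA])
    have gx: "f (x j) = ?g (x j)" if j: "j < m" for j
    proof -
      have zj: "k i \<odot>\<^bsub>?P\<^esub> z i \<in> carrier ?P" if "i < s" for i
        using P.smult_closed[of "k i" "z i"] k(1) that evP[OF t(1)[OF that]] t(2)[OF that] by simp
      have KY: "left_module K ?Y" by (rule restrict_scalars_left_module[OF artin_algebraD(3,4) YA])
      have "f (x j) = ev f j" using j by (simp add: ev_def)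
      also have "\<dots> = msum ?Y s (\<lambda>i. (k i \<odot>\<^bsub>?P\<^esub> z i) j)"
        unfolding k(2) by (rule msum_lin(2)[OF power_proj_lin[OF j] P KY zj])
      also have "\<dots> = ?g (x j)"
        unfolding msum_restrict_scalars
      proof (rule msum_cong)
        fix i assume "i < s"
        then have "z i j = t i (x j)" using fun_cong[OF t(2)[of i], of j] j by (simp add: ev_def)
        then show "(k i \<odot>\<^bsub>?P\<^esub> z i) j = \<phi> (k i) \<odot>\<^bsub>Y\<^esub> t i (x j)" using j by (simp add: power_mod_simps)
      qed
      finally show ?thesis .
    qed
    have "f u = ?g u" if u: "u \<in> carrier X" for u
    proof -
      obtain c where c: "\<forall>i<m. c i \<in> carrier A" "u = msum X m (\<lambda>i. c i \<odot>\<^bsub>X\<^esub> x i)" using x(2) u by blast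
      have cx: "c i \<odot>\<^bsub>X\<^esub> x i \<in> carrier X" if "i < m" for i using c x that by simp
      have "f u = msum Y m (\<lambda>i. f (c i \<odot>\<^bsub>X\<^esub> x i))" unfolding c(2) by (rule msum_lin(2)[OF L[OF f] XA YA cx])
      also have "\<dots> = msum Y m (\<lambda>i. ?g (c i \<odot>\<^bsub>X\<^esub> x i))"
      proof (rule msum_cong)
        fix i assume i: "i < m"
        have ci: "c i \<in> carrier A" "x i \<in> carrier X" using c x i by auto
        show "f (c i \<odot>\<^bsub>X\<^esub> x i) = ?g (c i \<odot>\<^bsub>X\<^esub> x i)"
          unfolding lin_smult[OF g ci] lin_smult[OF L[OF f] ci] gx[OF i] ..
      qed
      also have "\<dots> = ?g u" unfolding c(2) by (rule msum_lin(2)[OF g XA YA cx, symmetric])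
      finally show ?thesis .
    qed
    then show ?thesis using k(1) by blast
  qed
  then show ?thesis using t(1) by blast
qed

end

section \<open>Retracts, finitely generated projective modules\<close>

text \<open>Direct summands in terms of maps: no complement has to be named, and the defining
  equation is preserved by \<open>Hom(M, -)\<close>.\<close>

definition retract ::
    "('a, 'r) ring_scheme \<Rightarrow> ('a, 'x, 's) module_scheme \<Rightarrow> ('a, 'y, 't) module_scheme \<Rightarrow>
     ('x \<Rightarrow> 'y) \<Rightarrow> ('y \<Rightarrow> 'x) \<Rightarrow> bool" where
  "retract R X Z i r \<longleftrightarrow> lin R X Z i \<and> lin R Z X r \<and> (\<forall>x\<in>carrier X. r (i x) = x)"

definition iso_pair ::
    "('a, 'r) ring_scheme \<Rightarrow> ('a, 'x, 's) module_scheme \<Rightarrow> ('a, 'y, 't) module_scheme \<Rightarrow>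
     ('x \<Rightarrow> 'y) \<Rightarrow> ('y \<Rightarrow> 'x) \<Rightarrow> bool" where
  "iso_pair R X Y g h \<longleftrightarrow> retract R X Y g h \<and> retract R Y X h g"

lemma retractD:
  assumes "retract R X Z i r"
  shows "lin R X Z i" "lin R Z X r" "\<And>x. x \<in> carrier X \<Longrightarrow> r (i x) = x"
    "\<And>x. x \<in> carrier X \<Longrightarrow> i x \<in> carrier Z" "\<And>z. z \<in> carrier Z \<Longrightarrow> r z \<in> carrier X"
    "r ` carrier Z = carrier X" "inj_on i (carrier X)"
proof -
  show "lin R X Z i" "lin R Z X r" and ri: "\<And>x. x \<in> carrier X \<Longrightarrow> r (i x) = x"
    using assms by (auto simp: retract_def)
  then show i: "\<And>x. x \<in> carrier X \<Longrightarrow> i x \<in> carrier Z" and r: "\<And>z. z \<in> carrier Z \<Longrightarrow> r z \<in> carrier X"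
    by (auto dest: lin_closed)
  show "r ` carrier Z = carrier X"
  proof
    show "carrier X \<subseteq> r ` carrier Z"
    proof
      fix x assume "x \<in> carrier X"
      then show "x \<in> r ` carrier Z" using i ri by (intro image_eqI[of _ _ "i x"]) simp_all
    qed
  qed (use r in auto)
  show "inj_on i (carrier X)" by (rule inj_on_inverseI[of _ r]) (rule ri)
qed

lemma iso_pairD:
  assumes "iso_pair R X Y g h"
  shows "lin R X Y g" "lin R Y X h" "\<And>x. x \<in> carrier X \<Longrightarrow> h (g x) = x" "\<And>y. y \<in> carrier Y \<Longrightarrow> g (h y) = y"
    "\<And>x. x \<in> carrier X \<Longrightarrow> g x \<in> carrier Y" "\<And>y. y \<in> carrier Y \<Longrightarrow> h y \<in> carrier X"
    "g ` carrier X = carrier Y" "inj_on g (carrier X)"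
  using assms retractD[of R X Y g h] retractD[of R Y X h g] unfolding iso_pair_def by blast+

lemma iso_pair_retract: "iso_pair R X Y g h \<Longrightarrow> retract R X Y g h" "iso_pair R X Y g h \<Longrightarrow> retract R Y X h g"
  by (simp_all add: iso_pair_def)

lemma iso_pair_sym: "iso_pair R X Y g h \<Longrightarrow> iso_pair R Y X h g"
  by (simp add: iso_pair_def)

lemma retract_trans:
  "retract R X Y i r \<Longrightarrow> retract R Y Z j q \<Longrightarrow> retract R X Z (\<lambda>x. j (i x)) (\<lambda>z. r (q z))"
  by (auto simp: retract_def lin_def)

lemma iso_pair_trans:
  "iso_pair R X Y g h \<Longrightarrow> iso_pair R Y Z g' h' \<Longrightarrow> iso_pair R X Z (\<lambda>x. g' (g x)) (\<lambda>z. h (h' z))"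
  by (auto simp: iso_pair_def retract_def lin_def)

lemma bij_iso_pair:
  assumes "lin R X Y g" "left_module R X" "inj_on g (carrier X)" "g ` carrier X = carrier Y"
  shows "iso_pair R X Y g (inv_into (carrier X) g)"
proof -
  have *: "inv_into (carrier X) g y \<in> carrier X" "g (inv_into (carrier X) g y) = y" if "y \<in> carrier Y" for y
    using that assms(4) by (simp_all add: inv_into_into f_inv_into_f)
  have "lin R Y X (inv_into (carrier X) g)" by (rule lin_inverse[OF assms(1,2) * assms(3)])
  then show ?thesis using assms(1,3) * by (simp add: iso_pair_def retract_def)
qed

lemma mod_iso_pair:
  assumes "mod_iso R X Y" "left_module R X"
  shows "\<exists>g h. iso_pair R X Y g h"
proof -
  obtain f where "f \<in> mod_hom R X Y" "bij_betw f (carrier X) (carrier Y)" using assms(1) by (auto simp: mod_iso_def)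
  then show ?thesis using bij_iso_pair[OF _ assms(2), of Y f] by (auto simp: mod_hom_lin bij_betw_def)
qed

lemma iso_pair_mod_iso:
  assumes "iso_pair R X Y g h" "left_module R X"
  shows "mod_iso R X Y"
proof -
  note D = iso_pairD[OF assms(1)]
  have "bij_betw (restrict g (carrier X)) (carrier X) (carrier Y)"
    using D(7,8) by (simp add: bij_betw_def inj_on_def)
  then show ?thesis unfolding mod_iso_def using lin_restrict[OF D(1) assms(2)] by blast
qed

text \<open>Used whenever a module of another carrier type has to enter a statement about the
  universe, such as a resolution or an induction hypothesis.\<close>

lemma fg_copy:
  assumes "fg_module R X"
  shows "\<exists>(N :: 'a umod) g h. fg_module (R :: ('a, 'r) ring_scheme) N \<and> iso_pair R X N g h"
proof -
  obtain N :: "'a umod" where N: "left_module R N" "mod_iso R X N"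
    using fg_module_universe[OF assms] by blast
  obtain g h where gh: "iso_pair R X N g h" using mod_iso_pair[OF N(2) fg_left_module[OF assms]] by blast
  have "fg_module R N" by (rule fg_image[OF iso_pairD(1)[OF gh] N(1) assms iso_pairD(7)[OF gh]])
  then show ?thesis using gh by blast
qed

lemma fg_retract: "retract R X Z i r \<Longrightarrow> fg_module R Z \<Longrightarrow> left_module R X \<Longrightarrow> fg_module R X"
  using fg_image retractD(2,6) by blast

section \<open>Finitely generated projective modules through dual bases\<close>

definition dual_basis ::
    "('a, 'r) ring_scheme \<Rightarrow> ('a, 'x, 's) module_scheme \<Rightarrow> nat \<Rightarrow> (nat \<Rightarrow> 'x) \<Rightarrow> (nat \<Rightarrow> 'x \<Rightarrow> 'a) \<Rightarrow> bool" where
  "dual_basis R P m b c \<longleftrightarrow> (\<forall>i<m. b i \<in> carrier P \<and> lin R P (regular_mod R) (c i)) \<and>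
     (\<forall>v\<in>carrier P. v = msum P m (\<lambda>i. c i v \<odot>\<^bsub>P\<^esub> b i))"

text \<open>A finite dual basis characterises projectivity without quantifying over modules, so it
  makes sense for every carrier type. In the universe it agrees with the given definition, see
  \<open>fgp_iff\<close>.\<close>

definition fgp :: "('a, 'r) ring_scheme \<Rightarrow> ('a, 'x, 's) module_scheme \<Rightarrow> bool" where
  "fgp R P \<longleftrightarrow> left_module R P \<and> (\<exists>m b c. dual_basis R P m b c)"

lemma fgpD: "fgp R P \<Longrightarrow> left_module R P"
  by (simp add: fgp_def)

lemma fgp_fg:
  assumes "fgp R P" shows "fg_module R P"
proof -
  obtain m b c where "dual_basis R P m b c" and P: "left_module R P" using assms by (auto simp: fgp_def)
  then have D: "\<And>i. i < m \<Longrightarrow> b i \<in> carrier P" "\<And>i. i < m \<Longrightarrow> lin R P (regular_mod R) (c i)"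
    "\<And>v. v \<in> carrier P \<Longrightarrow> v = msum P m (\<lambda>i. c i v \<odot>\<^bsub>P\<^esub> b i)" by (auto simp: dual_basis_def)
  have "fgen R P (carrier P)"
  proof (rule fgenI[of m b])
    fix u assume "u \<in> carrier P"
    then show "\<exists>c. (\<forall>i<m. c i \<in> carrier R) \<and> u = msum P m (\<lambda>i. c i \<odot>\<^bsub>P\<^esub> b i)"
      using D lin_closed[OF D(2)] by (intro exI[of _ "\<lambda>i. c i u"]) auto
  qed (rule D(1))
  then show ?thesis using P by (simp add: fg_iff)
qed

text \<open>Preimages of the \<open>h (b i)\<close> are recombined with the coordinate functions
  \<open>c i\<close>. The modules \<open>X\<close> and \<open>Y\<close> may have any carrier types,
  which the lifting property in \<open>projective_mod\<close> does not offer.\<close>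

lemma fgp_lift:
  assumes P: "fgp R P" and X: "left_module R X" and Y: "left_module R Y"
    and g: "lin R X Y g" and surj: "carrier Y \<subseteq> g ` carrier X" and h: "lin R P Y h"
  shows "\<exists>k. lin R P X k \<and> (\<forall>v\<in>carrier P. g (k v) = h v)"
proof -
  obtain m b c where "dual_basis R P m b c" using P by (auto simp: fgp_def)
  then have D: "\<And>i. i < m \<Longrightarrow> b i \<in> carrier P" "\<And>i. i < m \<Longrightarrow> lin R P (regular_mod R) (c i)"
    "\<And>v. v \<in> carrier P \<Longrightarrow> v = msum P m (\<lambda>i. c i v \<odot>\<^bsub>P\<^esub> b i)" by (auto simp: dual_basis_def)
  have PL: "left_module R P" using P by (rule fgpD)
  interpret P: left_module R P by fact
  interpret X: left_module R X by fact
  define x where "x i = inv_into (carrier X) g (h (b i))" for i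
  have x: "x i \<in> carrier X" "g (x i) = h (b i)" if "i < m" for i
  proof -
    have "h (b i) \<in> g ` carrier X" using lin_closed[OF h D(1)[OF that]] surj by auto
    then show "x i \<in> carrier X" "g (x i) = h (b i)" by (simp_all add: x_def inv_into_into f_inv_into_f)
  qed
  let ?k = "\<lambda>v. msum X m (\<lambda>i. c i v \<odot>\<^bsub>X\<^esub> x i)"
  have k: "lin R P X ?k"
    by (rule lin_msum[OF _ PL X]) (rule lin_coeff_smult[OF D(2) X x(1)])
  have "g (?k v) = h v" if v: "v \<in> carrier P" for v
  proof -
    have cv: "c i v \<in> carrier R" if "i < m" for i using lin_closed[OF D(2)[OF that] v] by simp
    have "g (?k v) = msum Y m (\<lambda>i. g (c i v \<odot>\<^bsub>X\<^esub> x i))"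
      by (rule msum_lin(2)[OF g X Y]) (use cv x in auto)
    also have "\<dots> = msum Y m (\<lambda>i. h (c i v \<odot>\<^bsub>P\<^esub> b i))"
      by (rule msum_cong) (simp add: lin_smult[OF g cv x(1)] lin_smult[OF h cv D(1)] x(2))
    also have "\<dots> = h (msum P m (\<lambda>i. c i v \<odot>\<^bsub>P\<^esub> b i))"
      by (rule msum_lin(2)[OF h PL Y, symmetric]) (use cv D in auto)
    finally show ?thesis using D(3)[OF v] by simp
  qed
  then show ?thesis using k by blast
qed

lemma fgp_projective:
  fixes P :: "'a umod"
  assumes "fgp R P" shows "projective_mod R P"
  unfolding projective_mod_def
proof (intro conjI allI impI)
  show "left_module R P" using assms by (rule fgpD)
  fix X Y :: "'a umod" and g h
  assume H: "left_module R X \<and> left_module R Y \<and> g \<in> mod_hom R X Y \<and> g ` carrier X = carrier Y \<and> h \<in> mod_hom R P Y"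
  then obtain k where k: "lin R P X k" "\<forall>v\<in>carrier P. g (k v) = h v"
    using fgp_lift[OF assms, of X Y g h] by (auto simp: mod_hom_lin)
  have "compose (carrier P) g (restrict k (carrier P)) = h"
    using k(2) H by (auto simp: compose_def fun_eq_iff mod_hom_lin extensional_def)
  then show "\<exists>k\<in>mod_hom R P X. compose (carrier P) g k = h"
    using lin_restrict[OF k(1) fgpD[OF assms]] by blast
qed

definition unit_vec :: "('a, 'r) ring_scheme \<Rightarrow> nat \<Rightarrow> nat \<Rightarrow> nat \<Rightarrow> 'a" where
  "unit_vec R m i = (\<lambda>j\<in>{..<m}. if j = i then \<one>\<^bsub>R\<^esub> else \<zero>\<^bsub>R\<^esub>)"

lemma power_dual_basis:
  assumes "ring R"
  shows "dual_basis R (power_mod (regular_mod R) m) m (unit_vec R m) (\<lambda>i v. v i)"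
proof -
  interpret ring R by fact
  let ?P = "power_mod (regular_mod R) m"
  have RR: "left_module R (regular_mod R)" by (rule regular_left_module[OF assms])
  have P: "left_module R ?P" by (rule power_left_module[OF RR])
  interpret P: left_module R ?P by fact
  interpret RR: left_module R "regular_mod R" by fact
  have e: "unit_vec R m i \<in> carrier ?P" for i unfolding unit_vec_def by (rule power_modI) simp
  have "v = msum ?P m (\<lambda>i. v i \<odot>\<^bsub>?P\<^esub> unit_vec R m i)" if v: "v \<in> carrier ?P" for v
  proof (rule power_mod_eqI[OF v])
    have vi: "v i \<in> carrier R" if "i < m" for i using power_modD[OF v that] by simp
    have t: "v i \<odot>\<^bsub>?P\<^esub> unit_vec R m i \<in> carrier ?P" if "i < m" for i by (rule P.smult_closed[OF vi[OF that] e])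
    show "msum ?P m (\<lambda>i. v i \<odot>\<^bsub>?P\<^esub> unit_vec R m i) \<in> carrier ?P" by (rule P.msum_closed[OF t])
    fix j assume j: "j < m"
    have "msum ?P m (\<lambda>i. v i \<odot>\<^bsub>?P\<^esub> unit_vec R m i) j = msum (regular_mod R) m (\<lambda>i. (v i \<odot>\<^bsub>?P\<^esub> unit_vec R m i) j)"
      by (rule msum_lin(2)[OF power_proj_lin[OF j] P RR t])
    also have "\<dots> = v j"
      by (rule RR.msum_single[OF j]) (use j vi in \<open>auto simp: power_mod_simps(3) unit_vec_def\<close>)
    finally show "v j = msum ?P m (\<lambda>i. v i \<odot>\<^bsub>?P\<^esub> unit_vec R m i) j" ..
  qed
  then show ?thesis using e power_proj_lin[of _ m R "regular_mod R"] by (simp add: dual_basis_def)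
qed

lemma free_fgp: "ring R \<Longrightarrow> fgp R (power_mod (regular_mod R) m)"
  unfolding fgp_def using power_dual_basis power_left_module regular_left_module by blast

lemma fgp_retract:
  assumes "retract R X P i r" "fgp R P" "left_module R X"
  shows "fgp R X"
proof -
  note r = retractD[OF assms(1)]
  obtain m b c where "dual_basis R P m b c" and P: "left_module R P" using assms(2) by (auto simp: fgp_def)
  then have D: "\<And>i. i < m \<Longrightarrow> b i \<in> carrier P" "\<And>i. i < m \<Longrightarrow> lin R P (regular_mod R) (c i)"
    "\<And>v. v \<in> carrier P \<Longrightarrow> v = msum P m (\<lambda>i. c i v \<odot>\<^bsub>P\<^esub> b i)" by (auto simp: dual_basis_def)
  interpret P: left_module R P by fact
  have "dual_basis R X m (\<lambda>j. r (b j)) (\<lambda>j x. c j (i x))"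
    unfolding dual_basis_def
  proof (intro conjI allI impI ballI)
    show "j < m \<Longrightarrow> r (b j) \<in> carrier X" for j using r D by blast
    show "j < m \<Longrightarrow> lin R X (regular_mod R) (\<lambda>x. c j (i x))" for j by (rule lin_comp[OF r(1) D(2)])
    fix x assume x: "x \<in> carrier X"
    have cx: "c j (i x) \<in> carrier R" if "j < m" for j using lin_closed[OF D(2)[OF that] r(4)[OF x]] by simp
    have "x = r (msum P m (\<lambda>j. c j (i x) \<odot>\<^bsub>P\<^esub> b j))" using r(3)[OF x] D(3)[OF r(4)[OF x]] by simp
    also have "\<dots> = msum X m (\<lambda>j. r (c j (i x) \<odot>\<^bsub>P\<^esub> b j))"
      by (rule msum_lin(2)[OF r(2) P assms(3)]) (use cx D in auto)
    also have "\<dots> = msum X m (\<lambda>j. c j (i x) \<odot>\<^bsub>X\<^esub> r (b j))"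
      by (rule msum_cong) (rule lin_smult[OF r(2) cx D(1)])
    finally show "x = \<dots>" .
  qed
  then show ?thesis using assms(3) by (auto simp: fgp_def)
qed

text \<open>A section of a free cover makes \<open>P\<close> a retract of a free module, whose dual
  basis it inherits.\<close>

lemma fgp_if_sections:
  assumes P: "fg_module R P"
    and sec: "\<And>m p. lin R (power_mod (regular_mod R) m) P p \<Longrightarrow> p ` carrier (power_mod (regular_mod R) m) = carrier P \<Longrightarrow>
      \<exists>s. lin R P (power_mod (regular_mod R) m) s \<and> (\<forall>x\<in>carrier P. p (s x) = x)"
  shows "fgp R P"
proof -
  have PL: "left_module R P" using P by (rule fg_left_module)
  obtain m p where p: "lin R (power_mod (regular_mod R) m) P p" "p ` carrier (power_mod (regular_mod R) m) = carrier P"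
    using free_cover[OF P] by blast
  obtain s where "lin R P (power_mod (regular_mod R) m) s" "\<forall>x\<in>carrier P. p (s x) = x" using sec[OF p] by blast
  then have "retract R P (power_mod (regular_mod R) m) s p" using p(1) by (simp add: retract_def)
  then show ?thesis by (rule fgp_retract[OF _ free_fgp PL]) (use PL in \<open>simp add: left_module_def\<close>)
qed

lemma fgp_iff:
  fixes P :: "'a umod"
  shows "fg_module R P \<and> projective_mod R P \<longleftrightarrow> fgp R P"
proof
  assume H: "fg_module R P \<and> projective_mod R P"
  then have P: "left_module R P" by (simp add: fg_left_module)
  show "fgp R P"
  proof (rule fgp_if_sections[OF conjunct1[OF H]])
    fix m p
    let ?F = "power_mod (regular_mod R) m"
    assume p: "lin R ?F P p" "p ` carrier ?F = carrier P"
    have F: "fg_module R ?F" using P by (intro fgp_fg free_fgp) (simp add: left_module_def)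
    \<comment> \<open>\<open>projective_mod\<close> can be tested only against the universe, so a
      copy of the free module takes its place and the section is transported back along
      \<open>h\<close>.\<close>
    obtain N :: "'a umod" and g h where N: "fg_module R N" "iso_pair R ?F N g h"
      using fg_copy[OF F] by (elim exE conjE)
    note gh = iso_pairD[OF N(2)]
    have NL: "left_module R N" using N(1) by (rule fg_left_module)
    have ph: "lin R N P (\<lambda>x. p (h x))" by (rule lin_comp[OF gh(2) p(1)])
    have "h ` carrier N = carrier ?F" using iso_pairD(7)[OF iso_pair_sym[OF N(2)]] .
    then have surj: "restrict (\<lambda>x. p (h x)) (carrier N) ` carrier N = carrier P"
      using p(2) by (simp add: image_image[symmetric])
    have id: "restrict (\<lambda>x. x) (carrier P) \<in> mod_hom R P P" by (rule lin_restrict[OF lin_id P])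
    have "\<exists>k\<in>mod_hom R P N. compose (carrier P) (restrict (\<lambda>x. p (h x)) (carrier N)) k = restrict (\<lambda>x. x) (carrier P)"
    proof -
      have "projective_mod R P" using H ..
      then have "left_module R N \<and> left_module R P \<and> restrict (\<lambda>x. p (h x)) (carrier N) \<in> mod_hom R N P \<and>
          restrict (\<lambda>x. p (h x)) (carrier N) ` carrier N = carrier P \<and> restrict (\<lambda>x. x) (carrier P) \<in> mod_hom R P P \<longrightarrow> ?thesis"
        unfolding projective_mod_def by (elim conjE allE)
      then show ?thesis using lin_restrict[OF ph NL] surj id NL P by simp
    qed
    then obtain k where k: "k \<in> mod_hom R P N"
      "compose (carrier P) (restrict (\<lambda>x. p (h x)) (carrier N)) k = restrict (\<lambda>x. x) (carrier P)" by blast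
    have kN: "k x \<in> carrier N" if "x \<in> carrier P" for x using k(1) that by (auto simp: mod_hom_lin dest: lin_closed)
    have "p (h (k x)) = x" if "x \<in> carrier P" for x
      using fun_cong[OF k(2), of x] that kN by (simp add: compose_def)
    then show "\<exists>s. lin R P ?F s \<and> (\<forall>x\<in>carrier P. p (s x) = x)"
      using lin_comp[OF _ gh(2), of P k] k(1) by (intro exI[of _ "\<lambda>x. h (k x)"]) (simp add: mod_hom_lin)
  qed
qed (simp add: fgp_fg fgp_projective)

section \<open>Direct sums and exact sequences\<close>

definition dsum :: "('a, 'x, 's) module_scheme \<Rightarrow> ('a, 'y, 't) module_scheme \<Rightarrow> ('a, 'x \<times> 'y) module" where
  "dsum M N = \<lparr>carrier = carrier M \<times> carrier N, mult = undefined, one = undefined,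
     zero = (\<zero>\<^bsub>M\<^esub>, \<zero>\<^bsub>N\<^esub>), add = (\<lambda>v w. (fst v \<oplus>\<^bsub>M\<^esub> fst w, snd v \<oplus>\<^bsub>N\<^esub> snd w)),
     smult = (\<lambda>a v. (a \<odot>\<^bsub>M\<^esub> fst v, a \<odot>\<^bsub>N\<^esub> snd v))\<rparr>"

lemma dsum_simps [simp]:
  "carrier (dsum M N) = carrier M \<times> carrier N" "\<zero>\<^bsub>dsum M N\<^esub> = (\<zero>\<^bsub>M\<^esub>, \<zero>\<^bsub>N\<^esub>)"
  "v \<oplus>\<^bsub>dsum M N\<^esub> w = (fst v \<oplus>\<^bsub>M\<^esub> fst w, snd v \<oplus>\<^bsub>N\<^esub> snd w)"
  "a \<odot>\<^bsub>dsum M N\<^esub> v = (a \<odot>\<^bsub>M\<^esub> fst v, a \<odot>\<^bsub>N\<^esub> snd v)"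
  by (simp_all add: dsum_def)

lemma dsum_left_module:
  assumes "left_module R M" "left_module R N"
  shows "left_module R (dsum M N)"
proof -
  interpret M: left_module R M by fact
  interpret N: left_module R N by fact
  have "abelian_group (dsum M N)"
  proof (rule abelian_groupI, goal_cases)
    case (6 x)
    then show ?case by (intro bexI[of _ "(\<ominus>\<^bsub>M\<^esub> fst x, \<ominus>\<^bsub>N\<^esub> snd x)"]) (auto simp: M.M.l_neg N.M.l_neg)
  qed (auto simp: M.M.a_ac N.M.a_ac)
  then show ?thesis
    by (intro left_module.intro M.R.ring_axioms left_module_axioms.intro)
       (auto simp: M.smult_l_distr N.smult_l_distr M.smult_r_distr N.smult_r_distr M.smult_assoc1 N.smult_assoc1)
qed

lemma dsum_lins:
  assumes "left_module R M" "left_module R N"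
  shows "lin R (dsum M N) M fst" "lin R (dsum M N) N snd"
    "lin R M (dsum M N) (\<lambda>x. (x, \<zero>\<^bsub>N\<^esub>))" "lin R N (dsum M N) (\<lambda>x. (\<zero>\<^bsub>M\<^esub>, x))"
proof -
  interpret M: left_module R M by fact
  interpret N: left_module R N by fact
  show "lin R (dsum M N) M fst" "lin R (dsum M N) N snd"
    "lin R M (dsum M N) (\<lambda>x. (x, \<zero>\<^bsub>N\<^esub>))" "lin R N (dsum M N) (\<lambda>x. (\<zero>\<^bsub>M\<^esub>, x))"
    by (auto simp: lin_def)
qed

definition ses ::
    "('a, 'r) ring_scheme \<Rightarrow> ('a, 'x, 's) module_scheme \<Rightarrow> ('a, 'y, 't) module_scheme \<Rightarrow>
     ('a, 'z, 'u) module_scheme \<Rightarrow> ('x \<Rightarrow> 'y) \<Rightarrow> ('y \<Rightarrow> 'z) \<Rightarrow> bool" where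
  "ses R U V W f g \<longleftrightarrow> left_module R U \<and> left_module R V \<and> left_module R W \<and>
     lin R U V f \<and> lin R V W g \<and> inj_on f (carrier U) \<and> g ` carrier V = carrier W \<and>
     ker V W g = f ` carrier U"

lemma sesD:
  assumes "ses R U V W f g"
  shows "left_module R U" "left_module R V" "left_module R W" "lin R U V f" "lin R V W g"
    "inj_on f (carrier U)" "g ` carrier V = carrier W" "\<And>u. u \<in> carrier U \<Longrightarrow> g (f u) = \<zero>\<^bsub>W\<^esub>"
    "\<And>v. v \<in> carrier V \<Longrightarrow> g v = \<zero>\<^bsub>W\<^esub> \<Longrightarrow> \<exists>u\<in>carrier U. v = f u"
    "\<And>u. u \<in> carrier U \<Longrightarrow> f u \<in> carrier V" "\<And>v. v \<in> carrier V \<Longrightarrow> g v \<in> carrier W"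
proof -
  show 1: "left_module R U" "left_module R V" "left_module R W" "lin R U V f" "lin R V W g"
    "inj_on f (carrier U)" "g ` carrier V = carrier W" using assms by (auto simp: ses_def)
  have k: "ker V W g = f ` carrier U" using assms by (simp add: ses_def)
  show "g (f u) = \<zero>\<^bsub>W\<^esub>" if "u \<in> carrier U" for u
    using k that by (auto simp: ker_def)
  show "\<exists>u\<in>carrier U. v = f u" if "v \<in> carrier V" "g v = \<zero>\<^bsub>W\<^esub>" for v
  proof -
    have "v \<in> f ` carrier U" unfolding k[symmetric] using that by (simp add: ker_def)
    then show ?thesis by (rule imageE) blast
  qed
qed (use assms in \<open>auto simp: ses_def dest: lin_closed\<close>)

lemma sesI:
  assumes "left_module R U" "left_module R V" "left_module R W" "lin R U V f" "lin R V W g"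
    "inj_on f (carrier U)" "\<And>w. w \<in> carrier W \<Longrightarrow> \<exists>v\<in>carrier V. g v = w"
    "\<And>u. u \<in> carrier U \<Longrightarrow> g (f u) = \<zero>\<^bsub>W\<^esub>"
    "\<And>v. v \<in> carrier V \<Longrightarrow> g v = \<zero>\<^bsub>W\<^esub> \<Longrightarrow> \<exists>u\<in>carrier U. v = f u"
  shows "ses R U V W f g"
  unfolding ses_def
proof (intro conjI assms(1-6))
  show "g ` carrier V = carrier W" using lin_closed[OF assms(5)] assms(7) by blast
  show "ker V W g = f ` carrier U"
    using lin_closed[OF assms(4)] assms(8) by (auto simp: ker_def dest!: assms(9))
qed

lemma ses_ker:
  assumes "left_module R V" "left_module R W" "lin R V W g" "g ` carrier V = carrier W"
  shows "ses R (V\<lparr>carrier := ker V W g\<rparr>) V W (\<lambda>x. x) g"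
proof (rule sesI)
  show "left_module R (V\<lparr>carrier := ker V W g\<rparr>)" by (rule ker_left_module[OF assms(3,1,2)])
  show "lin R (V\<lparr>carrier := ker V W g\<rparr>) V (\<lambda>x. x)" by (rule lin_incl) (auto simp: ker_def)
  show "\<exists>v\<in>carrier V. g v = w" if "w \<in> carrier W" for w
  proof -
    have "w \<in> g ` carrier V" using that assms(4) by simp
    then show ?thesis by auto
  qed
qed (use assms in \<open>auto simp: ker_def\<close>)

lemma ses_lift:
  assumes s: "ses R U V W f g" and X: "left_module R X" and h: "lin R X V h"
    and van: "\<And>x. x \<in> carrier X \<Longrightarrow> g (h x) = \<zero>\<^bsub>W\<^esub>"
  shows "\<exists>k. lin R X U k \<and> (\<forall>x\<in>carrier X. f (k x) = h x)"
proof -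
  note S = sesD[OF s]
  let ?I = "V\<lparr>carrier := f ` carrier U\<rparr>"
  have "lin R U ?I f" by (rule lin_codom[OF S(4)]) simp
  then have "iso_pair R U ?I f (inv_into (carrier U) f)"
    by (intro bij_iso_pair S(1,6)) simp_all
  note I = iso_pairD[OF this]
  have hI: "h x \<in> f ` carrier U" if "x \<in> carrier X" for x
    using S(9)[OF lin_closed[OF h that] van[OF that]] by (elim bexE) simp
  have "lin R X ?I h" by (rule lin_codom[OF h hI])
  from lin_comp[OF this I(2)] have "lin R X U (\<lambda>x. inv_into (carrier U) f (h x))" .
  moreover have "f (inv_into (carrier U) f (h x)) = h x" if "x \<in> carrier X" for x
    using I(4) hI[OF that] by simp
  ultimately show ?thesis by blast
qed

lemma ses_transport:
  assumes s: "ses R U V W f g" and U: "iso_pair R U U' gU hU" "left_module R U'"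
    and V: "iso_pair R V V' gV hV" "left_module R V'" and W: "iso_pair R W W' gW hW" "left_module R W'"
  shows "ses R U' V' W' (\<lambda>x. gV (f (hU x))) (\<lambda>x. gW (g (hV x)))"
proof (rule sesI)
  note S = sesD[OF s] note U' = iso_pairD[OF U(1)] note V' = iso_pairD[OF V(1)] note W' = iso_pairD[OF W(1)]
  show "lin R U' V' (\<lambda>x. gV (f (hU x)))" by (rule lin_comp[OF lin_comp[OF U'(2) S(4)] V'(1)])
  show "lin R V' W' (\<lambda>x. gW (g (hV x)))" by (rule lin_comp[OF lin_comp[OF V'(2) S(5)] W'(1)])
  show "inj_on (\<lambda>x. gV (f (hU x))) (carrier U')"
  proof (rule inj_onI)
    fix x y assume xy: "x \<in> carrier U'" "y \<in> carrier U'" "gV (f (hU x)) = gV (f (hU y))"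
    then have "f (hU x) = f (hU y)" using inj_onD[OF V'(8) xy(3)] S(10) U'(6) by simp
    then have "hU x = hU y" using inj_onD[OF S(6)] xy U'(6) by simp
    from arg_cong[OF this, of gU] show "x = y" unfolding U'(4)[OF xy(1)] U'(4)[OF xy(2)] .
  qed
  show "\<exists>v\<in>carrier V'. gW (g (hV v)) = w" if w: "w \<in> carrier W'" for w
  proof -
    have "hW w \<in> g ` carrier V" unfolding S(7) by (rule W'(6)[OF w])
    then obtain v where "hW w = g v" "v \<in> carrier V" by (rule imageE)
    then show ?thesis using V' W'(4)[OF w] by (intro bexI[of _ "gV v"]) simp_all
  qed
  show "gW (g (hV (gV (f (hU u))))) = \<zero>\<^bsub>W'\<^esub>" if "u \<in> carrier U'" for u
    using that U' V' S lin_zero[OF W'(1) S(3) W(2)] by simp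
  show "\<exists>u\<in>carrier U'. v = gV (f (hU u))" if v: "v \<in> carrier V'" "gW (g (hV v)) = \<zero>\<^bsub>W'\<^esub>" for v
  proof -
    have "g (hV v) = \<zero>\<^bsub>W\<^esub>"
      using v W'(3)[OF S(11)[OF V'(6)[OF v(1)]]] lin_zero[OF W'(2) W(2) S(3)] by simp
    then obtain u where "u \<in> carrier U" "hV v = f u" using S(9) V'(6) v by blast
    then show ?thesis using V'(4)[OF v(1)] U' by (intro bexI[of _ "gU u"]) simp_all
  qed
qed (use assms in auto)

lemma fg_ext:
  assumes s: "ses R U V W f g" and "fg_module R U" "fg_module R W"
  shows "fg_module R V"
proof -
  note S = sesD[OF s]
  let ?I = "V\<lparr>carrier := f ` carrier U\<rparr>"
  have "fg_module R ?I"
    by (rule fg_image[OF _ image_left_module[OF S(4,1,2)] assms(2)]) (rule lin_codom[OF S(4)], auto)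
  then have "fgen R V (f ` carrier U)" by (simp add: fg_iff)
  moreover have "{v \<in> carrier V. g v = \<zero>\<^bsub>W\<^esub>} = f ` carrier U" using s by (simp add: ses_def ker_def)
  ultimately have "fgen R V (carrier V)"
    using fgen_ext[OF S(5,2,3) left_module.carrier_submodule[OF S(2)]] assms(3) S(7) by (simp add: fg_iff)
  then show ?thesis using S(2) by (simp add: fg_iff)
qed

lemma ses_dsum:
  assumes "left_module R M" "left_module R N"
  shows "ses R M (dsum M N) N (\<lambda>x. (x, \<zero>\<^bsub>N\<^esub>)) snd"
proof (rule sesI)
  interpret M: left_module R M by fact
  interpret N: left_module R N by fact
  show "\<exists>v\<in>carrier (dsum M N). snd v = w" if "w \<in> carrier N" for w
    using that by (intro bexI[of _ "(\<zero>\<^bsub>M\<^esub>, w)"]) auto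
qed (use assms dsum_lins[OF assms] dsum_left_module[OF assms] in \<open>auto simp: inj_on_def\<close>)

text \<open>A section of a free cover of \<open>V\<close> is glued from two lifts:
  \<open>v - t (g v)\<close> comes from \<open>U\<close> and is lifted by \<open>a\<close>, while
  \<open>t (g v)\<close> is lifted by \<open>t'\<close>.\<close>

lemma fgp_ext:
  assumes s: "ses R U V W f g" and U: "fgp R U" and W: "fgp R W"
  shows "fgp R V"
proof (rule fgp_if_sections[OF fg_ext[OF s fgp_fg[OF U] fgp_fg[OF W]]])
  note S = sesD[OF s]
  interpret V: left_module R V by (rule S(2))
  interpret W: left_module R W by (rule S(3))
  fix m p
  let ?F = "power_mod (regular_mod R) m"
  assume p: "lin R ?F V p" "p ` carrier ?F = carrier V"
  have F: "left_module R ?F" by (intro power_left_module regular_left_module V.R.ring_axioms)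
  obtain t where t: "lin R W V t" "\<forall>w\<in>carrier W. g (t w) = w"
    using fgp_lift[OF W S(2,3,5) _ lin_id] S(7) by blast
  obtain t' where t': "lin R W ?F t'" "\<forall>w\<in>carrier W. p (t' w) = t w"
    using fgp_lift[OF W F S(2) p(1) _ t(1)] p(2) by blast
  obtain a where a: "lin R U ?F a" "\<forall>u\<in>carrier U. p (a u) = f u"
    using fgp_lift[OF U F S(2) p(1) _ S(4)] p(2) by blast
  have tg: "lin R V V (\<lambda>v. v \<ominus>\<^bsub>V\<^esub> t (g v))"
    by (rule lin_sub[OF lin_id lin_comp[OF S(5) t(1)] S(2)])
  have tV: "t (g v) \<in> carrier V" if "v \<in> carrier V" for v using lin_closed[OF t(1)] S(11) that by blast
  have "g (v \<ominus>\<^bsub>V\<^esub> t (g v)) = \<zero>\<^bsub>W\<^esub>" if "v \<in> carrier V" for v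
    using that tV t(2) S(11) W.eq_iff_diff[of "g v" "g v"] by (simp add: lin_diff[OF S(5,2,3)])
  from ses_lift[OF s S(2) tg this]
  obtain k where k: "lin R V U k" "\<forall>v\<in>carrier V. f (k v) = v \<ominus>\<^bsub>V\<^esub> t (g v)" by blast
  let ?s = "\<lambda>v. a (k v) \<oplus>\<^bsub>?F\<^esub> t' (g v)"
  have "lin R V ?F ?s" by (rule lin_plus[OF lin_comp[OF k(1) a(1)] lin_comp[OF S(5) t'(1)] F])
  moreover have "p (?s v) = v" if v: "v \<in> carrier V" for v
    using lin_closed[OF a(1) lin_closed[OF k(1) v]] lin_closed[OF t'(1) S(11)[OF v]] lin_closed[OF k(1) v]
      S(11)[OF v] a(2) t'(2) k(2) v tV[OF v] by (simp add: lin_add[OF p(1)] V.diff_add)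
  ultimately show "\<exists>s. lin R V ?F s \<and> (\<forall>v\<in>carrier V. p (s v) = v)" by blast
qed

section \<open>Projective resolutions of bounded length\<close>

text \<open>A bound by a natural number instead of a value in \<open>enat\<close>, so that estimates
  can be proved by induction on the length.\<close>

definition pd_le :: "('a, 'r) ring_scheme \<Rightarrow> nat \<Rightarrow> ('a, 'x, 's) module_scheme \<Rightarrow> bool" where
  "pd_le R n X \<longleftrightarrow> left_module R X \<and> (\<exists>P d e. proj_resolution R X n P d e)"

lemma pd_le_mono:
  assumes "pd_le R n X" "n \<le> m"
  shows "pd_le R m X"
proof -
  obtain P d e where "proj_resolution R X n P d e" using assms(1) by (auto simp: pd_le_def)
  then have "proj_resolution R X m P d e" unfolding proj_resolution_def using assms(2) by simp
  then show ?thesis using assms(1) by (auto simp: pd_le_def)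
qed

text \<open>An infimum in \<open>enat\<close> is attained unless the set is empty, and then it is
  infinite.\<close>

lemma Inf_enat_le:
  assumes "Inf {enat k | k. Q k} \<le> enat n"
  shows "\<exists>m\<le>n. Q m"
proof -
  let ?S = "{enat k | k. Q k}"
  have "?S \<noteq> {}"
  proof
    assume "?S = {}"
    then have "Inf ?S = \<infinity>" by (simp add: Inf_enat_def)
    then show False using assms by simp
  qed
  moreover then obtain k where "k \<in> ?S" by blast
  then have "(LEAST k. k \<in> ?S) \<in> ?S" by (rule LeastI)
  ultimately have "Inf ?S \<in> ?S" unfolding Inf_enat_def by presburger
  then show ?thesis using assms by auto
qed

lemma proj_dim_le_iff:
  assumes "left_module R X"
  shows "proj_dim R X \<le> enat n \<longleftrightarrow> pd_le R n X"
proof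
  assume "pd_le R n X"
  then show "proj_dim R X \<le> enat n"
    unfolding proj_dim_def pd_le_def by (intro Inf_lower) blast
next
  assume H: "proj_dim R X \<le> enat n"
  obtain m where m: "m \<le> n" "\<exists>P d e. proj_resolution R X m P d e"
    using Inf_enat_le[OF H[unfolded proj_dim_def]] by blast
  then have "pd_le R m X" using assms by (simp add: pd_le_def)
  then show "pd_le R n X" by (rule pd_le_mono) (rule m(1))
qed

lemma pd_le_left_module: "pd_le R n X \<Longrightarrow> left_module R X"
  by (simp add: pd_le_def)

lemma pd_le_0_iff: "pd_le R 0 X \<longleftrightarrow> fgp R X"
  for R :: "('a, 'r) ring_scheme" and X :: "('a, 'x, 's) module_scheme"
proof
  assume "pd_le R 0 X"
  then obtain P d e where X: "left_module R X" and r: "proj_resolution R X 0 P d e" by (auto simp: pd_le_def)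
  then have P0: "fgp R (P 0)" and z: "zero_mod (P 1)" and e: "lin R (P 0) X e" "e ` carrier (P 0) = carrier X"
    and d: "lin R (P 1) (P 0) (d 0)" and ex: "d 0 ` carrier (P 1) = ker (P 0) X e" and P1: "fgp R (P 1)"
    unfolding proj_resolution_def exact_at_def a_kernel_ker fgp_iff mod_hom_lin by auto
  have PL: "left_module R (P 0)" "left_module R (P 1)" using P0 P1 by (auto intro: fgpD)
  have "ker (P 0) X e = {\<zero>\<^bsub>P 0\<^esub>}"
    using z lin_zero[OF d PL(2,1)] unfolding ex[symmetric] zero_mod_def by simp
  then have "inj_on e (carrier (P 0))"
    unfolding lin_inj_iff[OF e(1) PL(1) X] by (auto simp: ker_def)
  from bij_iso_pair[OF e(1) PL(1) this e(2)] show "fgp R X"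
    using fgp_retract[OF iso_pair_retract(2) P0 X] by blast
next
  assume X: "fgp R X"
  have XL: "left_module R X" using X by (rule fgpD)
  obtain N :: "'a umod" and g h where N: "fg_module R N" "iso_pair R X N g h"
    using fg_copy[OF fgp_fg[OF X]] by (elim exE conjE)
  note gh = iso_pairD[OF N(2)]
  have NL: "left_module R N" using N(1) by (rule fg_left_module)
  interpret N: left_module R N by fact
  have NP: "fgp R N" by (rule fgp_retract[OF iso_pair_retract(2)[OF N(2)] X NL])
  \<comment> \<open>A resolution has a module in every degree; the zero submodule of
    \<open>N\<close> fills the positive ones.\<close>
  let ?Z = "N\<lparr>carrier := {\<zero>\<^bsub>N\<^esub>}\<rparr>"
  have ZL: "left_module R ?Z" by (rule N.submodule_left_module[OF N.zero_submodule])
  have ZP: "fgp R ?Z"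
    unfolding fgp_def dual_basis_def using ZL by (intro conjI exI[of _ "0::nat"] exI) simp_all
  let ?P = "\<lambda>i::nat. case i of 0 \<Rightarrow> N | Suc _ \<Rightarrow> ?Z"
  let ?d = "\<lambda>i::nat. \<lambda>x\<in>{\<zero>\<^bsub>N\<^esub>}. \<zero>\<^bsub>N\<^esub>"
  have d: "?d i \<in> mod_hom R (?P (Suc i)) (?P i)" for i
    using lin_restrict[OF lin_zero_map[OF ZL NL] ZL] lin_restrict[OF lin_zero_map[OF ZL ZL] ZL]
    by (simp split: nat.split)
  have e: "restrict h (carrier N) \<in> mod_hom R N X" by (rule lin_restrict[OF gh(2) NL])
  have "\<forall>x\<in>carrier N. h x = \<zero>\<^bsub>X\<^esub> \<longrightarrow> x = \<zero>\<^bsub>N\<^esub>"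
    using iso_pairD(8)[OF iso_pair_sym[OF N(2)]] unfolding lin_inj_iff[OF gh(2) NL XL] .
  then have ex: "exact_at (?d 0) (restrict h (carrier N)) ?Z N X"
    using lin_zero[OF gh(2) NL XL] by (auto simp: exact_at_def a_kernel_ker ker_def)
  have "proj_resolution R X 0 ?P ?d (restrict h (carrier N))"
    unfolding proj_resolution_def
  proof (intro conjI allI impI)
    fix i show "fg_module R (?P i)" "projective_mod R (?P i)"
      using NP ZP unfolding fgp_iff[symmetric] by (auto split: nat.split)
    show "0 < i \<Longrightarrow> zero_mod (?P i)" by (simp add: zero_mod_def split: nat.split)
    show "?d i \<in> mod_hom R (?P (Suc i)) (?P i)" by (rule d)
    show "exact_at (?d (Suc i)) (?d i) (?P (Suc (Suc i))) (?P (Suc i)) (?P i)"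
      by (auto simp: exact_at_def a_kernel_ker ker_def split: nat.split)
    show "restrict h (carrier N) \<in> mod_hom R (?P 0) X" using e by simp
    show "restrict h (carrier N) ` carrier (?P 0) = carrier X"
      using iso_pairD(7)[OF iso_pair_sym[OF N(2)]] by simp
    show "exact_at (?d 0) (restrict h (carrier N)) (?P 1) (?P 0) X" using ex by simp
  qed
  then show "pd_le R 0 X" using XL by (auto simp: pd_le_def)
qed

text \<open>Cutting off the first term, and splicing it back in \<open>pd_le_SucI\<close>, turns the
  bound into a recursion on a first syzygy. The later estimates use this recursion and never handle
  whole resolutions.\<close>

lemma pd_le_SucE:
  fixes X :: "('a, 'x, 's) module_scheme"
  assumes "pd_le R (Suc n) X"
  obtains P :: "'a umod" and f where "fgp R P" "lin R P X f" "f ` carrier P = carrier X"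
    "pd_le R n (P\<lparr>carrier := ker P X f\<rparr>)"
proof -
  from assms obtain P d e where X: "left_module R X" and r: "proj_resolution R X (Suc n) P d e" by (auto simp: pd_le_def)
  note r' = r[unfolded proj_resolution_def exact_at_def a_kernel_ker mod_hom_lin]
  have fgP: "\<And>i. fgp R (P i)" and P0: "lin R (P 0) X e" "e ` carrier (P 0) = carrier X"
    and ex: "d 0 ` carrier (P 1) = ker (P 0) X e"
    and d: "\<And>i. lin R (P (Suc i)) (P i) (d i)"
    using r' unfolding fgp_iff by auto
  have PL: "left_module R (P 0)" by (rule fgpD[OF fgP])
  let ?L = "P 0\<lparr>carrier := ker (P 0) X e\<rparr>"
  have L: "left_module R ?L" by (rule ker_left_module[OF P0(1) PL X])
  have dk: "d 0 x \<in> ker (P 0) X e" if "x \<in> carrier (P 1)" for x using ex that by blast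
  have k: "ker (P (Suc 0)) ?L (d 0) = ker (P (Suc 0)) (P 0) (d 0)" by (simp add: ker_def)
  have "proj_resolution R ?L n (\<lambda>i. P (Suc i)) (\<lambda>i. d (Suc i)) (d 0)"
    unfolding proj_resolution_def exact_at_def a_kernel_ker mod_hom_lin
    using r' dk ex lin_codom[OF d[of 0], of "ker (P 0) X e"] k by auto
  then have "pd_le R n ?L" using L by (auto simp: pd_le_def)
  then show thesis using that[of "P 0" e] fgP P0 by blast
qed

lemma pd_le_SucI_umod:
  fixes X :: "('a, 'x, 's) module_scheme" and P :: "'a umod"
  assumes P: "fgp R P" and X: "left_module R X" and f: "lin R P X f" "f ` carrier P = carrier X"
    and k: "pd_le R n (P\<lparr>carrier := ker P X f\<rparr>)"
  shows "pd_le R (Suc n) X"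
proof -
  let ?L = "P\<lparr>carrier := ker P X f\<rparr>"
  obtain Q d e where L: "left_module R ?L" and r: "proj_resolution R ?L n Q d e" using k by (auto simp: pd_le_def)
  note r' = r[unfolded proj_resolution_def exact_at_def a_kernel_ker mod_hom_lin]
  have PL: "left_module R P" by (rule fgpD[OF P])
  have fgP: "fg_module R P" "projective_mod R P" using P unfolding fgp_iff[symmetric] by auto
  have fr: "restrict f (carrier P) \<in> mod_hom R P X" by (rule lin_restrict[OF f(1) PL])
  let ?Q = "\<lambda>i. case i of 0 \<Rightarrow> P | Suc j \<Rightarrow> Q j" and ?d = "\<lambda>i. case i of 0 \<Rightarrow> e | Suc j \<Rightarrow> d j"
  have e: "lin R (Q 0) P e" using r' by (auto simp: lin_def ker_def)
  have kk: "ker P X (restrict f (carrier P)) = ker P X f" by (auto simp: ker_def)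
  have kq: "ker (Q 0) ?L e = ker (Q 0) P e" by (simp add: ker_def)
  have "proj_resolution R X (Suc n) ?Q ?d (restrict f (carrier P))"
    unfolding proj_resolution_def
  proof (intro conjI allI impI)
    fix i show "fg_module R (?Q i)" "projective_mod R (?Q i)"
      using r' fgP by (auto split: nat.split)
    show "Suc n < i \<Longrightarrow> zero_mod (?Q i)" using r' by (auto split: nat.split)
    show "?d i \<in> mod_hom R (?Q (Suc i)) (?Q i)" using r' e by (auto simp: mod_hom_lin split: nat.split)
    show "exact_at (?d (Suc i)) (?d i) (?Q (Suc (Suc i))) (?Q (Suc i)) (?Q i)"
      using r' kq by (auto simp: exact_at_def a_kernel_ker split: nat.split)
    show "restrict f (carrier P) \<in> mod_hom R (?Q 0) X" using fr by simp
    show "restrict f (carrier P) ` carrier (?Q 0) = carrier X" using f by simp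
    show "exact_at (?d 0) (restrict f (carrier P)) (?Q 1) (?Q 0) X" using r' kk by (simp add: exact_at_def a_kernel_ker)
  qed
  then show ?thesis using X by (auto simp: pd_le_def)
qed

lemma pd_le_iso:
  assumes i: "iso_pair R X Y g h" and X: "pd_le R n X" and Y: "left_module R Y"
  shows "pd_le R n Y"
proof (cases n)
  case 0
  then show ?thesis using X fgp_retract[OF iso_pair_retract(2)[OF i] _ Y] by (simp add: pd_le_0_iff)
next
  case (Suc k)
  note D = iso_pairD[OF i]
  have XL: "left_module R X" using X by (rule pd_le_left_module)
  from X[unfolded Suc] obtain P :: "'a umod" and f where P: "fgp R P" "lin R P X f" "f ` carrier P = carrier X"
    "pd_le R k (P\<lparr>carrier := ker P X f\<rparr>)" by (rule pd_le_SucE)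
  have fX: "f x \<in> carrier X" if "x \<in> carrier P" for x by (rule lin_closed[OF P(2) that])
  have "ker P Y (\<lambda>x. g (f x)) = ker P X f"
    using D(3) fX lin_zero[OF D(1) XL Y] lin_zero[OF D(2) Y XL] by (auto simp: ker_def) metis
  moreover have "(\<lambda>x. g (f x)) ` carrier P = carrier Y" using P(3) D(7) by (simp add: image_image[symmetric])
  ultimately show ?thesis unfolding Suc
    using P(4) by (intro pd_le_SucI_umod[OF P(1) Y lin_comp[OF P(2) D(1)]]) simp_all
qed

lemma ker_iso:
  assumes i: "iso_pair R P Q g h" and P: "left_module R P" and X: "left_module R X" and f: "lin R P X f"
  shows "iso_pair R (P\<lparr>carrier := ker P X f\<rparr>) (Q\<lparr>carrier := ker Q X (\<lambda>q. f (h q))\<rparr>) g h"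
proof -
  note D = iso_pairD[OF i]
  have g: "lin R (P\<lparr>carrier := ker P X f\<rparr>) (Q\<lparr>carrier := ker Q X (\<lambda>q. f (h q))\<rparr>) g"
    by (rule lin_codom[OF lin_dom[OF D(1)]]) (use D in \<open>auto simp: ker_def\<close>)
  have h: "lin R (Q\<lparr>carrier := ker Q X (\<lambda>q. f (h q))\<rparr>) (P\<lparr>carrier := ker P X f\<rparr>) h"
    by (rule lin_codom[OF lin_dom[OF D(2)]]) (use D in \<open>auto simp: ker_def\<close>)
  show ?thesis using g h D by (simp add: iso_pair_def retract_def ker_def)
qed

lemma pd_le_SucI:
  assumes P: "fgp R P" and X: "left_module R X" and f: "lin R P X f" "f ` carrier P = carrier X"
    and k: "pd_le R n (P\<lparr>carrier := ker P X f\<rparr>)"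
  shows "pd_le R (Suc n) X"
proof -
  have PL: "left_module R P" by (rule fgpD[OF P])
  obtain N :: "'a umod" and g h where N: "fg_module R N" "iso_pair R P N g h"
    using fg_copy[OF fgp_fg[OF P]] by (elim exE conjE)
  note gh = iso_pairD[OF N(2)]
  have NL: "left_module R N" using N(1) by (rule fg_left_module)
  have NP: "fgp R N" by (rule fgp_retract[OF iso_pair_retract(2)[OF N(2)] P NL])
  have fh: "lin R N X (\<lambda>q. f (h q))" by (rule lin_comp[OF gh(2) f(1)])
  show ?thesis
  proof (rule pd_le_SucI_umod[OF NP X fh])
    show "(\<lambda>q. f (h q)) ` carrier N = carrier X"
      using f(2) iso_pairD(7)[OF iso_pair_sym[OF N(2)]] by (simp add: image_image[symmetric])
    show "pd_le R n (N\<lparr>carrier := ker N X (\<lambda>q. f (h q))\<rparr>)"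
      by (rule pd_le_iso[OF ker_iso[OF N(2) PL X f(1)] k ker_left_module[OF fh NL X]])
  qed
qed

lemma pd_le_fg: "pd_le R n X \<Longrightarrow> fg_module R X" for R :: "('a, 'r) ring_scheme"
proof (cases n)
  case (Suc k)
  assume "pd_le R n X"
  then have X: "left_module R X" by (rule pd_le_left_module)
  obtain P :: "'a umod" and f where P: "fgp R P" "lin R P X f" "f ` carrier P = carrier X"
    using \<open>pd_le R n X\<close> unfolding Suc by (rule pd_le_SucE)
  show ?thesis by (rule fg_image[OF P(2) X fgp_fg[OF P(1)] P(3)])
qed (simp add: pd_le_0_iff fgp_fg)

section \<open>Projective dimension in short exact sequences and retracts\<close>

text \<open>Statements proved for modules in the universe carry over to arbitrary carriers; this makes
  inductions possible in which kernels have another carrier type than the module itself.\<close>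

lemma pd_le_ext_transport:
  fixes R :: "('a, 'r) ring_scheme"
  assumes H: "\<And>(U :: 'a umod) (V :: 'a umod) (W :: 'a umod) f g.
      ses R U V W f g \<Longrightarrow> pd_le R n U \<Longrightarrow> pd_le R n W \<Longrightarrow> pd_le R n V"
    and s: "ses R U V W f g" and U: "pd_le R n U" and W: "pd_le R n W"
  shows "pd_le R n V"
proof -
  note S = sesD[OF s]
  have fg: "fg_module R U" "fg_module R W" using U W by (auto intro: pd_le_fg)
  obtain U' :: "'a umod" and gU hU where U': "fg_module R U'" "iso_pair R U U' gU hU"
    using fg_copy[OF fg(1)] by (elim exE conjE)
  obtain W' :: "'a umod" and gW hW where W': "fg_module R W'" "iso_pair R W W' gW hW"
    using fg_copy[OF fg(2)] by (elim exE conjE)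
  obtain V' :: "'a umod" and gV hV where V': "fg_module R V'" "iso_pair R V V' gV hV"
    using fg_copy[OF fg_ext[OF s fg]] by (elim exE conjE)
  have L: "left_module R U'" "left_module R V'" "left_module R W'" using U' V' W' by (auto intro: fg_left_module)
  have "pd_le R n V'"
    by (rule H[OF ses_transport[OF s U'(2) L(1) V'(2) L(2) W'(2) L(3)] pd_le_iso[OF U'(2) U L(1)] pd_le_iso[OF W'(2) W L(3)]])
  then show ?thesis by (rule pd_le_iso[OF iso_pair_sym[OF V'(2)] _ S(2)])
qed

text \<open>Horseshoe lemma: \<open>P \<oplus> Q\<close> covers \<open>V\<close>, and the kernels of
  the three covers form a short exact sequence. Its middle term lives on a product type, so the
  induction hypothesis is applied through \<open>pd_le_ext_transport\<close>.\<close>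

lemma pd_le_ext_umod:
  fixes R :: "('a, 'r) ring_scheme" and U :: "'a umod" and V :: "'a umod" and W :: "'a umod"
  assumes "ses R U V W f g" "pd_le R n U" "pd_le R n W"
  shows "pd_le R n V"
  using assms
proof (induction n arbitrary: U V W f g)
  case 0
  then show ?case using fgp_ext by (simp add: pd_le_0_iff)
next
  case (Suc n)
  note S = sesD[OF Suc.prems(1)]
  interpret U: left_module R U by (rule S(1))
  interpret V: left_module R V by (rule S(2))
  interpret W: left_module R W by (rule S(3))
  from Suc.prems(2) obtain P :: "'a umod" and p where P: "fgp R P" "lin R P U p" "p ` carrier P = carrier U"
    "pd_le R n (P\<lparr>carrier := ker P U p\<rparr>)" by (rule pd_le_SucE)
  from Suc.prems(3) obtain Q :: "'a umod" and q where Q: "fgp R Q" "lin R Q W q" "q ` carrier Q = carrier W"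
    "pd_le R n (Q\<lparr>carrier := ker Q W q\<rparr>)" by (rule pd_le_SucE)
  have PL: "left_module R P" by (rule fgpD[OF P(1)])
  have QL: "left_module R Q" by (rule fgpD[OF Q(1)])
  interpret P: left_module R P by fact
  interpret Q: left_module R Q by fact
  obtain t where t: "lin R Q V t" "\<forall>x\<in>carrier Q. g (t x) = q x"
    using fgp_lift[OF Q(1) S(2,3,5) _ Q(2)] S(7) by blast
  let ?D = "dsum P Q" and ?F = "\<lambda>x. f (p (fst x)) \<oplus>\<^bsub>V\<^esub> t (snd x)"
  note l = dsum_lins[OF PL QL]
  have DL: "left_module R ?D" by (rule dsum_left_module[OF PL QL])
  have F: "lin R ?D V ?F"
    by (rule lin_plus[OF lin_comp[OF l(1) lin_comp[OF P(2) S(4)]] lin_comp[OF l(2) t(1)] S(2)])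
  have tV: "t x \<in> carrier V" if "x \<in> carrier Q" for x by (rule lin_closed[OF t(1) that])
  have qW: "q x \<in> carrier W" if "x \<in> carrier Q" for x by (rule lin_closed[OF Q(2) that])
  have pU: "p x \<in> carrier U" if "x \<in> carrier P" for x by (rule lin_closed[OF P(2) that])
  have gF: "g (?F x) = q (snd x)" if "x \<in> carrier ?D" for x
    using that t(2) tV pU qW S(8,10) by (auto simp: lin_add[OF S(5)])
  \<comment> \<open>Solved with a prescribed second coordinate \<open>y\<close>. With
    \<open>v\<close> zero this shows that the kernels map onto each other, with \<open>v\<close>
    arbitrary that \<open>P \<oplus> Q\<close> covers \<open>V\<close>.\<close>
  have solve: "\<exists>x\<in>carrier P. ?F (x, y) = v" if y: "y \<in> carrier Q" and v: "v \<in> carrier V" and gv: "g v = q y" for y v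
  proof -
    have "g (v \<ominus>\<^bsub>V\<^esub> t y) = \<zero>\<^bsub>W\<^esub>"
      using v y gv tV t(2) qW W.eq_iff_diff[of "q y" "q y"] by (simp add: lin_diff[OF S(5,2,3)])
    then obtain u where u: "u \<in> carrier U" "v \<ominus>\<^bsub>V\<^esub> t y = f u" using S(9)[of "v \<ominus>\<^bsub>V\<^esub> t y"] v tV[OF y] by auto
    have "u \<in> p ` carrier P" using u(1) P(3) by simp
    then obtain x where x: "u = p x" "x \<in> carrier P" by (rule imageE)
    have "?F (x, y) = v" using u(2) x(1) V.diff_add[OF tV[OF y] v] by simp
    then show ?thesis using x(2) by blast
  qed
  let ?K = "?D\<lparr>carrier := ker ?D V ?F\<rparr>" and ?L1 = "P\<lparr>carrier := ker P U p\<rparr>" and ?L2 = "Q\<lparr>carrier := ker Q W q\<rparr>"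
  have ks: "ses R ?L1 ?K ?L2 (\<lambda>x. (x, \<zero>\<^bsub>Q\<^esub>)) snd"
  proof (rule sesI)
    show "left_module R ?L1" by (rule ker_left_module[OF P(2) PL S(1)])
    show "left_module R ?L2" by (rule ker_left_module[OF Q(2) QL S(3)])
    show "left_module R ?K" by (rule ker_left_module[OF F DL S(2)])
    show "lin R ?L1 ?K (\<lambda>x. (x, \<zero>\<^bsub>Q\<^esub>))"
      by (rule lin_codom[OF lin_dom[OF l(3)]])
        (auto simp: ker_def lin_zero[OF t(1) QL S(2)] lin_zero[OF S(4,1,2)])
    show "lin R ?K ?L2 snd"
    proof (rule lin_codom[OF lin_dom[OF l(2)]])
      fix x assume x: "x \<in> carrier ?K"
      then have "q (snd x) = g \<zero>\<^bsub>V\<^esub>" using gF[of x] by (simp add: ker_def)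
      then show "snd x \<in> ker Q W q" using x lin_zero[OF S(5,2,3)] by (auto simp: ker_def)
    qed (auto simp: ker_def)
    show "inj_on (\<lambda>x. (x, \<zero>\<^bsub>Q\<^esub>)) (carrier ?L1)" by (rule inj_onI) simp
  next
    fix y assume y: "y \<in> carrier ?L2"
    then have "y \<in> carrier Q" "g \<zero>\<^bsub>V\<^esub> = q y" using lin_zero[OF S(5,2,3)] by (auto simp: ker_def)
    then obtain x where "x \<in> carrier P" "?F (x, y) = \<zero>\<^bsub>V\<^esub>" using solve[of y "\<zero>\<^bsub>V\<^esub>"] by blast
    then show "\<exists>v\<in>carrier ?K. snd v = y" using \<open>y \<in> carrier Q\<close> by (intro bexI[of _ "(x, y)"]) (simp_all add: ker_def)
  next
    fix v assume v: "v \<in> carrier ?K" "snd v = \<zero>\<^bsub>?L2\<^esub>"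
    then have "fst v \<in> carrier P" "f (p (fst v)) = \<zero>\<^bsub>V\<^esub>"
      using lin_zero[OF t(1) QL S(2)] S(10) pU by (auto simp: ker_def)
    moreover then have "p (fst v) = \<zero>\<^bsub>U\<^esub>"
      using S(6) pU unfolding lin_inj_iff[OF S(4,1,2)] by blast
    ultimately show "\<exists>u\<in>carrier ?L1. v = (u, \<zero>\<^bsub>Q\<^esub>)"
      using v(2) by (intro bexI[of _ "fst v"]) (auto simp: ker_def prod_eq_iff)
  qed simp
  have "pd_le R n ?K" by (rule pd_le_ext_transport[OF Suc.IH ks P(4) Q(4)])
  moreover have "?F ` carrier ?D = carrier V"
  proof
    show "?F ` carrier ?D \<subseteq> carrier V" using lin_closed[OF F] by auto
    show "carrier V \<subseteq> ?F ` carrier ?D"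
    proof
      fix v assume v: "v \<in> carrier V"
      have "g v \<in> q ` carrier Q" unfolding Q(3) by (rule S(11)[OF v])
      then obtain y where y: "g v = q y" "y \<in> carrier Q" by (rule imageE)
      obtain x where "x \<in> carrier P" "?F (x, y) = v" using solve[OF y(2) v y(1)] by blast
      then show "v \<in> ?F ` carrier ?D" using y(2) by (intro image_eqI[of v ?F "(x, y)"]) simp_all
    qed
  qed
  ultimately show ?case by (intro pd_le_SucI[OF fgp_ext[OF ses_dsum[OF PL QL] P(1) Q(1)] S(2) F])
qed

lemma pd_le_ext:
  "ses R U V W f g \<Longrightarrow> pd_le R n U \<Longrightarrow> pd_le R n W \<Longrightarrow> pd_le R n V"
  by (rule pd_le_ext_transport[OF pd_le_ext_umod])

lemma pd_le_dsum:
  "pd_le R n X \<Longrightarrow> pd_le R n Y \<Longrightarrow> pd_le R n (dsum X Y)"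
  by (rule pd_le_ext[OF ses_dsum[OF pd_le_left_module pd_le_left_module]])

text \<open>A cover \<open>P\<close> of \<open>V\<close> is also a cover of \<open>W\<close>. Its
  kernel there consists of the elements that \<open>p\<close> sends into \<open>U\<close>, so it is
  an extension of \<open>U\<close> by the kernel of \<open>p\<close>, and both have dimension at
  most \<open>n\<close>.\<close>

lemma pd_le_quotient:
  fixes R :: "('a, 'r) ring_scheme"
  assumes s: "ses R U V W f g" and V: "pd_le R (Suc n) V" and U: "pd_le R n U"
  shows "pd_le R (Suc n) W"
proof -
  note S = sesD[OF s]
  from V obtain P :: "'a umod" and p where P: "fgp R P" "lin R P V p" "p ` carrier P = carrier V"
    "pd_le R n (P\<lparr>carrier := ker P V p\<rparr>)" by (rule pd_le_SucE)
  have PL: "left_module R P" by (rule fgpD[OF P(1)])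
  have gp: "lin R P W (\<lambda>x. g (p x))" by (rule lin_comp[OF P(2) S(5)])
  let ?L = "P\<lparr>carrier := ker P V p\<rparr>" and ?L' = "P\<lparr>carrier := ker P W (\<lambda>x. g (p x))\<rparr>"
  have L': "left_module R ?L'" by (rule ker_left_module[OF gp PL S(3)])
  have pL': "lin R ?L' V p" by (rule lin_dom[OF P(2)]) (auto simp: ker_def)
  obtain k where k: "lin R ?L' U k" "\<forall>x\<in>carrier ?L'. f (k x) = p x"
    using ses_lift[OF s L' pL'] by (auto simp: ker_def)
  have "ses R ?L ?L' U (\<lambda>x. x) k"
  proof (rule sesI)
    show "left_module R ?L" by (rule ker_left_module[OF P(2) PL S(2)])
    show "lin R ?L ?L' (\<lambda>x. x)"
      using lin_zero[OF S(5,2,3)] by (auto simp: lin_def ker_def)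
  next
    fix u assume u: "u \<in> carrier U"
    have "f u \<in> p ` carrier P" unfolding P(3) by (rule S(10)[OF u])
    then obtain x where x: "f u = p x" "x \<in> carrier P" by (rule imageE)
    have xL: "x \<in> carrier ?L'" using x S(8)[OF u] by (simp add: ker_def)
    then have "f (k x) = f u" using k(2) x(1) by simp
    then have "k x = u" using inj_onD[OF S(6)] u lin_closed[OF k(1) xL] by blast
    then show "\<exists>v\<in>carrier ?L'. k v = u" using xL by blast
  next
    fix x assume x: "x \<in> carrier ?L"
    then have xL: "x \<in> carrier ?L'" using lin_zero[OF S(5,2,3)] by (simp add: ker_def)
    then have "f (k x) = \<zero>\<^bsub>V\<^esub>" using k(2) x by (simp add: ker_def)
    then show "k x = \<zero>\<^bsub>U\<^esub>"
      using S(6) lin_closed[OF k(1) xL] unfolding lin_inj_iff[OF S(4,1,2)] by blast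
  next
    fix x assume "x \<in> carrier ?L'" "k x = \<zero>\<^bsub>U\<^esub>"
    then show "\<exists>u\<in>carrier ?L. x = u" using k(2) lin_zero[OF S(4,1,2)] by (force simp: ker_def)
  qed (use L' S(1) k(1) in auto)
  from pd_le_ext[OF this P(4) U] have "pd_le R n ?L'" .
  moreover have "(\<lambda>x. g (p x)) ` carrier P = carrier W" using P(3) S(7) by (simp add: image_image[symmetric])
  ultimately show ?thesis by (intro pd_le_SucI[OF P(1) S(3) gp])
qed

text \<open>The counterpart of \<open>pd_le_ext_transport\<close> for retracts, needed since the
  induction below meets a kernel retract of a direct sum on a product type.\<close>

lemma pd_le_retract_transport:
  fixes R :: "('a, 'r) ring_scheme"
  assumes H: "\<And>(X :: 'a umod) (Z :: 'a umod) i r.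
      retract R X Z i r \<Longrightarrow> left_module R X \<Longrightarrow> pd_le R n Z \<Longrightarrow> pd_le R n X"
    and r: "retract R X Z i r" and X: "left_module R X" and Z: "pd_le R n Z"
  shows "pd_le R n X"
proof -
  have fg: "fg_module R Z" using Z by (rule pd_le_fg)
  have fgX: "fg_module R X" by (rule fg_retract[OF r fg X])
  obtain X' :: "'a umod" and gX hX where X': "fg_module R X'" "iso_pair R X X' gX hX"
    using fg_copy[OF fgX] by (elim exE conjE)
  obtain Z' :: "'a umod" and gZ hZ where Z': "fg_module R Z'" "iso_pair R Z Z' gZ hZ"
    using fg_copy[OF fg] by (elim exE conjE)
  have L: "left_module R X'" "left_module R Z'" using X' Z' by (auto intro: fg_left_module)
  have "pd_le R n X'"
    by (rule H[OF retract_trans[OF iso_pair_retract(2)[OF X'(2)] retract_trans[OF r iso_pair_retract(1)[OF Z'(2)]]] L(1)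
          pd_le_iso[OF Z'(2) Z L(2)]])
  then show ?thesis by (rule pd_le_iso[OF iso_pair_sym[OF X'(2)] _ X])
qed

text \<open>If \<open>P\<close> covers \<open>Z\<close> with kernel \<open>L\<close>, and \<open>s\<close> lifts the idempotent of \<open>Z\<close> with image \<open>X\<close> to \<open>P\<close>,
  then \<open>x \<mapsto> (s x, x)\<close> and \<open>(l, p) \<mapsto> l + (p - s p)\<close> make the kernel of the induced cover of \<open>X\<close>
  a retract of \<open>L \<oplus> P\<close>.\<close>

lemma pd_le_retract_umod:
  fixes R :: "('a, 'r) ring_scheme" and X :: "'a umod" and Z :: "'a umod"
  assumes "retract R X Z i r" "left_module R X" "pd_le R n Z"
  shows "pd_le R n X"
  using assms
proof (induction n arbitrary: X Z i r)
  case 0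
  then show ?case using fgp_retract by (simp add: pd_le_0_iff)
next
  case (Suc n)
  note r = retractD[OF Suc.prems(1)]
  have Z: "left_module R Z" using Suc.prems(3) by (rule pd_le_left_module)
  from Suc.prems(3) obtain P :: "'a umod" and f where P: "fgp R P" "lin R P Z f" "f ` carrier P = carrier Z"
    "pd_le R n (P\<lparr>carrier := ker P Z f\<rparr>)" by (rule pd_le_SucE)
  have PL: "left_module R P" by (rule fgpD[OF P(1)])
  interpret P: left_module R P by fact
  interpret X: left_module R X by (rule Suc.prems(2))
  have fZ: "f x \<in> carrier Z" if "x \<in> carrier P" for x by (rule lin_closed[OF P(2) that])
  have rf: "lin R P X (\<lambda>x. r (f x))" by (rule lin_comp[OF P(2) r(2)])
  have irf: "lin R P Z (\<lambda>x. i (r (f x)))" by (rule lin_comp[OF rf r(1)])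
  obtain s where s: "lin R P P s" "\<forall>x\<in>carrier P. f (s x) = i (r (f x))"
    using fgp_lift[OF P(1) PL Z P(2) _ irf] P(3) by blast
  have sP: "s x \<in> carrier P" if "x \<in> carrier P" for x by (rule lin_closed[OF s(1) that])
  let ?L = "P\<lparr>carrier := ker P Z f\<rparr>" and ?LX = "P\<lparr>carrier := ker P X (\<lambda>x. r (f x))\<rparr>"
  have LL: "left_module R ?L" by (rule ker_left_module[OF P(2) PL Z])
  have LX: "left_module R ?LX" by (rule ker_left_module[OF rf PL Suc.prems(2)])
  have "retract R ?LX (dsum ?L P) (\<lambda>x. (s x, x)) (\<lambda>v. fst v \<oplus>\<^bsub>P\<^esub> (snd v \<ominus>\<^bsub>P\<^esub> s (snd v)))"
    unfolding retract_def
  proof (intro conjI ballI)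
    have k: "s x \<in> ker P Z f" if "x \<in> ker P X (\<lambda>x. r (f x))" for x
      using that s(2) sP lin_zero[OF r(1) Suc.prems(2) Z] by (simp add: ker_def)
    show "lin R ?LX (dsum ?L P) (\<lambda>x. (s x, x))"
      by (rule linI) (use k in \<open>auto simp: ker_def lin_add[OF s(1)] lin_smult[OF s(1)]\<close>)
    have *: "lin R (dsum ?L P) P (\<lambda>v. fst v \<oplus>\<^bsub>P\<^esub> (snd v \<ominus>\<^bsub>P\<^esub> s (snd v)))"
    proof (rule lin_plus[OF _ _ PL])
      show "lin R (dsum ?L P) P fst"
        using lin_comp[OF dsum_lins(1)[OF LL PL] lin_incl] by (auto simp: ker_def)
      show "lin R (dsum ?L P) P (\<lambda>v. snd v \<ominus>\<^bsub>P\<^esub> s (snd v))"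
        by (rule lin_sub[OF dsum_lins(2)[OF LL PL] lin_comp[OF dsum_lins(2)[OF LL PL] s(1)] PL])
    qed
    show "lin R (dsum ?L P) ?LX (\<lambda>v. fst v \<oplus>\<^bsub>P\<^esub> (snd v \<ominus>\<^bsub>P\<^esub> s (snd v)))"
    proof (rule lin_codom[OF *])
      fix v assume v: "v \<in> carrier (dsum ?L P)"
      then have c: "fst v \<in> carrier P" "snd v \<in> carrier P" "f (fst v) = \<zero>\<^bsub>Z\<^esub>" by (simp_all add: ker_def mem_Times_iff)
      have "r (f (fst v \<oplus>\<^bsub>P\<^esub> (snd v \<ominus>\<^bsub>P\<^esub> s (snd v)))) = r (f (fst v)) \<oplus>\<^bsub>X\<^esub> (r (f (snd v)) \<ominus>\<^bsub>X\<^esub> r (f (s (snd v))))"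
        unfolding lin_add[OF rf c(1) P.M.minus_closed[OF c(2) sP[OF c(2)]]]
          lin_diff[OF rf PL Suc.prems(2) c(2) sP[OF c(2)]] ..
      also have "\<dots> = \<zero>\<^bsub>X\<^esub>"
        using c s(2) r(3) lin_zero[OF r(2) Z Suc.prems(2)] r(5) fZ X.eq_iff_diff[of "r (f (snd v))" "r (f (snd v))"]
        by simp
      finally show "fst v \<oplus>\<^bsub>P\<^esub> (snd v \<ominus>\<^bsub>P\<^esub> s (snd v)) \<in> ker P X (\<lambda>x. r (f x))"
        using c sP by (simp add: ker_def)
    qed
    show "fst (s x, x) \<oplus>\<^bsub>P\<^esub> (snd (s x, x) \<ominus>\<^bsub>P\<^esub> s (snd (s x, x))) = x" if "x \<in> carrier ?LX" for x
      using that sP by (simp add: ker_def P.add_diff)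
  qed
  from pd_le_retract_transport[OF Suc.IH this LX]
  have "pd_le R n ?LX"
    using pd_le_dsum[OF P(4) pd_le_mono[of R 0 P n]] P(1) by (simp add: pd_le_0_iff)
  moreover have "(\<lambda>x. r (f x)) ` carrier P = carrier X" using P(3) r(6) by (simp add: image_image[symmetric])
  ultimately show ?case by (intro pd_le_SucI[OF P(1) Suc.prems(2) rf])
qed

lemma pd_le_retract:
  "retract R X Z i r \<Longrightarrow> left_module R X \<Longrightarrow> pd_le R n Z \<Longrightarrow> pd_le R n X"
  by (rule pd_le_retract_transport[OF pd_le_retract_umod])

section \<open>Injective coresolutions\<close>

lemma injective_modD:
  fixes I :: "'a umod" and X :: "'a umod" and Y :: "'a umod"
  assumes "injective_mod R I" "left_module R X" "left_module R Y" "g \<in> mod_hom R X Y"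
    "inj_on g (carrier X)" "h \<in> mod_hom R X I"
  shows "\<exists>k\<in>mod_hom R Y I. compose (carrier X) k g = h"
  using assms unfolding injective_mod_def by blast

text \<open>\<open>injective_mod\<close> tests only monomorphisms in the universe. An injection
  \<open>c\<close> of the carrier of \<open>Y\<close> into it suffices: \<open>X\<close> is replaced
  by its image in the copy of \<open>Y\<close>. This is the source of the assumptions
  \<open>inj_on c\<close> in what follows.\<close>

lemma injective_extend:
  fixes I :: "'a umod" and R :: "('a, 'r) ring_scheme"
    and X :: "('a, 'x, 's) module_scheme" and Y :: "('a, 'y, 't) module_scheme" and c :: "'y \<Rightarrow> (nat \<Rightarrow> 'a) set"
  assumes I: "injective_mod R I" and X: "left_module R X" and Y: "left_module R Y"
    and c: "inj_on c (carrier Y)" and j: "lin R X Y j" "inj_on j (carrier X)" and h: "lin R X I h"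
  shows "\<exists>k. lin R Y I k \<and> (\<forall>x\<in>carrier X. k (j x) = h x)"
proof -
  have IL: "left_module R I" using I by (simp add: injective_mod_def)
  define Y' where "Y' = transport_mod c Y"
  have Y': "left_module R Y'" unfolding Y'_def by (rule transport_mod_left_module[OF Y c])
  have "mod_iso R Y Y'" unfolding Y'_def by (rule transport_mod_iso[OF Y c])
  then obtain u v where uv: "iso_pair R Y Y' u v" using mod_iso_pair[OF _ Y] by blast
  note D = iso_pairD[OF uv]
  have uj: "lin R X Y' (\<lambda>x. u (j x))" by (rule lin_comp[OF j(1) D(1)])
  define X' where "X' = Y'\<lparr>carrier := (\<lambda>x. u (j x)) ` carrier X\<rparr>"
  have X': "left_module R X'" unfolding X'_def by (rule image_left_module[OF uj X Y'])
  have X'Y': "carrier X' \<subseteq> carrier Y'" using lin_closed[OF uj] by (auto simp: X'_def)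
  have inj: "inj_on (\<lambda>x. u (j x)) (carrier X)"
    using comp_inj_on[OF j(2), of u] D(8) lin_closed[OF j(1)]
    by (metis (mono_tags, lifting) comp_apply image_subsetI inj_on_cong inj_on_subset)
  have "iso_pair R X X' (\<lambda>x. u (j x)) (inv_into (carrier X) (\<lambda>x. u (j x)))"
    unfolding X'_def by (intro bij_iso_pair lin_codom[OF uj] X inj) simp_all
  note E = iso_pairD[OF this]
  let ?t = "inv_into (carrier X) (\<lambda>x. u (j x))"
  have h': "lin R X' I (\<lambda>x. h (?t x))" by (rule lin_comp[OF E(2) h])
  have incl: "lin R X' Y' (\<lambda>x. x)" unfolding X'_def by (rule lin_incl) (use X'Y' in \<open>simp add: X'_def\<close>)
  have "inj_on (restrict (\<lambda>x. x) (carrier X')) (carrier X')" by (simp add: inj_on_def)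
  from injective_modD[OF I X' Y' lin_restrict[OF incl X'] this lin_restrict[OF h' X']]
  obtain k where k: "k \<in> mod_hom R Y' I"
    "compose (carrier X') k (restrict (\<lambda>x. x) (carrier X')) = restrict (\<lambda>x. h (?t x)) (carrier X')" by blast
  have kl: "lin R Y' I k" using k(1) by (simp add: mod_hom_lin)
  have "k (u (j x)) = h x" if x: "x \<in> carrier X" for x
    using fun_cong[OF k(2), of "u (j x)"] E(3)[OF x] E(5)[OF x] by (simp add: compose_def)
  then show ?thesis using lin_comp[OF D(1) kl] by blast
qed

section \<open>Vanishing of extensions, read off from a fixed injective coresolution\<close>

locale inj_cores =
  fixes R :: "('a, 'r) ring_scheme" and N :: "('a, 'x, 's) module_scheme" and n :: nat
    and I :: "nat \<Rightarrow> 'a umod" and d and e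
  assumes N: "left_module R N" and cores: "inj_coresolution R N n I d e"
begin

lemma inj: "injective_mod R (I i)"
  using cores by (simp add: inj_coresolution_def)

lemma IL: "left_module R (I i)"
  using inj[of i] by (simp add: injective_mod_def)

lemma d_lin: "lin R (I i) (I (Suc i)) (d i)" and e_lin: "lin R N (I 0) e"
  using cores by (simp_all add: inj_coresolution_def mod_hom_lin)

lemma e_inj: "inj_on e (carrier N)"
  using cores by (simp add: inj_coresolution_def)

lemma zero_above: "n < i \<Longrightarrow> x \<in> carrier (I i) \<Longrightarrow> x = \<zero>\<^bsub>I i\<^esub>"
  using cores by (auto simp: inj_coresolution_def zero_mod_def)

lemma exact_d: "d i ` carrier (I i) = ker (I (Suc i)) (I (Suc (Suc i))) (d (Suc i))"
  and exact_e: "e ` carrier N = ker (I 0) (I (Suc 0)) (d 0)"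
  using cores by (simp_all add: inj_coresolution_def exact_at_def a_kernel_ker)

lemma dd: "x \<in> carrier (I i) \<Longrightarrow> d (Suc i) (d i x) = \<zero>\<^bsub>I (Suc (Suc i))\<^esub>"
  using exact_d[of i] by (auto simp: ker_def)

lemma de: "x \<in> carrier N \<Longrightarrow> d 0 (e x) = \<zero>\<^bsub>I (Suc 0)\<^esub>"
  using exact_e by (auto simp: ker_def)

lemma cores_lift:
  assumes X: "left_module R X" and u: "lin R X (I 0) u" "\<And>x. x \<in> carrier X \<Longrightarrow> d 0 (u x) = \<zero>\<^bsub>I (Suc 0)\<^esub>"
  shows "\<exists>b. lin R X N b \<and> (\<forall>x\<in>carrier X. e (b x) = u x)"
proof -
  let ?E = "I 0\<lparr>carrier := e ` carrier N\<rparr>"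
  have "iso_pair R N ?E e (inv_into (carrier N) e)"
    by (intro bij_iso_pair N e_inj lin_codom[OF e_lin]) simp_all
  note D = iso_pairD[OF this]
  have uE: "u x \<in> e ` carrier N" if "x \<in> carrier X" for x
    unfolding exact_e using lin_closed[OF u(1) that] u(2)[OF that] by (simp add: ker_def)
  have "lin R X N (\<lambda>x. inv_into (carrier N) e (u x))"
    by (rule lin_comp[OF lin_codom[OF u(1) uE] D(2)])
  moreover have "e (inv_into (carrier N) e (u x)) = u x" if "x \<in> carrier X" for x
    using D(4) uE[OF that] by simp
  ultimately show ?thesis by blast
qed

text \<open>By exactness a cocycle of positive degree takes values in the image of
  \<open>d i\<close>, and projectivity lifts it from there.\<close>

lemma fgp_cores_lift:
  assumes P: "fgp R P" and h: "lin R P (I (Suc i)) h" "\<And>x. x \<in> carrier P \<Longrightarrow> d (Suc i) (h x) = \<zero>\<^bsub>I (Suc (Suc i))\<^esub>"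
  shows "\<exists>m. lin R P (I i) m \<and> (\<forall>x\<in>carrier P. d i (m x) = h x)"
proof -
  let ?Y = "I (Suc i)\<lparr>carrier := d i ` carrier (I i)\<rparr>"
  have Y: "left_module R ?Y" by (rule image_left_module[OF d_lin IL IL])
  have hY: "lin R P ?Y h"
    by (rule lin_codom[OF h(1)]) (use h(2) lin_closed[OF h(1)] in \<open>simp add: exact_d ker_def\<close>)
  have dY: "lin R (I i) ?Y (d i)" by (rule lin_codom[OF d_lin]) simp
  show ?thesis by (rule fgp_lift[OF P IL Y dY _ hY]) simp
qed

text \<open>\<open>cohom_above k X\<close> says that \<open>Ext\<^sup>i(X, N) = 0\<close> for all \<open>i > k\<close>, in terms of the complex
  \<open>Hom(X, I)\<close>.\<close>

definition cohom_above :: "nat \<Rightarrow> ('a, 'y, 't) module_scheme \<Rightarrow> bool" where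
  "cohom_above k X \<longleftrightarrow> (\<forall>i\<ge>k. \<forall>h. lin R X (I (Suc i)) h \<and>
     (\<forall>x\<in>carrier X. d (Suc i) (h x) = \<zero>\<^bsub>I (Suc (Suc i))\<^esub>) \<longrightarrow>
     (\<exists>m. lin R X (I i) m \<and> (\<forall>x\<in>carrier X. d i (m x) = h x)))"

lemma cohom_aboveD:
  assumes "cohom_above k X" "k \<le> i" "lin R X (I (Suc i)) h"
    "\<And>x. x \<in> carrier X \<Longrightarrow> d (Suc i) (h x) = \<zero>\<^bsub>I (Suc (Suc i))\<^esub>"
  shows "\<exists>m. lin R X (I i) m \<and> (\<forall>x\<in>carrier X. d i (m x) = h x)"
  using assms by (auto simp: cohom_above_def)

lemma cohom_above_mono: "cohom_above k X \<Longrightarrow> k \<le> l \<Longrightarrow> cohom_above l X"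
  by (auto simp: cohom_above_def)

text \<open>Cocycles in degrees above \<open>n\<close> vanish because the coresolution does; this is
  where the injective dimension starts every dimension shift.\<close>

lemma cohom_above_top:
  assumes X: "left_module R X" shows "cohom_above n X"
  unfolding cohom_above_def
proof (intro allI impI)
  fix i h assume i: "n \<le> i" and h: "lin R X (I (Suc i)) h \<and> (\<forall>x\<in>carrier X. d (Suc i) (h x) = \<zero>\<^bsub>I (Suc (Suc i))\<^esub>)"
  have "h x = \<zero>\<^bsub>I (Suc i)\<^esub>" if "x \<in> carrier X" for x
    by (rule zero_above) (use i h that lin_closed in auto)
  then show "\<exists>m. lin R X (I i) m \<and> (\<forall>x\<in>carrier X. d i (m x) = h x)"
    using lin_zero[OF d_lin IL IL] by (intro exI[of _ "\<lambda>x. \<zero>\<^bsub>I i\<^esub>"]) (simp add: lin_zero_map[OF X IL])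
qed

lemma cohom_above_fgp: "fgp R P \<Longrightarrow> cohom_above 0 P"
  unfolding cohom_above_def using fgp_cores_lift by blast

lemma cohom_above_retract:
  assumes r: "retract R X Z i r" and Z: "cohom_above k Z"
  shows "cohom_above k X"
  unfolding cohom_above_def
proof (intro allI impI, elim conjE)
  note D = retractD[OF r]
  fix j h assume j: "k \<le> j" "lin R X (I (Suc j)) h" "\<forall>x\<in>carrier X. d (Suc j) (h x) = \<zero>\<^bsub>I (Suc (Suc j))\<^esub>"
  obtain m where m: "lin R Z (I j) m" "\<forall>x\<in>carrier Z. d j (m x) = h (r x)"
    using cohom_aboveD[OF Z j(1) lin_comp[OF D(2) j(2)]] j(3) D(5) by blast
  show "\<exists>m. lin R X (I j) m \<and> (\<forall>x\<in>carrier X. d j (m x) = h x)"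
    using lin_comp[OF D(1) m(1)] m(2) D(3,4) by (intro exI[of _ "\<lambda>x. m (i x)"]) simp
qed

text \<open>Dimension shifting as a chase in \<open>Hom(-, I)\<close>. Extend a cocycle from
  \<open>X\<close> to \<open>Y\<close>; its coboundary vanishes on \<open>X\<close> and descends to
  a cocycle \<open>h''\<close> on \<open>Z\<close>, one degree higher. Subtracting a primitive
  \<open>l\<close> of \<open>h''\<close> makes the extension a cocycle on \<open>Y\<close>, and a
  primitive of that restricts to one on \<open>X\<close>.\<close>

lemma cohom_above_cover:
  fixes c :: "'y \<Rightarrow> (nat \<Rightarrow> 'a) set" and Y :: "('a, 'y, 't) module_scheme"
  assumes s: "ses R X Y Z f g" and Y: "cohom_above 0 Y" and Z: "cohom_above (Suc k) Z"
    and c: "inj_on c (carrier Y)"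
  shows "cohom_above k X"
  unfolding cohom_above_def
proof (intro allI impI, elim conjE)
  note S = sesD[OF s]
  fix i h assume i: "k \<le> i" and h: "lin R X (I (Suc i)) h" "\<forall>x\<in>carrier X. d (Suc i) (h x) = \<zero>\<^bsub>I (Suc (Suc i))\<^esub>"
  interpret I1: left_module R "I (Suc i)" by (rule IL)
  obtain h' where h': "lin R Y (I (Suc i)) h'" "\<forall>x\<in>carrier X. h' (f x) = h x"
    using injective_extend[OF inj S(1,2) c S(4,6) h(1)] by blast
  have dh': "lin R Y (I (Suc (Suc i))) (\<lambda>y. d (Suc i) (h' y))" by (rule lin_comp[OF h'(1) d_lin])
  have "d (Suc i) (h' y) = \<zero>\<^bsub>I (Suc (Suc i))\<^esub>" if y: "y \<in> carrier Y" "g y = \<zero>\<^bsub>Z\<^esub>" for y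
  proof -
    obtain x where "x \<in> carrier X" "y = f x" using S(9)[OF y] by blast
    then show ?thesis using h'(2) h(2) by simp
  qed
  from lin_factor[OF S(5,2,3) IL S(7) dh' this]
  obtain h'' where h'': "lin R Z (I (Suc (Suc i))) h''" "\<forall>y\<in>carrier Y. h'' (g y) = d (Suc i) (h' y)" by blast
  have "d (Suc (Suc i)) (h'' z) = \<zero>\<^bsub>I (Suc (Suc (Suc i)))\<^esub>" if z: "z \<in> carrier Z" for z
  proof -
    have "z \<in> g ` carrier Y" unfolding S(7) by (rule z)
    then obtain y where "z = g y" "y \<in> carrier Y" by (rule imageE)
    then show ?thesis using h''(2) dd[OF lin_closed[OF h'(1)]] by simp
  qed
  then obtain l where l: "lin R Z (I (Suc i)) l" "\<forall>z\<in>carrier Z. d (Suc i) (l z) = h'' z"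
    using cohom_aboveD[OF Z _ h''(1)] i by auto
  have u: "lin R Y (I (Suc i)) (\<lambda>y. h' y \<ominus>\<^bsub>I (Suc i)\<^esub> l (g y))"
    by (rule lin_sub[OF h'(1) lin_comp[OF S(5) l(1)] IL])
  interpret I2: left_module R "I (Suc (Suc i))" by (rule IL)
  have "d (Suc i) (h' y \<ominus>\<^bsub>I (Suc i)\<^esub> l (g y)) = \<zero>\<^bsub>I (Suc (Suc i))\<^esub>" if y: "y \<in> carrier Y" for y
  proof -
    have "d (Suc i) (h' y) \<in> carrier (I (Suc (Suc i)))" by (rule lin_closed[OF dh' y])
    then show ?thesis
      using lin_closed[OF h'(1) y] lin_closed[OF l(1) S(11)[OF y]] l(2) h''(2) S(11)[OF y] y
        I2.eq_iff_diff[of "d (Suc i) (h' y)" "d (Suc i) (h' y)"]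
      by (simp add: lin_diff[OF d_lin IL IL])
  qed
  then obtain m where m: "lin R Y (I i) m" "\<forall>y\<in>carrier Y. d i (m y) = h' y \<ominus>\<^bsub>I (Suc i)\<^esub> l (g y)"
    using cohom_aboveD[OF Y _ u] by auto
  have "d i (m (f x)) = h x" if x: "x \<in> carrier X" for x
    using m(2) S(8,10)[OF x] h'(2) x lin_zero[OF l(1) S(3) IL] lin_closed[OF h(1) x]
    by (simp add: I1.minus_zero)
  then show "\<exists>m. lin R X (I i) m \<and> (\<forall>x\<in>carrier X. d i (m x) = h x)"
    using lin_comp[OF S(4) m(1)] by blast
qed

text \<open>From degree \<open>n\<close> on, any extension of a cocycle to \<open>Y\<close> is again
  a cocycle, since its coboundary lies in a zero module. A primitive on \<open>Y\<close> restricts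
  to \<open>X\<close>. This improves the bound of \<open>cohom_above_top\<close> by one.\<close>

lemma cohom_above_sub:
  fixes c :: "'y \<Rightarrow> (nat \<Rightarrow> 'a) set" and Y :: "('a, 'y, 't) module_scheme"
  assumes X: "left_module R X" and Y: "left_module R Y" and f: "lin R X Y f" "inj_on f (carrier X)"
    and Y0: "cohom_above 0 Y" and c: "inj_on c (carrier Y)" and n: "n = Suc k"
  shows "cohom_above k X"
  unfolding cohom_above_def
proof (intro allI impI, elim conjE)
  fix i h assume i: "k \<le> i" and h: "lin R X (I (Suc i)) h" "\<forall>x\<in>carrier X. d (Suc i) (h x) = \<zero>\<^bsub>I (Suc (Suc i))\<^esub>"
  obtain h' where h': "lin R Y (I (Suc i)) h'" "\<forall>x\<in>carrier X. h' (f x) = h x"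
    using injective_extend[OF inj X Y c f h(1)] by blast
  have "d (Suc i) (h' y) = \<zero>\<^bsub>I (Suc (Suc i))\<^esub>" if "y \<in> carrier Y" for y
    by (rule zero_above) (use i n lin_closed[OF d_lin lin_closed[OF h'(1) that]] in auto)
  then obtain m where m: "lin R Y (I i) m" "\<forall>y\<in>carrier Y. d i (m y) = h' y"
    using cohom_aboveD[OF Y0 _ h'(1)] by auto
  then show "\<exists>m. lin R X (I i) m \<and> (\<forall>x\<in>carrier X. d i (m x) = h x)"
    using lin_comp[OF f(1) m(1)] h'(2) lin_closed[OF f(1)] by (intro exI[of _ "\<lambda>x. m (f x)"]) simp
qed

text \<open>The vanishing of Ext^1(Z, N), turned into extension of maps. The chase is that of
  \<open>cohom_above_cover\<close>, with \<open>e\<close> in the place of the differential.\<close>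

lemma cohom_extend:
  fixes c :: "'y \<Rightarrow> (nat \<Rightarrow> 'a) set" and Y :: "('a, 'y, 't) module_scheme"
  assumes s: "ses R X Y Z f g" and Z: "cohom_above 0 Z" and c: "inj_on c (carrier Y)" and a: "lin R X N a"
  shows "\<exists>b. lin R Y N b \<and> (\<forall>x\<in>carrier X. b (f x) = a x)"
proof -
  note S = sesD[OF s]
  interpret I0: left_module R "I 0" by (rule IL)
  interpret I1: left_module R "I (Suc 0)" by (rule IL)
  obtain h where h: "lin R Y (I 0) h" "\<forall>x\<in>carrier X. h (f x) = e (a x)"
    using injective_extend[OF inj S(1,2) c S(4,6) lin_comp[OF a e_lin]] by blast
  have dh: "lin R Y (I (Suc 0)) (\<lambda>y. d 0 (h y))" by (rule lin_comp[OF h(1) d_lin])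
  have "d 0 (h y) = \<zero>\<^bsub>I (Suc 0)\<^esub>" if y: "y \<in> carrier Y" "g y = \<zero>\<^bsub>Z\<^esub>" for y
  proof -
    obtain x where "x \<in> carrier X" "y = f x" using S(9)[OF y] by blast
    then show ?thesis using h(2) de[OF lin_closed[OF a]] by simp
  qed
  from lin_factor[OF S(5,2,3) IL S(7) dh this]
  obtain h' where h': "lin R Z (I (Suc 0)) h'" "\<forall>y\<in>carrier Y. h' (g y) = d 0 (h y)" by blast
  have "d (Suc 0) (h' z) = \<zero>\<^bsub>I (Suc (Suc 0))\<^esub>" if z: "z \<in> carrier Z" for z
  proof -
    have "z \<in> g ` carrier Y" unfolding S(7) by (rule z)
    then obtain y where "z = g y" "y \<in> carrier Y" by (rule imageE)
    then show ?thesis using h'(2) dd[OF lin_closed[OF h(1)]] by simp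
  qed
  then obtain m where m: "lin R Z (I 0) m" "\<forall>z\<in>carrier Z. d 0 (m z) = h' z"
    using cohom_aboveD[OF Z _ h'(1)] by auto
  have u: "lin R Y (I 0) (\<lambda>y. h y \<ominus>\<^bsub>I 0\<^esub> m (g y))"
    by (rule lin_sub[OF h(1) lin_comp[OF S(5) m(1)] IL])
  have "d 0 (h y \<ominus>\<^bsub>I 0\<^esub> m (g y)) = \<zero>\<^bsub>I (Suc 0)\<^esub>" if y: "y \<in> carrier Y" for y
    using lin_closed[OF h(1) y] lin_closed[OF m(1) S(11)[OF y]] m(2) h'(2) S(11)[OF y] y lin_closed[OF dh y]
      I1.eq_iff_diff[of "d 0 (h y)" "d 0 (h y)"]
    by (simp add: lin_diff[OF d_lin IL IL])
  from cores_lift[OF S(2) u this]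
  obtain b where b: "lin R Y N b" "\<forall>y\<in>carrier Y. e (b y) = h y \<ominus>\<^bsub>I 0\<^esub> m (g y)" by blast
  have "b (f x) = a x" if x: "x \<in> carrier X" for x
  proof -
    have "e (b (f x)) = e (a x)"
      using b(2) S(8,10)[OF x] h(2) x lin_zero[OF m(1) S(3) IL] lin_closed[OF lin_comp[OF a e_lin] x]
      by (simp add: I0.minus_zero)
    then show ?thesis using inj_onD[OF e_inj] lin_closed[OF b(1) S(10)[OF x]] lin_closed[OF a x] by blast
  qed
  then show ?thesis using b(1) by blast
qed

text \<open>Dimension shifting in the opposite direction. In degree one the vanishing on
  \<open>X\<close> gives no information about \<open>Z\<close>; there the hypothesis
  \<open>ext\<close> takes over.\<close>

lemma cohom_above_cokernel:
  fixes c :: "'y \<Rightarrow> (nat \<Rightarrow> 'a) set" and P :: "('a, 'y, 't) module_scheme"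
  assumes s: "ses R X P Z f g" and X: "cohom_above 0 X" and P: "cohom_above 0 P" and c: "inj_on c (carrier P)"
    and ext: "\<And>a. lin R X N a \<Longrightarrow> \<exists>b. lin R P N b \<and> (\<forall>x\<in>carrier X. b (f x) = a x)"
  shows "cohom_above 0 Z"
  unfolding cohom_above_def
proof (intro allI impI, elim conjE)
  note S = sesD[OF s]
  fix i h assume h: "lin R Z (I (Suc i)) h" "\<forall>z\<in>carrier Z. d (Suc i) (h z) = \<zero>\<^bsub>I (Suc (Suc i))\<^esub>"
  interpret I0: left_module R "I i" by (rule IL)
  interpret I1: left_module R "I (Suc i)" by (rule IL)
  obtain m where m: "lin R P (I i) m" "\<forall>p\<in>carrier P. d i (m p) = h (g p)"
    using cohom_aboveD[OF P _ lin_comp[OF S(5) h(1)]] h(2) S(11) by auto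
  have dm: "d i (m (f x)) = \<zero>\<^bsub>I (Suc i)\<^esub>" if "x \<in> carrier X" for x
    using m(2) S(8,10)[OF that] lin_zero[OF h(1) S(3) IL] by simp
  have mf: "lin R X (I i) (\<lambda>x. m (f x))" by (rule lin_comp[OF S(4) m(1)])
  \<comment> \<open>The primitive \<open>m\<close> of the pulled-back cocycle descends to
    \<open>Z\<close> only after it is changed to vanish on \<open>X\<close>. The correction
    \<open>w\<close> must be a cocycle on \<open>P\<close>: for \<open>i = 0\<close> it comes from
    an extended map into \<open>N\<close>, otherwise it is the coboundary of an extended
    primitive.\<close>
  have "\<exists>w. lin R P (I i) w \<and> (\<forall>x\<in>carrier X. w (f x) = m (f x)) \<and> (\<forall>p\<in>carrier P. d i (w p) = \<zero>\<^bsub>I (Suc i)\<^esub>)"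
  proof (cases i)
    case 0
    obtain a where a: "lin R X N a" "\<forall>x\<in>carrier X. e (a x) = m (f x)"
      using cores_lift[OF S(1), of "\<lambda>x. m (f x)"] mf dm unfolding 0 by blast
    obtain b where b: "lin R P N b" "\<forall>x\<in>carrier X. b (f x) = a x" using ext[OF a(1)] by blast
    show ?thesis unfolding 0
      using lin_comp[OF b(1) e_lin] a(2) b(2) de[OF lin_closed[OF b(1)]] by (intro exI[of _ "\<lambda>p. e (b p)"]) simp
  next
    case (Suc j)
    obtain l where l: "lin R X (I j) l" "\<forall>x\<in>carrier X. d j (l x) = m (f x)"
      using cohom_aboveD[OF X, of j "\<lambda>x. m (f x)"] mf dm unfolding Suc by blast
    obtain l' where l': "lin R P (I j) l'" "\<forall>x\<in>carrier X. l' (f x) = l x"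
      using injective_extend[OF inj S(1,2) c S(4,6) l(1)] by blast
    show ?thesis unfolding Suc
      using lin_comp[OF l'(1) d_lin] l(2) l'(2) dd[OF lin_closed[OF l'(1)]] by (intro exI[of _ "\<lambda>p. d j (l' p)"]) simp
  qed
  then obtain w where w: "lin R P (I i) w" "\<forall>x\<in>carrier X. w (f x) = m (f x)" "\<forall>p\<in>carrier P. d i (w p) = \<zero>\<^bsub>I (Suc i)\<^esub>"
    by blast
  have u: "lin R P (I i) (\<lambda>p. m p \<ominus>\<^bsub>I i\<^esub> w p)" by (rule lin_sub[OF m(1) w(1) IL])
  have "m p \<ominus>\<^bsub>I i\<^esub> w p = \<zero>\<^bsub>I i\<^esub>" if p: "p \<in> carrier P" "g p = \<zero>\<^bsub>Z\<^esub>" for p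
  proof -
    obtain x where "x \<in> carrier X" "p = f x" using S(9)[OF p] by blast
    then show ?thesis using w(2) lin_closed[OF mf] I0.eq_iff_diff[of "m (f x)" "m (f x)"] by simp
  qed
  from lin_factor[OF S(5,2,3) IL S(7) u this]
  obtain m' where m': "lin R Z (I i) m'" "\<forall>p\<in>carrier P. m' (g p) = m p \<ominus>\<^bsub>I i\<^esub> w p" by blast
  have "d i (m' z) = h z" if z: "z \<in> carrier Z" for z
  proof -
    have "z \<in> g ` carrier P" unfolding S(7) by (rule z)
    then obtain p where p: "z = g p" "p \<in> carrier P" by (rule imageE)
    show ?thesis
      using m'(2) p m(2) w(3) lin_closed[OF m(1) p(2)] lin_closed[OF w(1) p(2)] lin_closed[OF h(1) z]
      by (simp add: lin_diff[OF d_lin IL IL] I1.minus_zero)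
  qed
  then show "\<exists>m. lin R Z (I i) m \<and> (\<forall>z\<in>carrier Z. d i (m z) = h z)" using m'(1) by blast
qed

text \<open>In an exact complex of projectives, extension problems along the differentials are solvable
  since cocycles can be shifted along \<open>I\<close> until they land in a zero module.\<close>

lemma exact_complex_extend:
  fixes Y :: "nat \<Rightarrow> ('a, 'y, 't) module_scheme" and c :: "nat \<Rightarrow> 'y \<Rightarrow> (nat \<Rightarrow> 'a) set"
  assumes Y: "\<And>j. fgp R (Y j)" and E: "\<And>j. lin R (Y j) (Y (Suc j)) (E j)"
    and ex: "\<And>j. E j ` carrier (Y j) = ker (Y (Suc j)) (Y (Suc (Suc j))) (E (Suc j))"
    and c: "\<And>j. inj_on (c j) (carrier (Y j))"
    and f: "lin R (Y j) N f" "\<And>y. y \<in> carrier (Y j) \<Longrightarrow> E j y = \<zero>\<^bsub>Y (Suc j)\<^esub> \<Longrightarrow> f y = \<zero>\<^bsub>N\<^esub>"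
  shows "\<exists>g. lin R (Y (Suc j)) N g \<and> (\<forall>y\<in>carrier (Y j). g (E j y) = f y)"
proof -
  have YL: "left_module R (Y j)" for j by (rule fgpD[OF Y])
  \<comment> \<open>Here \<open>k\<close> is the distance of \<open>i\<close> from degree
    \<open>n + 1\<close>. There the target is a zero module and the zero map is a solution.\<close>
  have main: "\<exists>g. lin R (Y (Suc j)) (I i) g \<and> (\<forall>y\<in>carrier (Y j). g (E j y) = f y) \<and>
      (\<forall>y\<in>carrier (Y (Suc j)). d i (g y) = \<zero>\<^bsub>I (Suc i)\<^esub>)"
    if "i + k = Suc n" "lin R (Y j) (I i) f" "\<forall>y\<in>carrier (Y j). d i (f y) = \<zero>\<^bsub>I (Suc i)\<^esub>"
      "\<forall>y\<in>carrier (Y j). E j y = \<zero>\<^bsub>Y (Suc j)\<^esub> \<longrightarrow> f y = \<zero>\<^bsub>I i\<^esub>" for k i j f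
    using that
  proof (induction k arbitrary: i j f)
    case 0
    then have "f y = \<zero>\<^bsub>I i\<^esub>" if "y \<in> carrier (Y j)" for y
      using that by (intro zero_above) (auto intro: lin_closed)
    then show ?case
      using lin_zero[OF d_lin IL IL] by (intro exI[of _ "\<lambda>x. \<zero>\<^bsub>I i\<^esub>"]) (simp add: lin_zero_map[OF YL IL])
  next
    case (Suc k)
    interpret I0: left_module R "I i" by (rule IL)
    interpret I1: left_module R "I (Suc i)" by (rule IL)
    let ?V = "Y (Suc j)\<lparr>carrier := E j ` carrier (Y j)\<rparr>"
    have V: "left_module R ?V" by (rule image_left_module[OF E YL YL])
    have EV: "lin R (Y j) ?V (E j)" by (rule lin_codom[OF E]) simp
    obtain f' where f': "lin R ?V (I i) f'" "\<forall>y\<in>carrier (Y j). f' (E j y) = f y"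
      using lin_factor[OF EV YL V IL _ Suc.prems(2)] Suc.prems(4) by auto
    have EVY: "E j ` carrier (Y j) \<subseteq> carrier (Y (Suc j))" using lin_closed[OF E] by auto
    obtain g0 where g0: "lin R (Y (Suc j)) (I i) g0" "\<forall>v\<in>carrier ?V. g0 v = f' v"
      using injective_extend[OF inj V YL c lin_incl[OF EVY] _ f'(1)] by auto
    have g0E: "g0 (E j y) = f y" if "y \<in> carrier (Y j)" for y using g0(2) f'(2) that by simp
    have dg: "lin R (Y (Suc j)) (I (Suc i)) (\<lambda>y. d i (g0 y))" by (rule lin_comp[OF g0(1) d_lin])
    have "\<forall>y\<in>carrier (Y (Suc j)). E (Suc j) y = \<zero>\<^bsub>Y (Suc (Suc j))\<^esub> \<longrightarrow> d i (g0 y) = \<zero>\<^bsub>I (Suc i)\<^esub>"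
    proof (intro ballI impI)
      fix y assume "y \<in> carrier (Y (Suc j))" "E (Suc j) y = \<zero>\<^bsub>Y (Suc (Suc j))\<^esub>"
      then have "y \<in> E j ` carrier (Y j)" unfolding ex by (simp add: ker_def)
      then obtain z where "y = E j z" "z \<in> carrier (Y j)" by (rule imageE)
      then show "d i (g0 y) = \<zero>\<^bsub>I (Suc i)\<^esub>" using g0E Suc.prems(3) by simp
    qed
    moreover have "\<forall>y\<in>carrier (Y (Suc j)). d (Suc i) (d i (g0 y)) = \<zero>\<^bsub>I (Suc (Suc i))\<^esub>"
      using dd[OF lin_closed[OF g0(1)]] by blast
    \<comment> \<open>\<open>d i \<circ> g0\<close> measures by how much the extension
      \<open>g0\<close> fails to be a cocycle. It is itself a cocycle that vanishes on the kernel of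
      \<open>E (Suc j)\<close>, so the induction hypothesis applies one step further along both
      complexes.\<close>
    ultimately obtain h where h: "lin R (Y (Suc (Suc j))) (I (Suc i)) h"
      "\<forall>y\<in>carrier (Y (Suc j)). h (E (Suc j) y) = d i (g0 y)"
      "\<forall>y\<in>carrier (Y (Suc (Suc j))). d (Suc i) (h y) = \<zero>\<^bsub>I (Suc (Suc i))\<^esub>"
      using Suc.IH[of "Suc i" "Suc j" "\<lambda>y. d i (g0 y)"] Suc.prems(1) dg by auto
    obtain h' where h': "lin R (Y (Suc (Suc j))) (I i) h'" "\<forall>y\<in>carrier (Y (Suc (Suc j))). d i (h' y) = h y"
      using fgp_cores_lift[OF Y h(1)] h(3) by blast
    \<comment> \<open>\<open>h'\<close> lifts \<open>h\<close> along \<open>d i\<close>. Subtracting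
      its pullback restores the cocycle condition and changes nothing on the image of
      \<open>E j\<close>, since that is killed by \<open>E (Suc j)\<close>.\<close>
    let ?g = "\<lambda>y. g0 y \<ominus>\<^bsub>I i\<^esub> h' (E (Suc j) y)"
    have g: "lin R (Y (Suc j)) (I i) ?g" by (rule lin_sub[OF g0(1) lin_comp[OF E h'(1)] IL])
    have "?g (E j y) = f y" if y: "y \<in> carrier (Y j)" for y
    proof -
      have "E j y \<in> ker (Y (Suc j)) (Y (Suc (Suc j))) (E (Suc j))" unfolding ex[symmetric] using y by (rule imageI)
      then have "E (Suc j) (E j y) = \<zero>\<^bsub>Y (Suc (Suc j))\<^esub>" by (simp add: ker_def)
      then show ?thesis using g0E[OF y] lin_zero[OF h'(1) YL IL] lin_closed[OF Suc.prems(2) y] by (simp add: I0.minus_zero)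
    qed
    moreover have "d i (?g y) = \<zero>\<^bsub>I (Suc i)\<^esub>" if y: "y \<in> carrier (Y (Suc j))" for y
      using lin_closed[OF g0(1) y] lin_closed[OF h'(1) lin_closed[OF E y]] h(2) h'(2) lin_closed[OF E y] y
        lin_closed[OF dg y] I1.eq_iff_diff[of "d i (g0 y)" "d i (g0 y)"]
      by (simp add: lin_diff[OF d_lin IL IL])
    ultimately show ?case using g by blast
  qed
  have "\<exists>g. lin R (Y (Suc j)) (I 0) g \<and> (\<forall>y\<in>carrier (Y j). g (E j y) = e (f y)) \<and>
      (\<forall>y\<in>carrier (Y (Suc j)). d 0 (g y) = \<zero>\<^bsub>I (Suc 0)\<^esub>)"
    using f(2) de[OF lin_closed[OF f(1)]] lin_zero[OF e_lin N IL]
    by (intro main[of 0 "Suc n"] lin_comp[OF f(1) e_lin]) auto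
  then obtain g where g: "lin R (Y (Suc j)) (I 0) g" "\<forall>y\<in>carrier (Y j). g (E j y) = e (f y)"
      "\<forall>y\<in>carrier (Y (Suc j)). d 0 (g y) = \<zero>\<^bsub>I (Suc 0)\<^esub>" by blast
  obtain b where b: "lin R (Y (Suc j)) N b" "\<forall>y\<in>carrier (Y (Suc j)). e (b y) = g y"
    using cores_lift[OF YL g(1)] g(3) by blast
  have "b (E j y) = f y" if y: "y \<in> carrier (Y j)" for y
  proof (rule inj_onD[OF e_inj])
    show "e (b (E j y)) = e (f y)" using b(2) g(2) lin_closed[OF E y] y by simp
    show "b (E j y) \<in> carrier N" "f y \<in> carrier N" using lin_closed[OF b(1) lin_closed[OF E y]] lin_closed[OF f(1) y] .
  qed
  then show ?thesis using b(1) by blast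
qed

end

section \<open>Powers and duality of free modules\<close>

definition pin :: "('a, 'x, 's) module_scheme \<Rightarrow> nat \<Rightarrow> nat \<Rightarrow> 'x \<Rightarrow> nat \<Rightarrow> 'x" where
  "pin M m j y = (\<lambda>i\<in>{..<m}. if i = j then y else \<zero>\<^bsub>M\<^esub>)"

lemma pin_lin:
  assumes "left_module R M"
  shows "lin R M (power_mod M m) (pin M m j)"
proof -
  have "lin R M (power_mod M m) (\<lambda>y. \<lambda>i\<in>{..<m}. if i = j then y else \<zero>\<^bsub>M\<^esub>)"
  proof (rule power_tuple_lin[OF assms assms])
    fix i show "lin R M M (\<lambda>y. if i = j then y else \<zero>\<^bsub>M\<^esub>)"
      by (cases "i = j") (simp_all add: lin_id lin_zero_map[OF assms assms])
  qed
  then show ?thesis by (simp add: pin_def[abs_def])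
qed

lemma pin_decomp:
  assumes M: "left_module R M" and v: "v \<in> carrier (power_mod M m)"
  shows "v = msum (power_mod M m) m (\<lambda>j. pin M m j (v j))"
proof (rule power_mod_eqI[OF v])
  interpret M: left_module R M by fact
  have P: "left_module R (power_mod M m)" by (rule power_left_module[OF M])
  interpret P: left_module R "power_mod M m" by fact
  have t: "pin M m j (v j) \<in> carrier (power_mod M m)" if "j < m" for j
    by (rule lin_closed[OF pin_lin[OF M] power_modD[OF v that]])
  show "msum (power_mod M m) m (\<lambda>j. pin M m j (v j)) \<in> carrier (power_mod M m)" by (rule P.msum_closed[OF t])
  fix i assume i: "i < m"
  have "msum (power_mod M m) m (\<lambda>j. pin M m j (v j)) i = msum M m (\<lambda>j. pin M m j (v j) i)"
    by (rule msum_lin(2)[OF power_proj_lin[OF i] P M t])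
  also have "\<dots> = v i"
    by (rule M.msum_single[OF i]) (use i power_modD[OF v i] in \<open>auto simp: pin_def\<close>)
  finally show "v i = msum (power_mod M m) m (\<lambda>j. pin M m j (v j)) i" ..
qed

lemma (in inj_cores) cohom_above_power:
  assumes Y: "left_module R Y" and k: "cohom_above k Y"
  shows "cohom_above k (power_mod Y s)"
  unfolding cohom_above_def
proof (intro allI impI, elim conjE)
  let ?P = "power_mod Y s"
  have P: "left_module R ?P" by (rule power_left_module[OF Y])
  fix i h assume i: "k \<le> i" and h: "lin R ?P (I (Suc i)) h" "\<forall>x\<in>carrier ?P. d (Suc i) (h x) = \<zero>\<^bsub>I (Suc (Suc i))\<^esub>"
  have pc: "pin Y s j y \<in> carrier ?P" if "y \<in> carrier Y" for j y by (rule lin_closed[OF pin_lin[OF Y] that])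
  have "\<exists>m. lin R Y (I i) m \<and> (\<forall>x\<in>carrier Y. d i (m x) = h (pin Y s j x))" for j
    by (rule cohom_aboveD[OF k i lin_comp[OF pin_lin[OF Y] h(1)]]) (use h(2) pc in blast)
  then have "\<exists>m. \<forall>j. lin R Y (I i) (m j) \<and> (\<forall>x\<in>carrier Y. d i (m j x) = h (pin Y s j x))"
    by (intro choice allI)
  then obtain m where m: "\<And>j. lin R Y (I i) (m j)" "\<And>j x. x \<in> carrier Y \<Longrightarrow> d i (m j x) = h (pin Y s j x)" by blast
  have ml: "lin R ?P (I i) (\<lambda>v. msum (I i) s (\<lambda>j. m j (v j)))"
    by (rule lin_msum[OF _ P IL]) (rule lin_comp[OF power_proj_lin m(1)])
  have "d i (msum (I i) s (\<lambda>j. m j (v j))) = h v" if v: "v \<in> carrier ?P" for v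
  proof -
    have vj: "v j \<in> carrier Y" if "j < s" for j by (rule power_modD[OF v that])
    have "d i (msum (I i) s (\<lambda>j. m j (v j))) = msum (I (Suc i)) s (\<lambda>j. d i (m j (v j)))"
      by (rule msum_lin(2)[OF d_lin IL IL lin_closed[OF m(1) vj]])
    also have "\<dots> = msum (I (Suc i)) s (\<lambda>j. h (pin Y s j (v j)))" by (rule msum_cong) (rule m(2)[OF vj])
    also have "\<dots> = h (msum ?P s (\<lambda>j. pin Y s j (v j)))"
      by (rule msum_lin(2)[OF h(1) P IL pc[OF vj], symmetric])
    finally show ?thesis using pin_decomp[OF Y v] by simp
  qed
  then show "\<exists>m. lin R ?P (I i) m \<and> (\<forall>x\<in>carrier ?P. d i (m x) = h x)" using ml by blast
qed

section \<open>Duals of free modules over the opposite ring\<close>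

lemma op_ring_simps [simp]:
  "carrier (op_ring R) = carrier R" "x \<otimes>\<^bsub>op_ring R\<^esub> y = y \<otimes>\<^bsub>R\<^esub> x" "x \<oplus>\<^bsub>op_ring R\<^esub> y = x \<oplus>\<^bsub>R\<^esub> y"
  "\<zero>\<^bsub>op_ring R\<^esub> = \<zero>\<^bsub>R\<^esub>" "\<one>\<^bsub>op_ring R\<^esub> = \<one>\<^bsub>R\<^esub>"
  by (simp_all add: op_ring_def)

lemma op_ring_ring: "ring R \<Longrightarrow> ring (op_ring R)"
proof -
  assume "ring R"
  then interpret ring R .
  show ?thesis
  proof (rule ringI)
    show "abelian_group (op_ring R)"
    proof (rule abelian_groupI, goal_cases)
      case (6 x)
      then show ?case by (intro bexI[of _ "\<ominus>\<^bsub>R\<^esub> x"]) (auto simp: l_neg)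
    qed (auto simp: a_ac)
    show "monoid (op_ring R)" by (rule monoidI) (auto simp: m_assoc)
  qed (auto simp: l_distr r_distr)
qed

lemma msum_op [simp]: "msum (regular_mod (op_ring R)) m f = msum (regular_mod R) m f"
  by (induction m) auto

lemma power_op [simp]:
  "carrier (power_mod (regular_mod (op_ring R)) m) = carrier (power_mod (regular_mod R) m)"
  "\<zero>\<^bsub>power_mod (regular_mod (op_ring R)) m\<^esub> = \<zero>\<^bsub>power_mod (regular_mod R) m\<^esub>"
  by (simp_all add: power_mod_def)

text \<open>Product of a row and a column vector. It identifies the dual of a free left module with
  the free right module on the same set of vectors, so that dualising a complex of free modules
  never leaves these carriers.\<close>

definition pairing :: "('a, 'r) ring_scheme \<Rightarrow> nat \<Rightarrow> (nat \<Rightarrow> 'a) \<Rightarrow> (nat \<Rightarrow> 'a) \<Rightarrow> 'a" where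
  "pairing R m v f = msum (regular_mod R) m (\<lambda>i. v i \<otimes>\<^bsub>R\<^esub> f i)"

context ring
begin

lemma pairing_lin_left:
  assumes f: "f \<in> carrier (power_mod (regular_mod R) m)"
  shows "lin R (power_mod (regular_mod R) m) (regular_mod R) (\<lambda>v. pairing R m v f)"
proof -
  have RR: "left_module R (regular_mod R)" by (rule regular_left_module[OF ring_axioms])
  have "lin R (power_mod (regular_mod R) m) (regular_mod R) (\<lambda>v. v i \<odot>\<^bsub>regular_mod R\<^esub> f i)" if "i < m" for i
    by (rule lin_coeff_smult[OF power_proj_lin[OF that] RR power_modD[OF f that]])
  from lin_msum[OF this power_left_module[OF RR] RR, of m] show ?thesis by (simp add: pairing_def)
qed

lemma pairing_op: "pairing (op_ring R) m f v = pairing R m v f"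
  by (simp add: pairing_def)

lemma pairing_repr:
  assumes g: "lin R (power_mod (regular_mod R) m) (regular_mod R) g"
  shows "\<exists>f\<in>carrier (power_mod (regular_mod R) m). \<forall>v\<in>carrier (power_mod (regular_mod R) m). g v = pairing R m v f"
proof -
  let ?F = "power_mod (regular_mod R) m"
  have RR: "left_module R (regular_mod R)" by (rule regular_left_module[OF ring_axioms])
  have F: "left_module R ?F" by (rule power_left_module[OF RR])
  note db = power_dual_basis[OF ring_axioms, of m, unfolded dual_basis_def]
  have e: "unit_vec R m i \<in> carrier ?F" if "i < m" for i using db that by simp
  let ?f = "\<lambda>i\<in>{..<m}. g (unit_vec R m i)"
  have "?f \<in> carrier ?F" by (rule power_modI) (rule lin_closed[OF g e])
  moreover have "g v = pairing R m v ?f" if v: "v \<in> carrier ?F" for v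
  proof -
    have vi: "v i \<in> carrier R" if "i < m" for i using power_modD[OF v that] by simp
    have t: "v i \<odot>\<^bsub>?F\<^esub> unit_vec R m i \<in> carrier ?F" if "i < m" for i
      by (rule left_module.smult_closed[OF F vi[OF that] e[OF that]])
    have "g v = g (msum ?F m (\<lambda>i. v i \<odot>\<^bsub>?F\<^esub> unit_vec R m i))" using db v by simp
    also have "\<dots> = msum (regular_mod R) m (\<lambda>i. g (v i \<odot>\<^bsub>?F\<^esub> unit_vec R m i))"
      by (rule msum_lin(2)[OF g F RR t])
    also have "\<dots> = pairing R m v ?f" unfolding pairing_def
      by (rule msum_cong) (simp add: lin_smult[OF g vi e])
    finally show ?thesis .
  qed
  ultimately show ?thesis by blast
qed

lemma pairing_unit:
  assumes "f \<in> carrier (power_mod (regular_mod R) m)" "j < m"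
  shows "pairing R m (unit_vec R m j) f = f j" "pairing R m f (unit_vec R m j) = f j"
proof -
  interpret RR: left_module R "regular_mod R" by (rule regular_left_module[OF ring_axioms])
  have fi: "f i \<in> carrier R" if "i < m" for i using power_modD[OF assms(1) that] by simp
  show "pairing R m (unit_vec R m j) f = f j" unfolding pairing_def
    by (rule RR.msum_single[OF assms(2)]) (use fi assms(2) in \<open>auto simp: unit_vec_def\<close>)
  show "pairing R m f (unit_vec R m j) = f j" unfolding pairing_def
    by (rule RR.msum_single[OF assms(2)]) (use fi assms(2) in \<open>auto simp: unit_vec_def\<close>)
qed

lemma unit_vec_closed: "j < m \<Longrightarrow> unit_vec R m j \<in> carrier (power_mod (regular_mod R) m)"
  using power_dual_basis[OF ring_axioms, of m] by (simp add: dual_basis_def)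

lemma pairing_eqI_left:
  assumes "v \<in> carrier (power_mod (regular_mod R) m)" "w \<in> carrier (power_mod (regular_mod R) m)"
    and "\<And>f. f \<in> carrier (power_mod (regular_mod R) m) \<Longrightarrow> pairing R m v f = pairing R m w f"
  shows "v = w"
proof (rule power_mod_eqI[OF assms(1,2)])
  fix j assume j: "j < m"
  show "v j = w j"
    using assms(3)[OF unit_vec_closed[OF j]] pairing_unit(2)[OF assms(1) j] pairing_unit(2)[OF assms(2) j] by simp
qed

lemma pairing_eqI_right:
  assumes "f \<in> carrier (power_mod (regular_mod R) m)" "g \<in> carrier (power_mod (regular_mod R) m)"
    and "\<And>v. v \<in> carrier (power_mod (regular_mod R) m) \<Longrightarrow> pairing R m v f = pairing R m v g"
  shows "f = g"
proof (rule power_mod_eqI[OF assms(1,2)])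
  fix j assume j: "j < m"
  show "f j = g j"
    using assms(3)[OF unit_vec_closed[OF j]] pairing_unit(1)[OF assms(1) j] pairing_unit(1)[OF assms(2) j] by simp
qed

text \<open>\<open>E\<close> is multiplication by the matrix of \<open>D\<close> from the other
  side, hence linear over the opposite ring.\<close>

lemma pairing_adjoint:
  assumes D: "lin R (power_mod (regular_mod R) m') (power_mod (regular_mod R) m) D"
  shows "\<exists>E. lin (op_ring R) (power_mod (regular_mod (op_ring R)) m) (power_mod (regular_mod (op_ring R)) m') E \<and>
    (\<forall>v\<in>carrier (power_mod (regular_mod R) m'). \<forall>f\<in>carrier (power_mod (regular_mod R) m).
       pairing R m' v (E f) = pairing R m (D v) f)"
proof -
  let ?F = "power_mod (regular_mod R) m" and ?F' = "power_mod (regular_mod R) m'"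
  let ?G = "power_mod (regular_mod (op_ring R)) m" and ?G' = "power_mod (regular_mod (op_ring R)) m'"
  have opr: "ring (op_ring R)" by (rule op_ring_ring[OF ring_axioms])
  interpret O: ring "op_ring R" by (rule opr)
  have RR: "left_module R (regular_mod R)" by (rule regular_left_module[OF ring_axioms])
  have OO: "left_module (op_ring R) (regular_mod (op_ring R))" by (rule regular_left_module[OF opr])
  interpret G: left_module "op_ring R" ?G by (rule power_left_module[OF OO])
  interpret G': left_module "op_ring R" ?G' by (rule power_left_module[OF OO])
  \<comment> \<open>This value is forced: the \<open>k\<close>-th entry of \<open>E f\<close> is its
    pairing with the \<open>k\<close>-th unit vector.\<close>
  define E where "E f = (\<lambda>k\<in>{..<m'}. pairing R m (D (unit_vec R m' k)) f)" for f
  have De: "D (unit_vec R m' k) \<in> carrier ?F" if "k < m'" for k by (rule lin_closed[OF D unit_vec_closed[OF that]])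
  have l: "lin (op_ring R) ?G (regular_mod (op_ring R)) (\<lambda>f. pairing R m (D (unit_vec R m' k)) f)" if "k < m'" for k
    using O.pairing_lin_left[of "D (unit_vec R m' k)" m] De[OF that] by (simp add: pairing_op)
  have Ec: "E f \<in> carrier ?G'" if "f \<in> carrier ?G" for f
    unfolding E_def by (rule power_modI) (rule lin_closed[OF l that])
  have "lin (op_ring R) ?G ?G' E"
  proof (rule linI[OF Ec])
    fix x y assume xy: "x \<in> carrier ?G" "y \<in> carrier ?G"
    show "E (x \<oplus>\<^bsub>?G\<^esub> y) = E x \<oplus>\<^bsub>?G'\<^esub> E y"
    proof (rule power_mod_eqI[OF Ec[OF G.M.a_closed[OF xy]] G'.M.a_closed[OF Ec[OF xy(1)] Ec[OF xy(2)]]])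
      fix k assume k: "k < m'"
      then show "E (x \<oplus>\<^bsub>?G\<^esub> y) k = (E x \<oplus>\<^bsub>?G'\<^esub> E y) k"
        using lin_add[OF l[OF k] xy] by (simp add: power_mod_simps(2) E_def)
    qed
  next
    fix a x assume ax: "a \<in> carrier (op_ring R)" "x \<in> carrier ?G"
    show "E (a \<odot>\<^bsub>?G\<^esub> x) = a \<odot>\<^bsub>?G'\<^esub> E x"
    proof (rule power_mod_eqI[OF Ec[OF G.smult_closed[OF ax]] G'.smult_closed[OF ax(1) Ec[OF ax(2)]]])
      fix k assume k: "k < m'"
      then show "E (a \<odot>\<^bsub>?G\<^esub> x) k = (a \<odot>\<^bsub>?G'\<^esub> E x) k"
        using lin_smult[OF l[OF k] ax] by (simp add: power_mod_simps(3) E_def)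
    qed
  qed
  moreover have "pairing R m' v (E f) = pairing R m (D v) f" if v: "v \<in> carrier ?F'" and f: "f \<in> carrier ?F" for v f
  proof -
    have F': "left_module R ?F'" by (rule power_left_module[OF RR])
    have Df: "lin R ?F' (regular_mod R) (\<lambda>v. pairing R m (D v) f)" by (rule lin_comp[OF D pairing_lin_left[OF f]])
    obtain g where g: "g \<in> carrier ?F'" "\<forall>v\<in>carrier ?F'. pairing R m (D v) f = pairing R m' v g"
      using pairing_repr[OF Df] by blast
    have "E f = g"
    proof (rule power_mod_eqI[OF _ g(1)])
      show "E f \<in> carrier ?F'" using Ec[of f] f by simp
      fix k assume k: "k < m'"
      then show "E f k = g k" using g(2) pairing_unit(1)[OF g(1) k] unit_vec_closed[OF k] by (simp add: E_def)
    qed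
    then show ?thesis using g(2) v by simp
  qed
  ultimately show ?thesis by blast
qed

end

section \<open>Modules without higher extensions by the ring are torsionless\<close>

text \<open>\<open>I\<close> coresolves \<open>A\<close> as a left module and its length
  \<open>n\<close> enters the final bound; \<open>J\<close> coresolves \<open>A\<close> as a right
  module, and its length \<open>r\<close> only has to be finite.\<close>

locale gor_algebra =
  fixes K :: "('k, 'r) ring_scheme" and A :: "('a, 's) ring_scheme" and \<phi> :: "'k \<Rightarrow> 'a"
    and n :: nat and I :: "nat \<Rightarrow> 'a umod" and d e
    and r :: nat and J :: "nat \<Rightarrow> 'a umod" and \<delta> \<epsilon>
  assumes AA: "artin_algebra K \<phi> A"
    and LI: "inj_coresolution A (regular_mod A) n I d e"
    and RI: "inj_coresolution (op_ring A) (regular_mod (op_ring A)) r J \<delta> \<epsilon>"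
begin

lemma A_ring: "ring A"
  by (rule artin_algebraD(2)[OF AA])

sublocale A: ring A
  by (rule A_ring)

sublocale L: inj_cores A "regular_mod A" n I d e
  by (intro inj_cores.intro regular_left_module A_ring LI)

sublocale O: inj_cores "op_ring A" "regular_mod (op_ring A)" r J \<delta> \<epsilon>
  by (intro inj_cores.intro regular_left_module op_ring_ring A_ring RI)

abbreviation free :: "nat \<Rightarrow> ('a, nat \<Rightarrow> 'a) module" where
  "free m \<equiv> power_mod (regular_mod A) m"

lemma free_L: "left_module A (free m)" and free_fg: "fg_module A (free m)"
  using free_fgp[OF A_ring, of m] by (simp_all add: fgpD fgp_fg)

text \<open>Elements of free modules are functions \<open>nat \<Rightarrow> 'a\<close>, elements of
  the universe are sets of such functions; singletons embed the former in the latter.\<close>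

lemma singleton_inj: "inj_on (\<lambda>v. {v}) S"
  by simp

text \<open>The last clause makes the dual complex exact: every functional on the image of
  \<open>D j\<close> extends to \<open>free (m j)\<close>. It holds since the vanishing of
  extensions passes from \<open>X\<close> to each syzygy, and \<open>L.cohom_extend\<close> applies
  to each cover.\<close>

lemma free_resolution:
  assumes X: "fg_module A X" and X0: "L.cohom_above 0 X"
  shows "\<exists>m D p. lin A (free (m 0)) X p \<and> p ` carrier (free (m 0)) = carrier X \<and>
    (\<forall>j. lin A (free (m (Suc j))) (free (m j)) (D j)) \<and>
    D 0 ` carrier (free (m 1)) = ker (free (m 0)) X p \<and>
    (\<forall>j. D (Suc j) ` carrier (free (m (Suc (Suc j)))) = ker (free (m (Suc j))) (free (m j)) (D j)) \<and>
    (\<forall>j a. lin A (free (m j)\<lparr>carrier := D j ` carrier (free (m (Suc j)))\<rparr>) (regular_mod A) a \<longrightarrow>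
       (\<exists>b. lin A (free (m j)) (regular_mod A) b \<and> (\<forall>u\<in>D j ` carrier (free (m (Suc j))). b u = a u)))"
proof -
  have XL: "left_module A X" by (rule fg_left_module[OF X])
  define ext where "ext m U \<longleftrightarrow> (\<forall>a. lin A (free m\<lparr>carrier := U\<rparr>) (regular_mod A) a \<longrightarrow>
      (\<exists>b. lin A (free m) (regular_mod A) b \<and> (\<forall>u\<in>U. b u = a u)))" for m U
  have ext_ker: "submodule (ker (free m) Z q) A (free m) \<and> L.cohom_above 0 (free m\<lparr>carrier := ker (free m) Z q\<rparr>) \<and>
      ext m (ker (free m) Z q)"
    if q: "lin A (free m) Z q" "q ` carrier (free m) = carrier Z" and Z: "left_module A Z" "L.cohom_above 0 Z"
    for m q and Z :: "('a, 'z, 'q) module_scheme"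
  proof (intro conjI)
    note s = ses_ker[OF free_L Z(1) q]
    show "submodule (ker (free m) Z q) A (free m)" by (rule ker_submodule[OF q(1) free_L Z(1)])
    show "L.cohom_above 0 (free m\<lparr>carrier := ker (free m) Z q\<rparr>)"
      by (rule L.cohom_above_cover[OF s L.cohom_above_fgp[OF free_fgp[OF A_ring]] L.cohom_above_mono[OF Z(2)] singleton_inj]) simp
    show "ext m (ker (free m) Z q)"
      unfolding ext_def using L.cohom_extend[OF s Z(2) singleton_inj] by simp
  qed
  obtain m0 p where p: "lin A (free m0) X p" "p ` carrier (free m0) = carrier X"
    using free_cover[OF X] by blast
  \<comment> \<open>The state of the recursion is a rank with a submodule of the free module of that
    rank. In this way all stages have one type, as dependent choice requires.\<close>
  define good where "good s \<longleftrightarrow> submodule (snd s) A (free (fst s)) \<and>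
    L.cohom_above 0 (free (fst s)\<lparr>carrier := snd s\<rparr>) \<and> ext (fst s) (snd s)" for s :: "nat \<times> (nat \<Rightarrow> 'a) set"
  define step where "step s t \<longleftrightarrow> (\<exists>D. lin A (free (fst t)) (free (fst s)) D \<and>
    D ` carrier (free (fst t)) = snd s \<and> snd t = ker (free (fst t)) (free (fst s)) D)"
    for s t :: "nat \<times> (nat \<Rightarrow> 'a) set"
  have start: "good (m0, ker (free m0) X p)"
    unfolding good_def fst_conv snd_conv by (rule ext_ker[OF p XL X0])
  have next_ex: "\<exists>t. good t \<and> step s t" if s: "good s" for s
  proof -
    let ?m = "fst s" and ?U = "snd s"
    let ?Z = "free ?m\<lparr>carrier := ?U\<rparr>"
    have U: "submodule ?U A (free ?m)" "L.cohom_above 0 ?Z" using s by (simp_all add: good_def)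
    have Z: "fg_module A ?Z" by (rule fg_submodule[OF AA free_fg U(1)])
    obtain m' D where D: "lin A (free m') ?Z D" "D ` carrier (free m') = carrier ?Z" using free_cover[OF Z] by blast
    have DU: "lin A (free m') (free ?m) D"
      using lin_comp[OF D(1) lin_incl[OF left_module.submoduleD(1)[OF free_L U(1)]]] by simp
    have kk: "ker (free m') ?Z D = ker (free m') (free ?m) D" by (simp add: ker_def)
    have "good (m', ker (free m') (free ?m) D)"
      unfolding good_def fst_conv snd_conv kk[symmetric] by (rule ext_ker[OF D fg_left_module[OF Z] U(2)])
    moreover have "step s (m', ker (free m') (free ?m) D)"
      unfolding step_def fst_conv snd_conv using DU D(2) by (intro exI[of _ D]) simp
    ultimately show ?thesis by blast
  qed
  have "\<exists>f. f 0 = (m0, ker (free m0) X p) \<and> (\<forall>i::nat. good (f i) \<and> step (f i) (f (Suc i)))"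
  proof -
    have "\<exists>f. \<forall>i::nat. (good (f i) \<and> (i = 0 \<longrightarrow> f i = (m0, ker (free m0) X p))) \<and> step (f i) (f (Suc i))"
      by (rule dependent_nat_choice) (use start next_ex in auto)
    then show ?thesis by blast
  qed
  then obtain f where f0: "f 0 = (m0, ker (free m0) X p)" and f: "\<And>i. good (f i)" "\<And>i::nat. step (f i) (f (Suc i))" by blast
  have "\<exists>D. \<forall>i. lin A (free (fst (f (Suc i)))) (free (fst (f i))) (D i) \<and>
    D i ` carrier (free (fst (f (Suc i)))) = snd (f i) \<and>
    snd (f (Suc i)) = ker (free (fst (f (Suc i)))) (free (fst (f i))) (D i)"
    using f(2) unfolding step_def by (intro choice allI)
  then obtain D where D: "\<And>i. lin A (free (fst (f (Suc i)))) (free (fst (f i))) (D i)"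
    "\<And>i. D i ` carrier (free (fst (f (Suc i)))) = snd (f i)"
    "\<And>i. snd (f (Suc i)) = ker (free (fst (f (Suc i)))) (free (fst (f i))) (D i)" by blast
  show ?thesis
    using p f0 D(1) D(2)[of 0] D(2,3) f(1) unfolding good_def ext_def
    by (intro exI[of _ "\<lambda>i. fst (f i)"] exI[of _ D] exI[of _ p]) simp
qed

text \<open>Dualise a free resolution of \<open>X\<close>. The result is an exact complex of free
  right modules, and its first differential \<open>E 0\<close> has the dual of \<open>X\<close> as
  kernel. If all functionals kill \<open>x = p v\<close>, then evaluation at \<open>v\<close>
  vanishes on that kernel; finite injective dimension on the right lets it factor through
  \<open>E 0\<close>. Since functionals on free right modules are again vectors, this says
  \<open>v = D 0 q\<close>, whence \<open>p v\<close> is zero.\<close>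

lemma torsionless:
  assumes X: "fg_module A X" and X0: "L.cohom_above 0 X" and x: "x \<in> carrier X"
    and van: "\<And>a. lin A X (regular_mod A) a \<Longrightarrow> a x = \<zero>\<^bsub>A\<^esub>"
  shows "x = \<zero>\<^bsub>X\<^esub>"
proof -
  have XL: "left_module A X" by (rule fg_left_module[OF X])
  obtain m D p where p: "lin A (free (m 0)) X p" "p ` carrier (free (m 0)) = carrier X"
    and D': "\<forall>j. lin A (free (m (Suc j))) (free (m j)) (D j)"
    and D0: "D 0 ` carrier (free (m 1)) = ker (free (m 0)) X p"
    and DS': "\<forall>j. D (Suc j) ` carrier (free (m (Suc (Suc j)))) = ker (free (m (Suc j))) (free (m j)) (D j)"
    and ext': "\<forall>j a. lin A (free (m j)\<lparr>carrier := D j ` carrier (free (m (Suc j)))\<rparr>) (regular_mod A) a \<longrightarrow>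
       (\<exists>b. lin A (free (m j)) (regular_mod A) b \<and> (\<forall>u\<in>D j ` carrier (free (m (Suc j))). b u = a u))"
    using free_resolution[OF X X0] by (elim exE conjE) (rule that)
  note D = D'[rule_format] and DS = DS'[rule_format] and ext = ext'[rule_format]
  have RR: "left_module A (regular_mod A)" by (rule regular_left_module[OF A_ring])
  let ?Y = "\<lambda>j. power_mod (regular_mod (op_ring A)) (m j)"
  have opr: "ring (op_ring A)" by (rule op_ring_ring[OF A_ring])
  interpret OR: ring "op_ring A" by (rule opr)
  have Y: "fgp (op_ring A) (?Y j)" for j by (rule free_fgp[OF opr])
  have "\<exists>E. \<forall>j. lin (op_ring A) (?Y j) (?Y (Suc j)) (E j) \<and>
    (\<forall>v\<in>carrier (free (m (Suc j))). \<forall>f\<in>carrier (free (m j)). pairing A (m (Suc j)) v (E j f) = pairing A (m j) (D j v) f)"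
    using A.pairing_adjoint[OF D] by (intro choice allI)
  then obtain E where E: "\<And>j. lin (op_ring A) (?Y j) (?Y (Suc j)) (E j)"
    and adj: "\<And>j v f. v \<in> carrier (free (m (Suc j))) \<Longrightarrow> f \<in> carrier (free (m j)) \<Longrightarrow>
       pairing A (m (Suc j)) v (E j f) = pairing A (m j) (D j v) f" by blast
  have Ec: "E j f \<in> carrier (free (m (Suc j)))" if "f \<in> carrier (free (m j))" for j f
    using lin_closed[OF E, of f j] that by simp
  have Dc: "D j v \<in> carrier (free (m j))" if "v \<in> carrier (free (m (Suc j)))" for j v by (rule lin_closed[OF D that])
  have zc: "\<zero>\<^bsub>free k\<^esub> \<in> carrier (free k)" for k
    by (rule left_module.submoduleD(2)[OF free_L left_module.carrier_submodule[OF free_L]])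
  have pz: "pairing A k v \<zero>\<^bsub>free k\<^esub> = \<zero>\<^bsub>A\<^esub>" "pairing A k \<zero>\<^bsub>free k\<^esub> v = \<zero>\<^bsub>A\<^esub>" if "v \<in> carrier (free k)" for k v
  proof -
    interpret RR: left_module A "regular_mod A" by (rule RR)
    have vi: "v i \<in> carrier A" if "i < k" for i using power_modD[OF \<open>v \<in> carrier (free k)\<close> that] by simp
    have "pairing A k v \<zero>\<^bsub>free k\<^esub> = \<zero>\<^bsub>regular_mod A\<^esub>" "pairing A k \<zero>\<^bsub>free k\<^esub> v = \<zero>\<^bsub>regular_mod A\<^esub>"
      unfolding pairing_def by (rule RR.msum_zero, use vi in \<open>simp add: power_mod_simps(4)\<close>)+
    then show "pairing A k v \<zero>\<^bsub>free k\<^esub> = \<zero>\<^bsub>A\<^esub>" "pairing A k \<zero>\<^bsub>free k\<^esub> v = \<zero>\<^bsub>A\<^esub>" by simp_all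
  qed
  have Ekill: "E (Suc j) (E j f) = \<zero>\<^bsub>?Y (Suc (Suc j))\<^esub>" if f: "f \<in> carrier (free (m j))" for j f
  proof -
    have "E (Suc j) (E j f) = \<zero>\<^bsub>free (m (Suc (Suc j)))\<^esub>"
    proof (rule A.pairing_eqI_right[OF Ec[OF Ec[OF f]] zc])
      fix v assume v: "v \<in> carrier (free (m (Suc (Suc j))))"
      have "D (Suc j) v \<in> ker (free (m (Suc j))) (free (m j)) (D j)" unfolding DS[symmetric] using v by (rule imageI)
      then have "D j (D (Suc j) v) = \<zero>\<^bsub>free (m j)\<^esub>" by (simp add: ker_def)
      then show "pairing A (m (Suc (Suc j))) v (E (Suc j) (E j f)) = pairing A (m (Suc (Suc j))) v \<zero>\<^bsub>free (m (Suc (Suc j)))\<^esub>"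
        using v f by (simp add: adj Ec Dc pz)
    qed
    then show ?thesis by simp
  qed
  \<comment> \<open>A functional killed by the next dual differential vanishes on the kernel of
    \<open>D j\<close>, so it factors through the image of \<open>D j\<close>; the extension
    property \<open>ext\<close> carries it to all of \<open>free (m j)\<close>.\<close>
  have Eex: "f \<in> E j ` carrier (?Y j)"
    if f: "f \<in> carrier (free (m (Suc j)))" and k: "E (Suc j) f = \<zero>\<^bsub>?Y (Suc (Suc j))\<^esub>" for j f
  proof -
    let ?V = "free (m j)\<lparr>carrier := D j ` carrier (free (m (Suc j)))\<rparr>"
    have DV: "lin A (free (m (Suc j))) ?V (D j)" by (rule lin_codom[OF D]) simp
    have V: "left_module A ?V" by (rule image_left_module[OF D free_L free_L])
    have "pairing A (m (Suc j)) v f = \<zero>\<^bsub>regular_mod A\<^esub>"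
      if v: "v \<in> carrier (free (m (Suc j)))" "D j v = \<zero>\<^bsub>?V\<^esub>" for v
    proof -
      have "v \<in> D (Suc j) ` carrier (free (m (Suc (Suc j))))" unfolding DS using v by (simp add: ker_def)
      then obtain w where w: "v = D (Suc j) w" "w \<in> carrier (free (m (Suc (Suc j))))" by (rule imageE)
      then show ?thesis using adj[OF w(2) f] k pz w(2) by simp
    qed
    from lin_factor[OF DV free_L V RR _ A.pairing_lin_left[OF f] this]
    obtain a where a: "lin A ?V (regular_mod A) a" "\<forall>v\<in>carrier (free (m (Suc j))). a (D j v) = pairing A (m (Suc j)) v f"
      by auto
    obtain b where b: "lin A (free (m j)) (regular_mod A) b" "\<forall>u\<in>D j ` carrier (free (m (Suc j))). b u = a u"
      using ext[OF a(1)] by blast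
    obtain f' where f': "f' \<in> carrier (free (m j))" "\<forall>v\<in>carrier (free (m j)). b v = pairing A (m j) v f'"
      using A.pairing_repr[OF b(1)] by blast
    have "f = E j f'"
    proof (rule A.pairing_eqI_right[OF f Ec[OF f'(1)]])
      fix v assume v: "v \<in> carrier (free (m (Suc j)))"
      have "pairing A (m (Suc j)) v f = b (D j v)" using a(2) b(2) v by simp
      also have "\<dots> = pairing A (m j) (D j v) f'" using f'(2) Dc[OF v] by blast
      also have "\<dots> = pairing A (m (Suc j)) v (E j f')" by (rule adj[OF v f'(1), symmetric])
      finally show "pairing A (m (Suc j)) v f = pairing A (m (Suc j)) v (E j f')" .
    qed
    then show ?thesis using f'(1) by simp
  qed
  have ex: "E j ` carrier (?Y j) = ker (?Y (Suc j)) (?Y (Suc (Suc j))) (E (Suc j))" for j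
  proof
    show "E j ` carrier (?Y j) \<subseteq> ker (?Y (Suc j)) (?Y (Suc (Suc j))) (E (Suc j))"
    proof (rule image_subsetI)
      fix f assume "f \<in> carrier (?Y j)"
      then show "E j f \<in> ker (?Y (Suc j)) (?Y (Suc (Suc j))) (E (Suc j))"
        unfolding ker_def using Ekill[of f j] Ec[of f j] by simp
    qed
    show "ker (?Y (Suc j)) (?Y (Suc (Suc j))) (E (Suc j)) \<subseteq> E j ` carrier (?Y j)"
    proof
      fix f assume "f \<in> ker (?Y (Suc j)) (?Y (Suc (Suc j))) (E (Suc j))"
      then show "f \<in> E j ` carrier (?Y j)" by (intro Eex) (simp_all add: ker_def)
    qed
  qed
  have "x \<in> p ` carrier (free (m 0))" unfolding p(2) by (rule x)
  then obtain v where v: "x = p v" "v \<in> carrier (free (m 0))" by (rule imageE)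
  have evl: "lin (op_ring A) (?Y k) (regular_mod (op_ring A)) (\<lambda>f. pairing A (m k) w f)"
    if "w \<in> carrier (free (m k))" for w k
    using OR.pairing_lin_left[of w "m k"] that by (simp add: A.pairing_op)
  \<comment> \<open>A vector \<open>f\<close> in the kernel of \<open>E 0\<close> is a functional
    that kills the kernel of \<open>p\<close>. It descends to \<open>X\<close>, where
    \<open>van\<close> applies.\<close>
  have "pairing A (m 0) v f = \<zero>\<^bsub>regular_mod (op_ring A)\<^esub>"
    if f: "f \<in> carrier (?Y 0)" "E 0 f = \<zero>\<^bsub>?Y (Suc 0)\<^esub>" for f
  proof -
    have fF: "f \<in> carrier (free (m 0))" using f(1) by simp
    have "pairing A (m 0) u f = \<zero>\<^bsub>regular_mod A\<^esub>"
      if u: "u \<in> carrier (free (m 0))" "p u = \<zero>\<^bsub>X\<^esub>" for u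
    proof -
      have "u \<in> D 0 ` carrier (free (m 1))" unfolding D0 using u by (simp add: ker_def)
      then obtain w where w: "u = D 0 w" "w \<in> carrier (free (m 1))" by (rule imageE)
      then show ?thesis using adj[of w 0 f] f(2) pz fF by simp
    qed
    from lin_factor[OF p(1) free_L XL RR p(2) A.pairing_lin_left[OF fF] this]
    obtain a where "lin A X (regular_mod A) a" "\<forall>u\<in>carrier (free (m 0)). a (p u) = pairing A (m 0) u f" by blast
    then show ?thesis using van[of a] v by simp
  qed
  from O.exact_complex_extend[of ?Y E "\<lambda>_ v. {v}" 0, OF Y E ex singleton_inj evl[OF v(2)] this]
  obtain g where g: "lin (op_ring A) (?Y (Suc 0)) (regular_mod (op_ring A)) g"
    "\<forall>f\<in>carrier (?Y 0). g (E 0 f) = pairing A (m 0) v f" by blast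
  obtain q where q: "q \<in> carrier (free (m (Suc 0)))" "\<forall>f\<in>carrier (free (m (Suc 0))). g f = pairing A (m (Suc 0)) q f"
    using OR.pairing_repr[OF g(1)] by (auto simp: A.pairing_op)
  have "v = D 0 q"
  proof (rule A.pairing_eqI_left[OF v(2) Dc[OF q(1)]])
    fix f assume f: "f \<in> carrier (free (m 0))"
    have "pairing A (m 0) v f = g (E 0 f)" using g(2) f by simp
    also have "\<dots> = pairing A (m (Suc 0)) q (E 0 f)" using q(2) Ec[OF f] by blast
    also have "\<dots> = pairing A (m 0) (D 0 q) f" by (rule adj[OF q(1) f])
    finally show "pairing A (m 0) v f = pairing A (m 0) (D 0 q) f" .
  qed
  then have "v \<in> ker (free (m 0)) X p" unfolding D0[symmetric] using q(1) by simp
  then show ?thesis using v(1) by (simp add: ker_def)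
qed

end

section \<open>Gorenstein projective modules over a Gorenstein algebra\<close>

text \<open>Cosets of a submodule of \<open>free s\<close> have the type
  \<open>(nat \<Rightarrow> 'a) set\<close>, so the quotients formed in \<open>cosyzygy\<close>
  already lie in the universe.\<close>

lemma quotient_exists:
  fixes P :: "('a, 'x, 's) module_scheme" and R :: "('a, 'r) ring_scheme"
  assumes P: "left_module R P" and U: "submodule U R P"
  shows "\<exists>(Q :: ('a, 'x set) module) q. left_module R Q \<and> lin R P Q q \<and> q ` carrier P = carrier Q \<and> ker P Q q = U"
proof -
  interpret P: left_module R P by fact
  note UD = P.submoduleD[OF U]
  define q where "q x = {y \<in> carrier P. y \<ominus>\<^bsub>P\<^esub> x \<in> U}" for x
  have q_eq: "q x = q y \<longleftrightarrow> x \<ominus>\<^bsub>P\<^esub> y \<in> U" if xy: "x \<in> carrier P" "y \<in> carrier P" for x y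
  proof
    assume "q x = q y"
    moreover have "x \<in> q x" using xy UD(2) P.eq_iff_diff[of x x] by (simp add: q_def)
    ultimately show "x \<ominus>\<^bsub>P\<^esub> y \<in> U" by (simp add: q_def)
  next
    assume H: "x \<ominus>\<^bsub>P\<^esub> y \<in> U"
    have "z \<ominus>\<^bsub>P\<^esub> x \<in> U \<longleftrightarrow> z \<ominus>\<^bsub>P\<^esub> y \<in> U" if z: "z \<in> carrier P" for z
    proof -
      have 1: "(z \<ominus>\<^bsub>P\<^esub> x) \<oplus>\<^bsub>P\<^esub> (x \<ominus>\<^bsub>P\<^esub> y) = z \<ominus>\<^bsub>P\<^esub> y"
        using xy z P.diff_add[of x z] by (simp add: a_minus_def P.M.a_assoc[symmetric])
      then have "z \<ominus>\<^bsub>P\<^esub> x = (z \<ominus>\<^bsub>P\<^esub> y) \<ominus>\<^bsub>P\<^esub> (x \<ominus>\<^bsub>P\<^esub> y)"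
        using xy z P.add_minus_cancel[of "z \<ominus>\<^bsub>P\<^esub> x" "x \<ominus>\<^bsub>P\<^esub> y"] by simp
      then show ?thesis using 1 UD(3)[OF _ H] P.submodule_diff[OF U _ H] by metis
    qed
    then show "q x = q y" by (auto simp: q_def)
  qed
  define s where "s = inv_into (carrier P) q"
  have s: "s t \<in> carrier P" "q (s t) = t" if "t \<in> q ` carrier P" for t
    using that by (simp_all add: s_def inv_into_into f_inv_into_f)
  define Q :: "('a, 'x set) module" where "Q = \<lparr>carrier = q ` carrier P, mult = undefined, one = undefined,
    zero = q \<zero>\<^bsub>P\<^esub>, add = (\<lambda>t u. q (s t \<oplus>\<^bsub>P\<^esub> s u)), smult = (\<lambda>a t. q (a \<odot>\<^bsub>P\<^esub> s t))\<rparr>"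
  have Qs: "carrier Q = q ` carrier P" "\<zero>\<^bsub>Q\<^esub> = q \<zero>\<^bsub>P\<^esub>" by (simp_all add: Q_def)
  have sq: "s (q x) \<ominus>\<^bsub>P\<^esub> x \<in> U" "s (q x) \<in> carrier P" if "x \<in> carrier P" for x
    using s[of "q x"] q_eq[of "s (q x)" x] that by simp_all
  have add: "q x \<oplus>\<^bsub>Q\<^esub> q y = q (x \<oplus>\<^bsub>P\<^esub> y)" if xy: "x \<in> carrier P" "y \<in> carrier P" for x y
  proof -
    have "(s (q x) \<oplus>\<^bsub>P\<^esub> s (q y)) \<ominus>\<^bsub>P\<^esub> (x \<oplus>\<^bsub>P\<^esub> y) = (s (q x) \<ominus>\<^bsub>P\<^esub> x) \<oplus>\<^bsub>P\<^esub> (s (q y) \<ominus>\<^bsub>P\<^esub> y)"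
      using xy sq by (simp add: a_minus_def P.M.minus_add P.M.a_ac)
    also have "\<dots> \<in> U" by (intro UD(3) sq xy)
    finally show ?thesis using xy sq by (simp add: Q_def q_eq)
  qed
  have smult: "a \<odot>\<^bsub>Q\<^esub> q x = q (a \<odot>\<^bsub>P\<^esub> x)" if a: "a \<in> carrier R" and x: "x \<in> carrier P" for a x
  proof -
    have "(a \<odot>\<^bsub>P\<^esub> s (q x)) \<ominus>\<^bsub>P\<^esub> (a \<odot>\<^bsub>P\<^esub> x) = a \<odot>\<^bsub>P\<^esub> (s (q x) \<ominus>\<^bsub>P\<^esub> x)"
      using a x sq by (simp add: a_minus_def P.smult_r_distr P.smult_r_minus)
    also have "\<dots> \<in> U" by (intro UD(4) sq a x)
    finally show ?thesis using a x sq by (simp add: Q_def q_eq)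
  qed
  have "abelian_group Q"
  proof (rule abelian_groupI, goal_cases)
    case (6 t)
    then obtain x where "x \<in> carrier P" "t = q x" by (auto simp: Qs)
    then show ?case by (intro bexI[of _ "q (\<ominus>\<^bsub>P\<^esub> x)"]) (simp_all add: Qs add P.M.l_neg)
  qed (auto simp: Qs add P.M.a_ac)
  then have "left_module R Q"
    by (intro left_module.intro P.R.ring_axioms left_module_axioms.intro)
       (auto simp: Qs add smult P.smult_l_distr P.smult_r_distr P.smult_assoc1)
  moreover have "lin R P Q q" by (rule linI) (auto simp: Qs add smult)
  moreover have "ker P Q q = U"
  proof (rule Set.set_eqI)
    fix x show "x \<in> ker P Q q \<longleftrightarrow> x \<in> U"
      using UD(1) q_eq[of x "\<zero>\<^bsub>P\<^esub>"] P.minus_zero[of x] by (cases "x \<in> carrier P") (auto simp: ker_def Qs)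
  qed
  ultimately show ?thesis using Qs(1) by blast
qed

lemma iso_pair_refl: "iso_pair R X X (\<lambda>x. x) (\<lambda>x. x)"
  by (simp add: iso_pair_def retract_def lin_id)

lemma hom_fgen:
  assumes AA: "artin_algebra K \<phi> A" and X: "fg_module A X" and Y: "fg_module A Y"
  shows "\<exists>s t. (\<forall>i<s. lin A X Y (t i)) \<and> (\<forall>f. lin A X Y f \<longrightarrow> (\<exists>k. (\<forall>i<s. k i \<in> carrier K) \<and>
     (\<forall>x\<in>carrier X. f x = msum Y s (\<lambda>i. \<phi> (k i) \<odot>\<^bsub>Y\<^esub> t i x))))"
proof -
  have XL: "left_module A X" and YL: "left_module A Y" using X Y by (auto intro: fg_left_module)
  interpret Y: left_module A Y by fact
  have "\<exists>s t. (\<forall>i<s. t i \<in> mod_hom A X Y) \<and> (\<forall>f\<in>mod_hom A X Y. \<exists>k. (\<forall>i<s. k i \<in> carrier K) \<and>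
     (\<forall>x\<in>carrier X. f x = msum Y s (\<lambda>i. \<phi> (k i) \<odot>\<^bsub>Y\<^esub> t i x)))"
  proof (rule hom_subset_fgen[OF AA X Y])
    show "lin A X Y f" if "f \<in> mod_hom A X Y" for f using that by (simp add: mod_hom_lin)
    show "(\<lambda>x\<in>carrier X. \<zero>\<^bsub>Y\<^esub>) \<in> mod_hom A X Y" by (rule lin_restrict[OF lin_zero_map[OF XL YL] XL])
    show "(\<lambda>x\<in>carrier X. f x \<oplus>\<^bsub>Y\<^esub> g x) \<in> mod_hom A X Y" if "f \<in> mod_hom A X Y" "g \<in> mod_hom A X Y" for f g
      using that by (intro lin_restrict[OF lin_plus[OF _ _ YL] XL]) (simp_all add: mod_hom_lin)
    show "(\<lambda>x\<in>carrier X. \<phi> k \<odot>\<^bsub>Y\<^esub> f x) \<in> mod_hom A X Y" if "k \<in> carrier K" "f \<in> mod_hom A X Y" for k f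
      using that by (intro lin_restrict[OF lin_comp[OF _ scalar_lin[OF AA YL]] XL]) (simp_all add: mod_hom_lin)
  qed
  then obtain s t where t: "\<forall>i<s. t i \<in> mod_hom A X Y" and gen: "\<forall>f\<in>mod_hom A X Y. \<exists>k. (\<forall>i<s. k i \<in> carrier K) \<and>
     (\<forall>x\<in>carrier X. f x = msum Y s (\<lambda>i. \<phi> (k i) \<odot>\<^bsub>Y\<^esub> t i x))" by (elim exE conjE)
  have "\<exists>k. (\<forall>i<s. k i \<in> carrier K) \<and> (\<forall>x\<in>carrier X. f x = msum Y s (\<lambda>i. \<phi> (k i) \<odot>\<^bsub>Y\<^esub> t i x))"
    if "lin A X Y f" for f
    using bspec[OF gen lin_restrict[OF that XL]] by simp
  then show ?thesis using t by (intro exI[of _ s] exI[of _ t]) (simp add: mod_hom_lin)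
qed

lemma fg_small:
  fixes R :: "('a, 'r) ring_scheme" and X :: "('a, 'x, 's) module_scheme"
  assumes "fg_module R X"
  shows "\<exists>c :: 'x \<Rightarrow> (nat \<Rightarrow> 'a) set. inj_on c (carrier X)"
  using fg_copy[OF assms] iso_pairD(8) by blast

section \<open>Syzygies, cosyzygies and complete resolutions\<close>

context gor_algebra
begin

text \<open>Extension of maps into \<open>A\<close> is applied to each coordinate of a dual basis of
  \<open>Q\<close>, and the coordinates are recombined.\<close>

lemma cohom_extend_fgp:
  fixes c :: "'y \<Rightarrow> (nat \<Rightarrow> 'a) set" and Y :: "('a, 'y, 't) module_scheme"
  assumes s: "ses A X Y Z f g" and Z: "L.cohom_above 0 Z" and c: "inj_on c (carrier Y)"
    and Q: "fgp A Q" and a: "lin A X Q a"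
  shows "\<exists>b. lin A Y Q b \<and> (\<forall>x\<in>carrier X. b (f x) = a x)"
proof -
  note S = sesD[OF s]
  obtain m b u where "dual_basis A Q m b u" and QL: "left_module A Q" using Q by (auto simp: fgp_def)
  then have D: "\<And>i. i < m \<Longrightarrow> b i \<in> carrier Q" "\<And>i. i < m \<Longrightarrow> lin A Q (regular_mod A) (u i)"
    "\<And>v. v \<in> carrier Q \<Longrightarrow> v = msum Q m (\<lambda>i. u i v \<odot>\<^bsub>Q\<^esub> b i)" by (auto simp: dual_basis_def)
  define t where "t i = (SOME t. lin A Y (regular_mod A) t \<and> (\<forall>x\<in>carrier X. t (f x) = u i (a x)))" for i
  have t: "lin A Y (regular_mod A) (t i) \<and> (\<forall>x\<in>carrier X. t i (f x) = u i (a x))" if "i < m" for i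
  proof -
    have "\<exists>t. lin A Y (regular_mod A) t \<and> (\<forall>x\<in>carrier X. t (f x) = u i (a x))"
      by (rule L.cohom_extend[OF s Z c lin_comp[OF a D(2)[OF that]]])
    then show ?thesis unfolding t_def by (rule someI_ex)
  qed
  have "lin A Y Q (\<lambda>y. msum Q m (\<lambda>i. t i y \<odot>\<^bsub>Q\<^esub> b i))"
    by (rule lin_msum[OF lin_coeff_smult S(2) QL]) (use t D QL in auto)
  moreover have "msum Q m (\<lambda>i. t i (f x) \<odot>\<^bsub>Q\<^esub> b i) = a x" if x: "x \<in> carrier X" for x
  proof -
    have "msum Q m (\<lambda>i. t i (f x) \<odot>\<^bsub>Q\<^esub> b i) = msum Q m (\<lambda>i. u i (a x) \<odot>\<^bsub>Q\<^esub> b i)"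
      by (rule msum_cong) (use t x in simp)
    then show ?thesis using D(3)[OF lin_closed[OF a x]] by simp
  qed
  ultimately show ?thesis by blast
qed

text \<open>Both modules are kept in the universe, so the relation can be iterated by dependent
  choice in either direction.\<close>

definition syzygy_step :: "'a umod \<Rightarrow> 'a umod \<Rightarrow> bool" where
  "syzygy_step X Y \<longleftrightarrow> (\<exists>(P :: 'a umod) i p. fgp A P \<and> ses A X P Y i p)"

text \<open>Generators \<open>t i\<close> of the dual of \<open>X\<close> over \<open>K\<close> are
  the components of a map \<open>j\<close> into \<open>free s\<close>. Torsionlessness makes
  \<open>j\<close> injective. Every functional on \<open>X\<close> factors through \<open>j\<close>,
  which is the condition of \<open>L.cohom_above_cokernel\<close> for its cokernel.\<close>

lemma cosyzygy:
  fixes X :: "'a umod"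
  assumes X: "fg_module A X" and X0: "L.cohom_above 0 X"
  shows "\<exists>Y. fg_module A Y \<and> L.cohom_above 0 Y \<and> syzygy_step X Y"
proof -
  have XL: "left_module A X" by (rule fg_left_module[OF X])
  have RR: "left_module A (regular_mod A)" by (rule regular_left_module[OF A_ring])
  interpret RR: left_module A "regular_mod A" by (rule RR)
  have RF: "fg_module A (regular_mod A)"
    unfolding fg_iff
  proof (intro conjI RR fgenI[of 1 "\<lambda>_. \<one>\<^bsub>A\<^esub>"])
    fix u assume "u \<in> carrier (regular_mod A)"
    then show "\<exists>c. (\<forall>i<1. c i \<in> carrier A) \<and> u = msum (regular_mod A) 1 (\<lambda>i. c i \<odot>\<^bsub>regular_mod A\<^esub> \<one>\<^bsub>A\<^esub>)"
      by (intro exI[of _ "\<lambda>_. u"]) simp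
  qed simp
  obtain s t where t: "\<forall>i<s. lin A X (regular_mod A) (t i)"
    and gen: "\<forall>f. lin A X (regular_mod A) f \<longrightarrow> (\<exists>k. (\<forall>i<s. k i \<in> carrier K) \<and>
     (\<forall>x\<in>carrier X. f x = msum (regular_mod A) s (\<lambda>i. \<phi> (k i) \<odot>\<^bsub>regular_mod A\<^esub> t i x)))"
    using hom_fgen[OF AA X RF] by (elim exE conjE)
  have tA: "t i x \<in> carrier A" if "i < s" "x \<in> carrier X" for i x
    using t that lin_closed[of A X "regular_mod A" "t i" x] by simp
  define j where "j x = (\<lambda>i\<in>{..<s}. t i x)" for x
  interpret X: left_module A X by (rule XL)
  have j: "lin A X (free s) j"
    unfolding j_def by (rule power_tuple_lin[OF XL RR]) (use t in blast)
  have inj: "inj_on j (carrier X)"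
    unfolding lin_inj_iff[OF j XL free_L]
  proof (intro ballI impI)
    fix x assume x: "x \<in> carrier X" "j x = \<zero>\<^bsub>free s\<^esub>"
    have tx: "t i x = \<zero>\<^bsub>A\<^esub>" if "i < s" for i
      using fun_cong[OF x(2), of i] that by (simp add: j_def power_mod_simps(4))
    show "x = \<zero>\<^bsub>X\<^esub>"
    proof (rule torsionless[OF X X0 x(1)])
      fix a assume "lin A X (regular_mod A) a"
      note a = this
      obtain k where k: "\<forall>i<s. k i \<in> carrier K"
        "\<forall>x\<in>carrier X. a x = msum (regular_mod A) s (\<lambda>i. \<phi> (k i) \<odot>\<^bsub>regular_mod A\<^esub> t i x)" using mp[OF spec[OF gen] a] by (elim exE conjE)
      have "msum (regular_mod A) s (\<lambda>i. \<phi> (k i) \<odot>\<^bsub>regular_mod A\<^esub> t i x) = \<zero>\<^bsub>regular_mod A\<^esub>"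
        by (rule RR.msum_zero) (use k(1) tx artin_algebraD(6)[OF AA] in simp)
      then show "a x = \<zero>\<^bsub>A\<^esub>" using k(2) x(1) by simp
    qed
  qed
  have ext: "\<exists>b. lin A (free s) (regular_mod A) b \<and> (\<forall>x\<in>carrier X. b (j x) = a x)"
    if a: "lin A X (regular_mod A) a" for a
  proof -
    obtain k where k: "\<forall>i<s. k i \<in> carrier K"
      "\<forall>x\<in>carrier X. a x = msum (regular_mod A) s (\<lambda>i. \<phi> (k i) \<odot>\<^bsub>regular_mod A\<^esub> t i x)" using mp[OF spec[OF gen] a] by (elim exE conjE)
    \<comment> \<open>The coefficients are written on the right of \<open>v i\<close>, where
      multiplication is linear for left modules; by centrality of \<open>\<phi> (k i)\<close> this
      gives the same values.\<close>
    have "lin A (free s) (regular_mod A) (\<lambda>v. msum (regular_mod A) s (\<lambda>i. v i \<odot>\<^bsub>regular_mod A\<^esub> \<phi> (k i)))"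
      by (rule lin_msum[OF lin_coeff_smult[OF power_proj_lin RR] free_L RR])
        (use k(1) artin_algebraD(6)[OF AA] in simp_all)
    moreover have "msum (regular_mod A) s (\<lambda>i. j x i \<odot>\<^bsub>regular_mod A\<^esub> \<phi> (k i)) = a x" if x: "x \<in> carrier X" for x
    proof -
      have "msum (regular_mod A) s (\<lambda>i. j x i \<odot>\<^bsub>regular_mod A\<^esub> \<phi> (k i)) =
        msum (regular_mod A) s (\<lambda>i. \<phi> (k i) \<odot>\<^bsub>regular_mod A\<^esub> t i x)"
        by (rule msum_cong) (use k(1) tA[OF _ x] artin_algebraD(5)[OF AA] in \<open>simp add: j_def\<close>)
      then show ?thesis using k(2) x by simp
    qed
    ultimately show ?thesis by blast
  qed
  have im: "submodule (j ` carrier X) A (free s)" by (rule image_submodule[OF j XL free_L X.carrier_submodule])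
  obtain Q :: "('a, (nat \<Rightarrow> 'a) set) module" and q where Q: "left_module A Q" "lin A (free s) Q q"
    "q ` carrier (free s) = carrier Q" "ker (free s) Q q = j ` carrier X"
    using quotient_exists[OF free_L im] by (elim exE conjE)
  have sq: "ses A X (free s) Q j q" unfolding ses_def using XL free_L Q j inj by simp
  have Qfg: "fg_module A Q" by (rule fg_image[OF Q(2,1) free_fg Q(3)])
  have Q0: "L.cohom_above 0 Q"
    by (rule L.cohom_above_cokernel[OF sq X0 L.cohom_above_fgp[OF free_fgp[OF A_ring]] singleton_inj ext])
  obtain P :: "'a umod" and g h where P: "fg_module A P" "iso_pair A (free s) P g h"
    using fg_copy[OF free_fg[of s]] by (elim exE conjE)
  have PL: "left_module A P" by (rule fg_left_module[OF P(1)])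
  have "fgp A P" by (rule fgp_retract[OF iso_pair_retract(2)[OF P(2)] free_fgp[OF A_ring] PL])
  then have "syzygy_step X Q"
    unfolding syzygy_step_def using ses_transport[OF sq iso_pair_refl XL P(2) PL iso_pair_refl Q(1)] by blast
  then show ?thesis using Qfg Q0 by blast
qed

lemma umod_small: "inj_on (\<lambda>x. x) S"
  by simp

lemma syzygy:
  fixes Y :: "'a umod"
  assumes Y: "fg_module A Y" and Y0: "L.cohom_above 0 Y"
  shows "\<exists>X. fg_module A X \<and> L.cohom_above 0 X \<and> syzygy_step X Y"
proof -
  have YL: "left_module A Y" by (rule fg_left_module[OF Y])
  obtain m p where p: "lin A (free m) Y p" "p ` carrier (free m) = carrier Y" using free_cover[OF Y] by blast
  obtain P :: "'a umod" and g h where P: "fg_module A P" "iso_pair A (free m) P g h"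
    using fg_copy[OF free_fg[of m]] by (elim exE conjE)
  have PL: "left_module A P" by (rule fg_left_module[OF P(1)])
  have PP: "fgp A P" by (rule fgp_retract[OF iso_pair_retract(2)[OF P(2)] free_fgp[OF A_ring] PL])
  have q: "lin A P Y (\<lambda>x. p (h x))" by (rule lin_comp[OF iso_pairD(2)[OF P(2)] p(1)])
  have "(\<lambda>x. p (h x)) ` carrier P = carrier Y"
    using iso_pairD(7)[OF iso_pair_sym[OF P(2)]] p(2) by (simp add: image_image[symmetric])
  note s = ses_ker[OF PL YL q this]
  let ?X = "P\<lparr>carrier := ker P Y (\<lambda>x. p (h x))\<rparr>"
  have "fg_module A ?X" by (rule fg_submodule[OF AA P(1) ker_submodule[OF q PL YL]])
  moreover have "L.cohom_above 0 ?X"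
    by (rule L.cohom_above_cover[OF s L.cohom_above_fgp[OF PP] L.cohom_above_mono[OF Y0] umod_small]) simp
  ultimately show ?thesis using s PP unfolding syzygy_step_def by blast
qed

text \<open>Iterated syzygies to the left and cosyzygies to the right of \<open>X\<close> are
  spliced into a two-sided exact complex. It stays exact under maps to projectives, since all its
  cycle modules have no higher extensions by \<open>A\<close>.\<close>

lemma gorenstein_projective_if_cohom:
  fixes X :: "'a umod"
  assumes X: "fg_module A X" and X0: "L.cohom_above 0 X"
  shows "gorenstein_projective A X"
proof -
  define good where "good Y \<longleftrightarrow> fg_module A Y \<and> L.cohom_above 0 Y" for Y :: "'a umod"
  have gX: "good X" using X X0 by (simp add: good_def)
  have "\<exists>f. \<forall>i::nat. (good (f i) \<and> (i = 0 \<longrightarrow> f i = X)) \<and> syzygy_step (f i) (f (Suc i))"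
    by (rule dependent_nat_choice) (use gX cosyzygy in \<open>auto simp: good_def\<close>)
  then obtain u where u: "\<And>i::nat. good (u i)" "u 0 = X" "\<And>i. syzygy_step (u i) (u (Suc i))" by blast
  have "\<exists>f. \<forall>i::nat. (good (f i) \<and> (i = 0 \<longrightarrow> f i = X)) \<and> syzygy_step (f (Suc i)) (f i)"
    by (rule dependent_nat_choice) (use gX syzygy in \<open>auto simp: good_def\<close>)
  then obtain w where w: "\<And>i::nat. good (w i)" "w 0 = X" "\<And>i. syzygy_step (w (Suc i)) (w i)" by blast
  \<comment> \<open>The cycle modules: cosyzygies in nonnegative and syzygies in negative
    degrees.\<close>
  define Z where "Z j = (if 0 \<le> j then u (nat j) else w (nat (- j)))" for j :: int
  have Zg: "good (Z j)" for j by (simp add: Z_def u(1) w(1))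
  have Z0: "Z 0 = X" by (simp add: Z_def u(2))
  have step: "syzygy_step (Z j) (Z (j + 1))" for j
  proof (cases "0 \<le> j")
    case True
    then have "nat (j + 1) = Suc (nat j)" by simp
    then show ?thesis using True u(3)[of "nat j"] by (simp add: Z_def)
  next
    case False
    then have "nat (- j) = Suc (nat (- (j + 1)))" by simp
    \<comment> \<open>For \<open>j = -1\<close> the two halves meet, both sequences starting at
      \<open>X\<close>.\<close>
    moreover have "Z (j + 1) = w (nat (- (j + 1)))"
      using False u(2) w(2) by (auto simp: Z_def)
    ultimately show ?thesis using False w(3)[of "nat (- (j + 1))"] by (simp add: Z_def)
  qed
  have "\<forall>j. \<exists>(P :: 'a umod) i p. fgp A P \<and> ses A (Z j) P (Z (j + 1)) i p"
    using step unfolding syzygy_step_def by blast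
  then have "\<exists>P :: int \<Rightarrow> 'a umod. \<forall>j. \<exists>i p. fgp A (P j) \<and> ses A (Z j) (P j) (Z (j + 1)) i p" by (rule choice)
  then obtain P :: "int \<Rightarrow> 'a umod" where "\<forall>j. \<exists>i p. fgp A (P j) \<and> ses A (Z j) (P j) (Z (j + 1)) i p" by blast
  then have "\<exists>\<iota>. \<forall>j. \<exists>p. fgp A (P j) \<and> ses A (Z j) (P j) (Z (j + 1)) (\<iota> j) p" by (rule choice)
  then obtain \<iota> where "\<forall>j. \<exists>p. fgp A (P j) \<and> ses A (Z j) (P j) (Z (j + 1)) (\<iota> j) p" by blast
  then have "\<exists>\<pi>. \<forall>j. fgp A (P j) \<and> ses A (Z j) (P j) (Z (j + 1)) (\<iota> j) (\<pi> j)" by (rule choice)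
  then obtain \<pi> where P: "\<And>j. fgp A (P j)" and s: "\<And>j. ses A (Z j) (P j) (Z (j + 1)) (\<iota> j) (\<pi> j)" by blast
  note S = sesD[OF s]
  define D where "D j = restrict (\<lambda>x. \<iota> (j + 1) (\<pi> j x)) (carrier (P j))" for j
  have Dl: "D j \<in> mod_hom A (P j) (P (j + 1))" for j
    unfolding D_def by (rule lin_restrict[OF lin_comp[OF S(5) S(4)] S(2)])
  have Dim: "D j ` carrier (P j) = \<iota> (j + 1) ` carrier (Z (j + 1))" for j
  proof -
    have "D j ` carrier (P j) = \<iota> (j + 1) ` (\<pi> j ` carrier (P j))" by (simp add: D_def image_image)
    then show ?thesis by (simp add: S(7))
  qed
  have \<iota>0: "\<iota> j x = \<zero>\<^bsub>P j\<^esub> \<longleftrightarrow> x = \<zero>\<^bsub>Z j\<^esub>" if "x \<in> carrier (Z j)" for j x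
    using S(6)[of j] that lin_zero[OF S(4)[of j] S(1)[of j] S(2)[of j]] unfolding lin_inj_iff[OF S(4)[of j] S(1)[of j] S(2)[of j]] by auto
  have two: "j + 1 + 1 = j + 2" for j :: int by simp
  have Dker: "ker (P j) (P (j + 1)) (D j) = ker (P j) (Z (j + 1)) (\<pi> j)" for j
    using \<iota>0[OF S(11)] by (auto simp: ker_def D_def)
  have ex: "exact_at (D j) (D (j + 1)) (P j) (P (j + 1)) (P (j + 2))" for j
  proof -
    have "ker (P (j + 1)) (P (j + 1 + 1)) (D (j + 1)) = \<iota> (j + 1) ` carrier (Z (j + 1))"
      unfolding Dker using s[of "j + 1"] by (simp add: ses_def)
    then show ?thesis unfolding exact_at_def a_kernel_ker Dim two by simp
  qed
  have "totally_acyclic A P D"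
    unfolding totally_acyclic_def
  proof (intro conjI allI ballI impI)
    fix j show "fg_module A (P j)" "projective_mod A (P j)" using P[of j] unfolding fgp_iff[symmetric] by auto
  next
    fix Q :: "'a umod" and j f
    assume Q: "fg_module A Q \<and> projective_mod A Q" and f: "f \<in> mod_hom A (P (j + 1)) Q"
      and van: "compose (carrier (P j)) f (D j) = (\<lambda>x\<in>carrier (P j). \<zero>\<^bsub>Q\<^esub>)"
    have Qp: "fgp A Q" using Q unfolding fgp_iff .
    have fl: "lin A (P (j + 1)) Q f" and fe: "f \<in> extensional (carrier (P (j + 1)))" using f by (simp_all add: mod_hom_lin)
    \<comment> \<open>The image of \<open>D j\<close> is the kernel of \<open>\<pi> (j + 1)\<close>,
      so a cocycle \<open>f\<close> descends to the next cycle module, and from there it extends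
      along \<open>\<iota>\<close>.\<close>
    have "f y = \<zero>\<^bsub>Q\<^esub>" if y: "y \<in> carrier (P (j + 1))" "\<pi> (j + 1) y = \<zero>\<^bsub>Z (j + 1 + 1)\<^esub>" for y
    proof -
      obtain z where z: "z \<in> carrier (Z (j + 1))" "y = \<iota> (j + 1) z" using S(9)[OF y] by blast
      then have "y \<in> D j ` carrier (P j)" unfolding Dim by simp
      then obtain x where "y = D j x" "x \<in> carrier (P j)" by (rule imageE)
      then show ?thesis using fun_cong[OF van, of x] by (simp add: compose_def)
    qed
    from lin_factor[OF S(5) S(2) S(3) fgpD[OF Qp] S(7) fl this]
    obtain f' where f': "lin A (Z (j + 1 + 1)) Q f'" "\<forall>x\<in>carrier (P (j + 1)). f' (\<pi> (j + 1) x) = f x" by blast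
    have c0: "L.cohom_above 0 (Z (j + 1 + 1 + 1))" using Zg unfolding good_def by blast
    obtain b where b: "lin A (P (j + 1 + 1)) Q b" "\<forall>x\<in>carrier (Z (j + 1 + 1)). b (\<iota> (j + 1 + 1) x) = f' x"
      using cohom_extend_fgp[OF s c0 umod_small Qp f'(1)] by blast
    have "f = compose (carrier (P (j + 1))) (restrict b (carrier (P (j + 1 + 1)))) (D (j + 1))"
    proof
      fix x show "f x = compose (carrier (P (j + 1))) (restrict b (carrier (P (j + 1 + 1)))) (D (j + 1)) x"
      proof (cases "x \<in> carrier (P (j + 1))")
        case True
        then show ?thesis using b(2) f'(2) S(11)[OF True] S(10) by (simp add: compose_def D_def)
      next
        case False
        then show ?thesis using fe by (simp add: compose_def extensional_def)
      qed
    qed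
    then show "\<exists>g\<in>mod_hom A (P (j + 2)) Q. f = compose (carrier (P (j + 1))) g (D (j + 1))"
      using lin_restrict[OF b(1) S(2)] unfolding two by blast
  qed (use Dl ex in auto)
  moreover have "mod_iso A X ((P 0)\<lparr>carrier := D (-1) ` carrier (P (-1))\<rparr>)"
  proof -
    have "D (-1) ` carrier (P (-1)) = \<iota> 0 ` carrier (Z 0)" using Dim[of "-1"] by simp
    moreover have "iso_pair A (Z 0) (P 0\<lparr>carrier := \<iota> 0 ` carrier (Z 0)\<rparr>) (\<iota> 0) (inv_into (carrier (Z 0)) (\<iota> 0))"
      by (rule bij_iso_pair[OF lin_codom[OF S(4)] S(1) S(6)]) auto
    ultimately show ?thesis using iso_pair_mod_iso[OF _ S(1)[of 0]] unfolding Z0 by simp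
  qed
  ultimately show ?thesis unfolding gorenstein_projective_def using X by blast
qed

text \<open>Every cycle module of the complex is a syzygy of the next one. The bound
  \<open>n\<close> of \<open>L.cohom_above_top\<close> holds for all of them, and \<open>n\<close>
  dimension shifts bring it down to zero.\<close>

lemma cohom_if_gorenstein_projective:
  assumes "gorenstein_projective A G"
  shows "L.cohom_above 0 G"
proof -
  from assms obtain P D where G: "fg_module A G" and T: "totally_acyclic A P D"
    and iso: "mod_iso A G ((P 0)\<lparr>carrier := D (-1) ` carrier (P (-1))\<rparr>)"
    by (auto simp: gorenstein_projective_def)
  have P: "fgp A (P j)" for j using T unfolding totally_acyclic_def fgp_iff[symmetric] by blast
  have D: "lin A (P j) (P (j + 1)) (D j)" for j using T unfolding totally_acyclic_def mod_hom_lin by blast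
  have two: "j + 1 + 1 = j + 2" for j :: int by simp
  have ex: "D j ` carrier (P j) = ker (P (j + 1)) (P (j + 1 + 1)) (D (j + 1))" for j
    using T unfolding totally_acyclic_def exact_at_def a_kernel_ker two by blast
  have PL: "left_module A (P j)" for j by (rule fgpD[OF P])
  define N where "N j = P (j + 1)\<lparr>carrier := D j ` carrier (P j)\<rparr>" for j
  have NL: "left_module A (N j)" for j unfolding N_def by (rule image_left_module[OF D PL PL])
  have s: "ses A (N j) (P (j + 1)) (N (j + 1)) (\<lambda>x. x) (D (j + 1))" for j
    unfolding ses_def
  proof (intro conjI NL PL)
    show "lin A (N j) (P (j + 1)) (\<lambda>x. x)"
      unfolding N_def by (rule lin_incl) (use lin_closed[OF D] in auto)
    show "lin A (P (j + 1)) (N (j + 1)) (D (j + 1))" unfolding N_def by (rule lin_codom[OF D]) simp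
    show "D (j + 1) ` carrier (P (j + 1)) = carrier (N (j + 1))" by (simp add: N_def)
    show "ker (P (j + 1)) (N (j + 1)) (D (j + 1)) = (\<lambda>x. x) ` carrier (N j)"
      by (simp add: N_def ex) (simp add: ker_def)
  qed simp
  have "L.cohom_above (n - t) (N j)" if "t \<le> n" for t j
    using that
  proof (induction t arbitrary: j)
    case 0 then show ?case using L.cohom_above_top[OF NL] by simp
  next
    case (Suc t)
    have "Suc (n - Suc t) = n - t" using Suc.prems by simp
    then show ?case
      using L.cohom_above_cover[OF s L.cohom_above_fgp[OF P] _ umod_small, of "n - Suc t" j] Suc by simp
  qed
  \<comment> \<open>\<open>N (-1)\<close> is the image of the map from \<open>P (-1)\<close> to
    \<open>P 0\<close>, the copy of \<open>G\<close> in the complex.\<close>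
  from this[of n "-1"] have N0: "L.cohom_above 0 (N (-1))" by simp
  obtain g h where "iso_pair A G (N (-1)) g h"
    using mod_iso_pair[OF _ fg_left_module[OF G], of "N (-1)"] iso by (auto simp: N_def)
  then show ?thesis using L.cohom_above_retract[OF iso_pair_retract(1) N0] by blast
qed

end

section \<open>The functor \<open>Hom(M, -)\<close>\<close>

lemma hom_module_simps [simp]:
  "carrier (hom_module R M X) = mod_hom R M X" "\<zero>\<^bsub>hom_module R M X\<^esub> = (\<lambda>m\<in>carrier M. \<zero>\<^bsub>X\<^esub>)"
  "f \<oplus>\<^bsub>hom_module R M X\<^esub> g = (\<lambda>m\<in>carrier M. f m \<oplus>\<^bsub>X\<^esub> g m)"
  "b \<odot>\<^bsub>hom_module R M X\<^esub> f = (\<lambda>m\<in>carrier M. f (b m))"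
  by (simp_all add: hom_module_def)

lemma end_ring_simps [simp]:
  "carrier (end_ring R M) = mod_hom R M M" "\<zero>\<^bsub>end_ring R M\<^esub> = (\<lambda>m\<in>carrier M. \<zero>\<^bsub>M\<^esub>)"
  "f \<oplus>\<^bsub>end_ring R M\<^esub> g = (\<lambda>m\<in>carrier M. f m \<oplus>\<^bsub>M\<^esub> g m)"
  "b \<otimes>\<^bsub>end_ring R M\<^esub> f = (\<lambda>m\<in>carrier M. f (b m))"
  by (simp_all add: end_ring_def compose_def)

lemma mod_hom_eqI:
  assumes "f \<in> mod_hom R M X" "g \<in> mod_hom R M X" "\<And>x. x \<in> carrier M \<Longrightarrow> f x = g x"
  shows "f = g"
  by (rule extensionalityI[of f "carrier M"]) (use assms in \<open>auto simp: mod_hom_lin\<close>)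

lemma mod_hom_linD: "f \<in> mod_hom R M X \<Longrightarrow> lin R M X f"
  by (simp add: mod_hom_lin)

lemma mod_hom_closed: "f \<in> mod_hom R M X \<Longrightarrow> x \<in> carrier M \<Longrightarrow> f x \<in> carrier X"
  using lin_closed mod_hom_linD by metis

definition hom_map :: "('a, 'm, 's) module_scheme \<Rightarrow> ('x \<Rightarrow> 'y) \<Rightarrow> ('m \<Rightarrow> 'x) \<Rightarrow> 'm \<Rightarrow> 'y" where
  "hom_map M f h = (\<lambda>m\<in>carrier M. f (h m))"

lemma hom_map_apply [simp]: "m \<in> carrier M \<Longrightarrow> hom_map M f h m = f (h m)"
  by (simp add: hom_map_def)

lemma hom_map_closed:
  assumes "lin R X Y f" "left_module R M" "h \<in> mod_hom R M X"
  shows "hom_map M f h \<in> mod_hom R M Y"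
  unfolding hom_map_def by (rule lin_restrict[OF lin_comp[OF mod_hom_linD[OF assms(3)] assms(1)] assms(2)])

lemma hom_map_lin:
  assumes f: "lin R X Y f" and M: "left_module R M"
  shows "lin (end_ring R M) (hom_module R M X) (hom_module R M Y) (hom_map M f)"
proof (rule linI)
  fix h assume "h \<in> carrier (hom_module R M X)"
  then show "hom_map M f h \<in> carrier (hom_module R M Y)" using hom_map_closed[OF f M] by simp
next
  fix h k assume "h \<in> carrier (hom_module R M X)" "k \<in> carrier (hom_module R M X)"
  then show "hom_map M f (h \<oplus>\<^bsub>hom_module R M X\<^esub> k) = hom_map M f h \<oplus>\<^bsub>hom_module R M Y\<^esub> hom_map M f k"
    using mod_hom_closed by (auto simp: hom_map_def restrict_def fun_eq_iff intro!: lin_add[OF f])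
next
  fix b h assume "b \<in> carrier (end_ring R M)" "h \<in> carrier (hom_module R M X)"
  then show "hom_map M f (b \<odot>\<^bsub>hom_module R M X\<^esub> h) = b \<odot>\<^bsub>hom_module R M Y\<^esub> hom_map M f h"
    using mod_hom_closed[of b R M M] by (auto simp: hom_map_def restrict_def fun_eq_iff)
qed

lemma hom_map_retract:
  assumes r: "retract R X Y i r" and M: "left_module R M"
  shows "retract (end_ring R M) (hom_module R M X) (hom_module R M Y) (hom_map M i) (hom_map M r)"
proof -
  note D = retractD[OF r]
  have "hom_map M r (hom_map M i h) = h" if h: "h \<in> mod_hom R M X" for h
    by (rule mod_hom_eqI[OF hom_map_closed[OF D(2) M hom_map_closed[OF D(1) M h]] h])
      (simp add: D(3)[OF mod_hom_closed[OF h]])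
  then show ?thesis unfolding retract_def using hom_map_lin[OF D(1) M] hom_map_lin[OF D(2) M] by simp
qed

lemma hom_map_iso: "iso_pair R X Y g h \<Longrightarrow> left_module R M \<Longrightarrow>
  iso_pair (end_ring R M) (hom_module R M X) (hom_module R M Y) (hom_map M g) (hom_map M h)"
  by (simp add: iso_pair_def hom_map_retract)

text \<open>Left exactness holds in general; surjectivity at the right end is supplied by
  \<open>lift\<close>, which approximations are made to satisfy.\<close>

lemma hom_ses:
  assumes s: "ses R X Y Z f g" and M: "left_module R M"
    and lift: "\<And>h. lin R M Z h \<Longrightarrow> \<exists>k. lin R M Y k \<and> (\<forall>x\<in>carrier M. g (k x) = h x)"
  shows "ses (end_ring R M) (hom_module R M X) (hom_module R M Y) (hom_module R M Z) (hom_map M f) (hom_map M g)"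
proof (rule sesI)
  note S = sesD[OF s]
  interpret M: left_module R M by (rule M)
  show "left_module (end_ring R M) (hom_module R M X)" "left_module (end_ring R M) (hom_module R M Y)"
    "left_module (end_ring R M) (hom_module R M Z)" by (rule hom_module_left_module[OF M] S)+
  show "lin (end_ring R M) (hom_module R M X) (hom_module R M Y) (hom_map M f)" by (rule hom_map_lin[OF S(4) M])
  show "lin (end_ring R M) (hom_module R M Y) (hom_module R M Z) (hom_map M g)" by (rule hom_map_lin[OF S(5) M])
  show "inj_on (hom_map M f) (carrier (hom_module R M X))"
  proof (rule inj_onI)
    fix h k assume hk: "h \<in> carrier (hom_module R M X)" "k \<in> carrier (hom_module R M X)" "hom_map M f h = hom_map M f k"
    show "h = k"
    proof (rule mod_hom_eqI)
      show "h \<in> mod_hom R M X" "k \<in> mod_hom R M X" using hk by simp_all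
      fix x assume x: "x \<in> carrier M"
      have "f (h x) = f (k x)" using fun_cong[OF hk(3), of x] x by simp
      then show "h x = k x" using inj_onD[OF S(6)] mod_hom_closed[of h R M X x] mod_hom_closed[of k R M X x] hk x by simp
    qed
  qed
next
  note S = sesD[OF s]
  fix h assume "h \<in> carrier (hom_module R M Z)"
  then have h: "h \<in> mod_hom R M Z" by simp
  obtain k where k: "lin R M Y k" "\<forall>x\<in>carrier M. g (k x) = h x" using lift[OF mod_hom_linD[OF h]] by blast
  have kr: "restrict k (carrier M) \<in> mod_hom R M Y" by (rule lin_restrict[OF k(1) M])
  have "hom_map M g (restrict k (carrier M)) = h"
    by (rule mod_hom_eqI[OF hom_map_closed[OF S(5) M kr] h]) (simp add: k(2))
  then show "\<exists>v\<in>carrier (hom_module R M Y). hom_map M g v = h" using kr by auto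
next
  note S = sesD[OF s]
  fix h assume "h \<in> carrier (hom_module R M X)"
  then have h: "h \<in> mod_hom R M X" by simp
  show "hom_map M g (hom_map M f h) = \<zero>\<^bsub>hom_module R M Z\<^esub>"
    using S(8) mod_hom_closed[OF h] by (auto simp: hom_map_def restrict_def fun_eq_iff)
next
  note S = sesD[OF s]
  fix h assume "h \<in> carrier (hom_module R M Y)" and z: "hom_map M g h = \<zero>\<^bsub>hom_module R M Z\<^esub>"
  then have h: "h \<in> mod_hom R M Y" by simp
  have "g (h x) = \<zero>\<^bsub>Z\<^esub>" if "x \<in> carrier M" for x using fun_cong[OF z, of x] that by simp
  then obtain k where k: "lin R M X k" "\<forall>x\<in>carrier M. f (k x) = h x"
    using ses_lift[OF s M mod_hom_linD[OF h]] by blast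
  have kr: "restrict k (carrier M) \<in> mod_hom R M X" by (rule lin_restrict[OF k(1) M])
  have "h = hom_map M f (restrict k (carrier M))"
    by (rule mod_hom_eqI[OF h hom_map_closed[OF S(4) M kr]]) (simp add: k(2))
  then show "\<exists>u\<in>carrier (hom_module R M X). h = hom_map M f u" using kr by auto
qed

section \<open>Powers of a module and the additive closure\<close>

lemma ses_power:
  assumes M: "left_module R M"
  shows "ses R (power_mod M m) (power_mod M (Suc m)) M (\<lambda>v. \<lambda>i\<in>{..<Suc m}. if i < m then v i else \<zero>\<^bsub>M\<^esub>) (\<lambda>v. v m)"
    (is "ses _ ?P ?P' _ ?j _")
proof (rule sesI)
  have P: "left_module R ?P" and P': "left_module R ?P'" by (rule power_left_module[OF M])+
  show "left_module R ?P" "left_module R ?P'" "left_module R M" by fact+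
  show j: "lin R ?P ?P' ?j"
  proof (rule power_tuple_lin[OF P M])
    fix i show "lin R ?P M (\<lambda>v. if i < m then v i else \<zero>\<^bsub>M\<^esub>)"
      by (cases "i < m") (simp_all add: power_proj_lin lin_zero_map[OF P M])
  qed
  show "lin R ?P' M (\<lambda>v. v m)" by (rule power_proj_lin) simp
  show "inj_on ?j (carrier ?P)"
  proof (rule inj_onI)
    fix v w assume vw: "v \<in> carrier ?P" "w \<in> carrier ?P" "?j v = ?j w"
    show "v = w"
    proof (rule power_mod_eqI[OF vw(1,2)])
      fix i assume "i < m" then show "v i = w i" using fun_cong[OF vw(3), of i] by simp
    qed
  qed
  show "\<exists>v\<in>carrier ?P'. v m = w" if "w \<in> carrier M" for w
    using lin_closed[OF pin_lin[OF M, of "Suc m" m] that] by (intro bexI[of _ "pin M (Suc m) m w"]) (simp_all add: pin_def)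
  show "\<exists>u\<in>carrier ?P. v = ?j u" if v: "v \<in> carrier ?P'" "v m = \<zero>\<^bsub>M\<^esub>" for v
  proof
    show u: "restrict v {..<m} \<in> carrier ?P" by (rule power_modI) (use power_modD[OF v(1)] in simp)
    show "v = ?j (restrict v {..<m})"
      by (rule power_mod_eqI[OF v(1) lin_closed[OF j u]]) (use v(2) in \<open>auto simp: less_Suc_eq\<close>)
  qed
qed simp

lemma power_zero_fg: "left_module R M \<Longrightarrow> fg_module R (power_mod M 0)"
proof -
  assume M: "left_module R M"
  have P: "left_module R (power_mod M 0)" by (rule power_left_module[OF M])
  have "fgen R (power_mod M 0) (carrier (power_mod M 0))"
    by (rule fgenI[of 0]) (auto simp: power_mod_def)
  then show ?thesis using P by (simp add: fg_iff)
qed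

lemma power_fg:
  assumes "fg_module R M" shows "fg_module R (power_mod M m)"
proof (induction m)
  case 0 then show ?case by (rule power_zero_fg[OF fg_left_module[OF assms]])
next
  case (Suc m)
  show ?case by (rule fg_ext[OF ses_power[OF fg_left_module[OF assms]] Suc assms])
qed

text \<open>Powers are built up one summand at a time. The sequences split, so they remain exact
  under \<open>Hom(M, -)\<close>.\<close>

lemma pd_le_hom_power:
  assumes M: "left_module R M" and E: "left_module R E" and p: "pd_le (end_ring R M) p (hom_module R M E)"
  shows "pd_le (end_ring R M) p (hom_module R M (power_mod E m))"
proof (induction m)
  case 0
  have P: "left_module R (power_mod E 0)" by (rule power_left_module[OF E])
  have L: "left_module (end_ring R M) (hom_module R M (power_mod E 0))" by (rule hom_module_left_module[OF M P])
  have "v = \<zero>\<^bsub>hom_module R M (power_mod E 0)\<^esub>" if v: "v \<in> mod_hom R M (power_mod E 0)" for v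
  proof (rule mod_hom_eqI[OF v])
    have "\<zero>\<^bsub>hom_module R M (power_mod E 0)\<^esub> \<in> carrier (hom_module R M (power_mod E 0))"
      by (rule left_module.submoduleD(2)[OF L left_module.carrier_submodule[OF L]])
    then show "\<zero>\<^bsub>hom_module R M (power_mod E 0)\<^esub> \<in> mod_hom R M (power_mod E 0)" by simp
    fix x assume "x \<in> carrier M"
    then show "v x = \<zero>\<^bsub>hom_module R M (power_mod E 0)\<^esub> x"
      using mod_hom_closed[OF v, of x] by (auto simp: power_mod_def restrict_def)
  qed
  then have "fgp (end_ring R M) (hom_module R M (power_mod E 0))"
    unfolding fgp_def dual_basis_def using L by (intro conjI exI[of _ "0::nat"] exI) simp_all
  then show ?case using pd_le_mono[of _ 0 _ p] by (simp add: pd_le_0_iff)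
next
  case (Suc m)
  have "ses (end_ring R M) (hom_module R M (power_mod E m)) (hom_module R M (power_mod E (Suc m))) (hom_module R M E)
    (hom_map M (\<lambda>v. \<lambda>i\<in>{..<Suc m}. if i < m then v i else \<zero>\<^bsub>E\<^esub>)) (hom_map M (\<lambda>v. v m))"
  proof (rule hom_ses[OF ses_power[OF E] M])
    fix h assume "lin R M E h"
    then show "\<exists>k. lin R M (power_mod E (Suc m)) k \<and> (\<forall>x\<in>carrier M. k x m = h x)"
      using lin_comp[OF _ pin_lin[OF E, of "Suc m" m], of M h]
      by (intro exI[of _ "\<lambda>x. pin E (Suc m) m (h x)"]) (simp add: pin_def)
  qed
  then show ?case by (rule pd_le_ext[OF _ Suc p])
qed

text \<open>An internal direct sum yields the projection onto \<open>U\<close> along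
  \<open>V\<close>: its value is the unique \<open>u\<close> in \<open>U\<close> with
  \<open>y - u\<close> in \<open>V\<close>, and its linearity is a consequence of
  uniqueness.\<close>

lemma add_closure_retract:
  assumes X: "X \<in> add_closure R E" and E: "left_module R E"
  shows "\<exists>m i r. retract R X (power_mod E m) i r"
proof -
  obtain m U V where ids: "internal_direct_sum R (power_mod E m) U V"
    and iso: "mod_iso R X ((power_mod E m)\<lparr>carrier := U\<rparr>)" and fg: "fg_module R X"
    using X by (auto simp: add_closure_def direct_summand_def)
  let ?Y = "power_mod E m"
  have YL: "left_module R ?Y" by (rule power_left_module[OF E])
  interpret Y: left_module R ?Y by fact
  have U: "submodule U R ?Y" and V: "submodule V R ?Y" and UV: "U \<inter> V = {\<zero>\<^bsub>?Y\<^esub>}" and sum: "U <+>\<^bsub>?Y\<^esub> V = carrier ?Y"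
    using ids by (simp_all add: internal_direct_sum_def)
  note UD = Y.submoduleD[OF U] and VD = Y.submoduleD[OF V]
  have UY: "u \<in> carrier ?Y" if "u \<in> U" for u using UD(1) that by blast
  define \<pi> where "\<pi> y = (SOME u. u \<in> U \<and> y \<ominus>\<^bsub>?Y\<^esub> u \<in> V)" for y
  have \<pi>: "\<pi> y \<in> U \<and> y \<ominus>\<^bsub>?Y\<^esub> \<pi> y \<in> V" if y: "y \<in> carrier ?Y" for y
  proof -
    have "y \<in> U <+>\<^bsub>?Y\<^esub> V" unfolding sum by (rule y)
    then obtain u v where uv: "u \<in> U" "v \<in> V" "y = u \<oplus>\<^bsub>?Y\<^esub> v" by (auto simp: set_add_def')
    have "y \<ominus>\<^bsub>?Y\<^esub> u = v"
      using uv UY[OF uv(1)] VD(1) Y.add_minus_cancel[of v u] by (auto simp: Y.M.a_comm)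
    then have "\<exists>u. u \<in> U \<and> y \<ominus>\<^bsub>?Y\<^esub> u \<in> V" using uv(1,2) by auto
    then show ?thesis unfolding \<pi>_def by (rule someI_ex)
  qed
  have uniq: "\<pi> y = u" if y: "y \<in> carrier ?Y" and u: "u \<in> U" "y \<ominus>\<^bsub>?Y\<^esub> u \<in> V" for y u
  proof -
    have c: "\<pi> y \<in> carrier ?Y" "u \<in> carrier ?Y" using \<pi>[OF y] u UY by auto
    have "\<pi> y \<ominus>\<^bsub>?Y\<^esub> u \<in> U" using \<pi>[OF y] u(1) by (simp add: Y.submodule_diff[OF U])
    moreover have "(y \<ominus>\<^bsub>?Y\<^esub> u) \<ominus>\<^bsub>?Y\<^esub> (y \<ominus>\<^bsub>?Y\<^esub> \<pi> y) \<in> V" using \<pi>[OF y] u(2) by (simp add: Y.submodule_diff[OF V])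
    moreover have "(y \<ominus>\<^bsub>?Y\<^esub> u) \<ominus>\<^bsub>?Y\<^esub> (y \<ominus>\<^bsub>?Y\<^esub> \<pi> y) = \<pi> y \<ominus>\<^bsub>?Y\<^esub> u"
    proof -
      have e1: "y = (y \<ominus>\<^bsub>?Y\<^esub> \<pi> y) \<oplus>\<^bsub>?Y\<^esub> \<pi> y" using Y.diff_add[OF c(1) y] by simp
      have "y \<ominus>\<^bsub>?Y\<^esub> u = (\<pi> y \<ominus>\<^bsub>?Y\<^esub> u) \<oplus>\<^bsub>?Y\<^esub> (y \<ominus>\<^bsub>?Y\<^esub> \<pi> y)"
        by (subst e1) (use y c in \<open>simp add: a_minus_def Y.M.a_ac\<close>)
      then show ?thesis using y c by (simp add: Y.add_minus_cancel)
    qed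
    ultimately have "\<pi> y \<ominus>\<^bsub>?Y\<^esub> u \<in> U \<inter> V" by simp
    then show ?thesis unfolding UV using Y.eq_iff_diff[OF c] by simp
  qed
  have \<pi>Y: "\<pi> y \<in> carrier ?Y" if "y \<in> carrier ?Y" for y using UY \<pi>[OF that] by blast
  have \<pi>l: "lin R ?Y (?Y\<lparr>carrier := U\<rparr>) \<pi>"
  proof (rule linI)
    show "\<pi> y \<in> carrier (?Y\<lparr>carrier := U\<rparr>)" if "y \<in> carrier ?Y" for y using \<pi>[OF that] by simp
  next
    fix y z assume yz: "y \<in> carrier ?Y" "z \<in> carrier ?Y"
    have "(y \<oplus>\<^bsub>?Y\<^esub> z) \<ominus>\<^bsub>?Y\<^esub> (\<pi> y \<oplus>\<^bsub>?Y\<^esub> \<pi> z) = (y \<ominus>\<^bsub>?Y\<^esub> \<pi> y) \<oplus>\<^bsub>?Y\<^esub> (z \<ominus>\<^bsub>?Y\<^esub> \<pi> z)"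
      using yz \<pi>Y by (simp add: a_minus_def Y.M.minus_add Y.M.a_ac)
    also have "\<dots> \<in> V" using \<pi>[OF yz(1)] \<pi>[OF yz(2)] VD(3) by blast
    finally have "\<pi> (y \<oplus>\<^bsub>?Y\<^esub> z) = \<pi> y \<oplus>\<^bsub>?Y\<^esub> \<pi> z"
      using \<pi>[OF yz(1)] \<pi>[OF yz(2)] UD(3) yz by (intro uniq) auto
    then show "\<pi> (y \<oplus>\<^bsub>?Y\<^esub> z) = \<pi> y \<oplus>\<^bsub>?Y\<lparr>carrier := U\<rparr>\<^esub> \<pi> z" by simp
  next
    fix a y assume ay: "a \<in> carrier R" "y \<in> carrier ?Y"
    have "(a \<odot>\<^bsub>?Y\<^esub> y) \<ominus>\<^bsub>?Y\<^esub> (a \<odot>\<^bsub>?Y\<^esub> \<pi> y) = a \<odot>\<^bsub>?Y\<^esub> (y \<ominus>\<^bsub>?Y\<^esub> \<pi> y)"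
      using ay \<pi>Y by (simp add: a_minus_def Y.smult_r_distr Y.smult_r_minus)
    also have "\<dots> \<in> V" using \<pi>[OF ay(2)] VD(4) ay by blast
    finally have "\<pi> (a \<odot>\<^bsub>?Y\<^esub> y) = a \<odot>\<^bsub>?Y\<^esub> \<pi> y"
      using \<pi>[OF ay(2)] UD(4) ay by (intro uniq) auto
    then show "\<pi> (a \<odot>\<^bsub>?Y\<^esub> y) = a \<odot>\<^bsub>?Y\<lparr>carrier := U\<rparr>\<^esub> \<pi> y" by simp
  qed
  have \<pi>id: "\<pi> u = u" if "u \<in> U" for u
    using that UY[OF that] VD(2) Y.eq_iff_diff[of u u] by (intro uniq) auto
  obtain g h where gh: "iso_pair R X (?Y\<lparr>carrier := U\<rparr>) g h"
    using mod_iso_pair[OF iso fg_left_module[OF fg]] by blast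
  note D = iso_pairD[OF gh]
  have "lin R X ?Y g" using lin_comp[OF D(1) lin_incl[OF UD(1)]] by simp
  moreover have "h (\<pi> (g x)) = x" if "x \<in> carrier X" for x
    using D(3,5)[OF that] \<pi>id[of "g x"] by simp
  ultimately have "retract R X ?Y g (\<lambda>y. h (\<pi> y))"
    using lin_comp[OF \<pi>l D(2)] by (simp add: retract_def)
  then show ?thesis by blast
qed

lemma power_copy_add_closure:
  fixes N :: "'a umod" and R :: "('a, 'r) ring_scheme"
  assumes N: "fg_module R N" and i: "iso_pair R (power_mod E m) N g h" and E: "left_module R E"
  shows "N \<in> add_closure R E"
proof -
  have YL: "left_module R (power_mod E m)" by (rule power_left_module[OF E])
  interpret Y: left_module R "power_mod E m" by fact
  have e: "(power_mod E m)\<lparr>carrier := carrier (power_mod E m)\<rparr> = power_mod E m" by (simp add: power_mod_def)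
  have "carrier (power_mod E m) <+>\<^bsub>power_mod E m\<^esub> {\<zero>\<^bsub>power_mod E m\<^esub>} = carrier (power_mod E m)"
    by (auto simp: set_add_def')
  then have "internal_direct_sum R (power_mod E m) (carrier (power_mod E m)) {\<zero>\<^bsub>power_mod E m\<^esub>}"
    unfolding internal_direct_sum_def using Y.carrier_submodule Y.zero_submodule by simp
  moreover have "mod_iso R N ((power_mod E m)\<lparr>carrier := carrier (power_mod E m)\<rparr>)"
    unfolding e by (rule iso_pair_mod_iso[OF iso_pair_sym[OF i] fg_left_module[OF N]])
  ultimately show ?thesis unfolding add_closure_def direct_summand_def using N by blast
qed

lemma mod_iso_trans:
  assumes "mod_iso R X Y" "mod_iso R Y Z" "left_module R X" "left_module R Y"
  shows "mod_iso R X Z"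
proof -
  obtain g h g' h' where gh: "iso_pair R X Y g h" "iso_pair R Y Z g' h'"
    using mod_iso_pair[OF assms(1,3)] mod_iso_pair[OF assms(2,4)] by blast
  show ?thesis by (rule iso_pair_mod_iso[OF iso_pair_trans[OF gh] assms(3)])
qed

lemma gorenstein_projective_iso:
  assumes G: "gorenstein_projective R G" and i: "iso_pair R G N g h" and N: "fg_module R N"
  shows "gorenstein_projective R N"
proof -
  obtain P D where G': "fg_module R G" "totally_acyclic R P D"
    "mod_iso R G ((P 0)\<lparr>carrier := D (-1) ` carrier (P (-1))\<rparr>)"
    using G by (auto simp: gorenstein_projective_def)
  have L: "left_module R G" "left_module R N" using G'(1) N by (auto intro: fg_left_module)
  have "mod_iso R N ((P 0)\<lparr>carrier := D (-1) ` carrier (P (-1))\<rparr>)"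
    by (rule mod_iso_trans[OF iso_pair_mod_iso[OF iso_pair_sym[OF i] L(2)] G'(3) L(2,1)])
  then show ?thesis unfolding gorenstein_projective_def using N G'(2) by blast
qed

section \<open>The bound on the global dimension\<close>

locale gor_hom = gor_algebra K A \<phi> n I d e r J \<delta> \<epsilon>
  for K :: "('k, 'r) ring_scheme" and A :: "('a, 's) ring_scheme" and \<phi> :: "'k \<Rightarrow> 'a"
    and n I d e r J \<delta> \<epsilon> +
  fixes E :: "('a, 'e, 'u) module_scheme" and M :: "('a, 'm, 't) module_scheme"
  assumes E: "fg_module A E" and GPE: "GP A = add_closure A E" and M: "gorenstein_projective A M"
begin

lemma E_left: "left_module A E"
  by (rule fg_left_module[OF E])

lemma M_fg: "fg_module A M"
  using M by (simp add: gorenstein_projective_def)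

lemma M_left: "left_module A M"
  by (rule fg_left_module[OF M_fg])

text \<open>A copy of the power in the universe belongs to \<open>add E\<close>, so it is Gorenstein
  projective by \<open>GPE\<close>.\<close>

lemma power_E_cohom: "L.cohom_above 0 (power_mod E m)"
proof -
  obtain N :: "'a umod" and g h where N: "fg_module A N" "iso_pair A (power_mod E m) N g h"
    using fg_copy[OF power_fg[OF E, of m]] by (elim exE conjE)
  have "N \<in> GP A" unfolding GPE by (rule power_copy_add_closure[OF N E_left])
  then have "L.cohom_above 0 N" using cohom_if_gorenstein_projective by (simp add: GP_def)
  then show ?thesis by (rule L.cohom_above_retract[OF iso_pair_retract(1)[OF N(2)]])
qed

lemma gorenstein_projective_retract:
  assumes G: "gorenstein_projective A G"
  shows "\<exists>m i r. retract A G (power_mod E m) i r"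
proof -
  have fg: "fg_module A G" using G by (simp add: gorenstein_projective_def)
  obtain N :: "'a umod" and g h where N: "fg_module A N" "iso_pair A G N g h"
    using fg_copy[OF fg] by (elim exE conjE)
  have "N \<in> add_closure A E"
    unfolding GPE[symmetric] using gorenstein_projective_iso[OF G N(2,1)] by (simp add: GP_def)
  then obtain m i r where "retract A N (power_mod E m) i r" using add_closure_retract E_left by blast
  then show ?thesis using retract_trans[OF iso_pair_retract(1)[OF N(2)]] by blast
qed

text \<open>Generators of \<open>Hom(E, X)\<close> over \<open>K\<close> give a right \<open>add E\<close>-approximation of \<open>X\<close>.\<close>

lemma approximation:
  assumes X: "fg_module A X"
  shows "\<exists>s q. lin A (power_mod E s) X q \<and> (\<forall>m h. lin A (power_mod E m) X h \<longrightarrow>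
    (\<exists>k. lin A (power_mod E m) (power_mod E s) k \<and> (\<forall>v\<in>carrier (power_mod E m). q (k v) = h v)))"
proof -
  have XL: "left_module A X" by (rule fg_left_module[OF X])
  interpret E: left_module A E by (rule E_left)
  obtain s t where t: "\<forall>i<s. lin A E X (t i)"
    and gen: "\<forall>f. lin A E X f \<longrightarrow> (\<exists>k. (\<forall>i<s. k i \<in> carrier K) \<and>
     (\<forall>x\<in>carrier E. f x = msum X s (\<lambda>i. \<phi> (k i) \<odot>\<^bsub>X\<^esub> t i x)))"
    using hom_fgen[OF AA E X] by (elim exE conjE)
  have Ps: "left_module A (power_mod E s)" by (rule power_left_module[OF E_left])
  interpret Ps: left_module A "power_mod E s" by (rule Ps)
  let ?q = "\<lambda>v. msum X s (\<lambda>i. t i (v i))"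
  have q: "lin A (power_mod E s) X ?q"
    by (rule lin_msum[OF lin_comp[OF power_proj_lin] Ps XL]) (use t in auto)
  have one: "\<exists>b. lin A E (power_mod E s) b \<and> (\<forall>x\<in>carrier E. ?q (b x) = f x)" if f: "lin A E X f" for f
  proof -
    obtain k where k: "\<forall>i<s. k i \<in> carrier K"
      "\<forall>x\<in>carrier E. f x = msum X s (\<lambda>i. \<phi> (k i) \<odot>\<^bsub>X\<^esub> t i x)" using mp[OF spec[OF gen] f] by (elim exE conjE)
    have kA: "\<phi> (k i) \<in> carrier A" if "i < s" for i using k(1) artin_algebraD(6)[OF AA] that by blast
    \<comment> \<open>The coefficients of \<open>f\<close> with respect to the generators become a
      map into the power of \<open>E\<close>; it is \<open>A\<close>-linear because the coefficients
      act centrally.\<close>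
    let ?b = "\<lambda>x. \<lambda>i\<in>{..<s}. \<phi> (k i) \<odot>\<^bsub>E\<^esub> x"
    have "lin A E (power_mod E s) ?b"
      by (rule power_tuple_lin[OF E_left E_left scalar_lin[OF AA E_left]]) (use k(1) in blast)
    moreover have "?q (?b x) = f x" if x: "x \<in> carrier E" for x
    proof -
      have "?q (?b x) = msum X s (\<lambda>i. \<phi> (k i) \<odot>\<^bsub>X\<^esub> t i x)"
        by (rule msum_cong) (use t kA x in \<open>simp add: lin_def\<close>)
      then show ?thesis using k(2) x by simp
    qed
    ultimately show ?thesis by blast
  qed
  have "\<exists>k. lin A (power_mod E m) (power_mod E s) k \<and> (\<forall>v\<in>carrier (power_mod E m). ?q (k v) = h v)"
    if h: "lin A (power_mod E m) X h" for m h
  proof -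
    have Pm: "left_module A (power_mod E m)" by (rule power_left_module[OF E_left])
    have "\<forall>j. \<exists>b. lin A E (power_mod E s) b \<and> (\<forall>x\<in>carrier E. ?q (b x) = h (pin E m j x))"
      using one[OF lin_comp[OF pin_lin[OF E_left] h]] by blast
    from choice[OF this] obtain b where b: "\<And>j. lin A E (power_mod E s) (b j)"
      "\<And>j x. x \<in> carrier E \<Longrightarrow> ?q (b j x) = h (pin E m j x)" by blast
    have kl: "lin A (power_mod E m) (power_mod E s) (\<lambda>v. msum (power_mod E s) m (\<lambda>j. b j (v j)))"
      by (rule lin_msum[OF lin_comp[OF power_proj_lin b(1)] Pm Ps])
    have "?q (msum (power_mod E s) m (\<lambda>j. b j (v j))) = h v" if v: "v \<in> carrier (power_mod E m)" for v
    proof -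
      have vj: "v j \<in> carrier E" if "j < m" for j by (rule power_modD[OF v that])
      have "?q (msum (power_mod E s) m (\<lambda>j. b j (v j))) = msum X m (\<lambda>j. ?q (b j (v j)))"
        by (rule msum_lin(2)[OF q Ps XL lin_closed[OF b(1) vj]])
      also have "\<dots> = msum X m (\<lambda>j. h (pin E m j (v j)))" by (rule msum_cong) (rule b(2)[OF vj])
      also have "\<dots> = h (msum (power_mod E m) m (\<lambda>j. pin E m j (v j)))"
        by (rule msum_lin(2)[OF h Pm XL lin_closed[OF pin_lin[OF E_left] vj], symmetric])
      finally show ?thesis using pin_decomp[OF E_left v] by simp
    qed
    then show ?thesis using kl by blast
  qed
  then show ?thesis using q by blast
qed

text \<open>A Gorenstein projective module is a retract of a power of \<open>E\<close>, so every map
  from it to \<open>X\<close> factors through \<open>q\<close>. A free cover of \<open>X\<close> is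
  one of these maps, which makes \<open>q\<close> surjective.\<close>

lemma approximation_gorenstein_projective:
  assumes X: "fg_module A X"
  shows "\<exists>s q. lin A (power_mod E s) X q \<and> q ` carrier (power_mod E s) = carrier X \<and>
    (\<forall>h. lin A M X h \<longrightarrow> (\<exists>k. lin A M (power_mod E s) k \<and> (\<forall>v\<in>carrier M. q (k v) = h v)))"
proof -
  have XL: "left_module A X" by (rule fg_left_module[OF X])
  interpret X: left_module A X by (rule XL)
  obtain s q where q: "lin A (power_mod E s) X q" and lift: "\<forall>m h. lin A (power_mod E m) X h \<longrightarrow>
    (\<exists>k. lin A (power_mod E m) (power_mod E s) k \<and> (\<forall>v\<in>carrier (power_mod E m). q (k v) = h v))"
    using approximation[OF X] by (elim exE conjE)
  \<comment> \<open>Used for modules of two carrier types: the copy \<open>F\<close> of a free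
    module, for surjectivity, and \<open>M\<close> itself.\<close>
  have lift': "\<exists>k. lin A G (power_mod E s) k \<and> (\<forall>v\<in>carrier G. q (k v) = h v)"
    if G: "gorenstein_projective A G" and h: "lin A G X h" for h and G :: "('a, 'g, 'w) module_scheme"
  proof -
    obtain m i u where "retract A G (power_mod E m) i u" using gorenstein_projective_retract[OF G] by blast
    note D = retractD[OF this]
    obtain k where k: "lin A (power_mod E m) (power_mod E s) k" "\<forall>v\<in>carrier (power_mod E m). q (k v) = h (u v)"
      using mp[OF spec[OF spec[OF lift]] lin_comp[OF D(2) h]] by blast
    show ?thesis using lin_comp[OF D(1) k(1)] k(2) D(3,4) by (intro exI[of _ "\<lambda>x. k (i x)"]) simp
  qed
  obtain m p where p: "lin A (free m) X p" "p ` carrier (free m) = carrier X" using free_cover[OF X] by blast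
  obtain F :: "'a umod" and g h where F: "fg_module A F" "iso_pair A (free m) F g h"
    using fg_copy[OF free_fg[of m]] by (elim exE conjE)
  have FP: "fgp A F" by (rule fgp_retract[OF iso_pair_retract(2)[OF F(2)] free_fgp[OF A_ring] fg_left_module[OF F(1)]])
  have FG: "gorenstein_projective A F" by (rule gorenstein_projective_if_cohom[OF F(1) L.cohom_above_fgp[OF FP]])
  obtain k where k: "lin A F (power_mod E s) k" "\<forall>v\<in>carrier F. q (k v) = p (h v)"
    using lift'[OF FG lin_comp[OF iso_pairD(2)[OF F(2)] p(1)]] by blast
  have "carrier X \<subseteq> q ` carrier (power_mod E s)"
  proof
    fix x assume "x \<in> carrier X"
    then have "x \<in> p ` carrier (free m)" unfolding p(2) .
    then obtain v where v: "x = p v" "v \<in> carrier (free m)" by (rule imageE)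
    then have "x = q (k (g v))" using k(2) iso_pairD(3,5)[OF F(2) v(2)] by simp
    then show "x \<in> q ` carrier (power_mod E s)" using lin_closed[OF k(1) iso_pairD(5)[OF F(2) v(2)]] by simp
  qed
  then have "q ` carrier (power_mod E s) = carrier X" using lin_closed[OF q] by blast
  then show ?thesis using q lift'[OF M] by blast
qed

text \<open>Each approximation trades one degree of extensions for one of projective dimension: its
  kernel satisfies the hypothesis with \<open>k\<close> lowered by one, and
  \<open>pd_le_quotient\<close> raises the bound by one.\<close>

lemma pd_le_hom_umod:
  fixes X :: "'a umod"
  assumes p: "pd_le (end_ring A M) p (hom_module A M E)" and X: "fg_module A X" and k: "L.cohom_above k X"
  shows "pd_le (end_ring A M) (p + k) (hom_module A M X)"
  using X k
proof (induction k arbitrary: X)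
  case 0
  obtain m i u where "retract A X (power_mod E m) i u"
    using gorenstein_projective_retract[OF gorenstein_projective_if_cohom[OF 0]] by blast
  from pd_le_retract[OF hom_map_retract[OF this M_left] hom_module_left_module[OF M_left fg_left_module[OF 0(1)]] pd_le_hom_power[OF M_left E_left p]]
  show ?case by simp
next
  case (Suc k)
  have XL: "left_module A X" by (rule fg_left_module[OF Suc.prems(1)])
  obtain s q where q: "lin A (power_mod E s) X q" "q ` carrier (power_mod E s) = carrier X"
    "\<forall>h. lin A M X h \<longrightarrow> (\<exists>k. lin A M (power_mod E s) k \<and> (\<forall>v\<in>carrier M. q (k v) = h v))"
    using approximation_gorenstein_projective[OF Suc.prems(1)] by (elim exE conjE)
  have Ps: "left_module A (power_mod E s)" by (rule power_left_module[OF E_left])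
  note s = ses_ker[OF Ps XL q(1,2)]
  let ?X1 = "power_mod E s\<lparr>carrier := ker (power_mod E s) X q\<rparr>"
  have X1: "fg_module A ?X1" by (rule fg_submodule[OF AA power_fg[OF E] ker_submodule[OF q(1) Ps XL]])
  obtain c :: "_ \<Rightarrow> (nat \<Rightarrow> 'a) set" where c: "inj_on c (carrier (power_mod E s))"
    using fg_small[OF power_fg[OF E, of s]] by blast
  have X1k: "L.cohom_above k ?X1" by (rule L.cohom_above_cover[OF s power_E_cohom Suc.prems(2) c])
  \<comment> \<open>The kernel consists of functions into the carrier of \<open>E\<close>, whereas
    the induction hypothesis concerns the universe.\<close>
  obtain N :: "'a umod" and g h where N: "fg_module A N" "iso_pair A ?X1 N g h"
    using fg_copy[OF X1] by (elim exE conjE)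
  have "pd_le (end_ring A M) (p + k) (hom_module A M N)"
    by (rule Suc.IH[OF N(1) L.cohom_above_retract[OF iso_pair_retract(2)[OF N(2)] X1k]])
  then have "pd_le (end_ring A M) (p + k) (hom_module A M ?X1)"
    by (rule pd_le_iso[OF hom_map_iso[OF iso_pair_sym[OF N(2)] M_left] _ hom_module_left_module[OF M_left fg_left_module[OF X1]]])
  moreover have "pd_le (end_ring A M) (Suc (p + k)) (hom_module A M (power_mod E s))"
    by (rule pd_le_mono[OF pd_le_hom_power[OF M_left E_left p]]) simp
  ultimately show ?case
    using pd_le_quotient[OF hom_ses[OF s M_left]] q(3) by simp
qed

lemma pd_le_hom:
  assumes p: "pd_le (end_ring A M) p (hom_module A M E)" and X: "fg_module A X" and k: "L.cohom_above k X"
  shows "pd_le (end_ring A M) (p + k) (hom_module A M X)"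
proof -
  obtain N :: "'a umod" and g h where N: "fg_module A N" "iso_pair A X N g h"
    using fg_copy[OF X] by (elim exE conjE)
  have "pd_le (end_ring A M) (p + k) (hom_module A M N)"
    by (rule pd_le_hom_umod[OF p N(1) L.cohom_above_retract[OF iso_pair_retract(2)[OF N(2)] k]])
  then show ?thesis
    by (rule pd_le_iso[OF hom_map_iso[OF iso_pair_sym[OF N(2)] M_left] _ hom_module_left_module[OF M_left fg_left_module[OF X]]])
qed

end

lemma msum_hom_module:
  "u \<in> carrier M \<Longrightarrow> msum (hom_module R M X) m f u = msum X m (\<lambda>i. f i u)"
  by (induction m) simp_all

lemma hom_coordinate_lin:
  assumes M: "left_module R M" and j: "j < m"
  shows "lin (end_ring R M) (hom_module R M (power_mod M m)) (regular_mod (end_ring R M)) (hom_map M (\<lambda>v. v j))"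
  using hom_map_lin[OF power_proj_lin[OF j] M] by (auto simp: lin_def)

text \<open>The inclusions of the summands form a basis over the endomorphism ring, and the
  coordinates of a map are its coefficients.\<close>

lemma hom_power_fgp:
  assumes M: "left_module R M"
  shows "fgp (end_ring R M) (hom_module R M (power_mod M m))"
proof -
  let ?H = "hom_module R M (power_mod M m)"
  have P: "left_module R (power_mod M m)" by (rule power_left_module[OF M])
  have H: "left_module (end_ring R M) ?H" by (rule hom_module_left_module[OF M P])
  interpret H: left_module "end_ring R M" ?H by (rule H)
  have b: "restrict (pin M m j) (carrier M) \<in> mod_hom R M (power_mod M m)" for j
    by (rule lin_restrict[OF pin_lin[OF M] M])
  have c: "hom_map M (\<lambda>v. v j) h \<in> mod_hom R M M" if "j < m" "h \<in> mod_hom R M (power_mod M m)" for j h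
    by (rule hom_map_closed[OF power_proj_lin[OF that(1)] M that(2)])
  have "h = msum ?H m (\<lambda>j. hom_map M (\<lambda>v. v j) h \<odot>\<^bsub>?H\<^esub> restrict (pin M m j) (carrier M))"
    if h: "h \<in> mod_hom R M (power_mod M m)" for h
  proof (rule mod_hom_eqI[OF h])
    have "msum ?H m (\<lambda>j. hom_map M (\<lambda>v. v j) h \<odot>\<^bsub>?H\<^esub> restrict (pin M m j) (carrier M)) \<in> carrier ?H"
    proof (rule H.msum_closed, rule H.smult_closed)
      fix j assume "j < m"
      then show "hom_map M (\<lambda>v. v j) h \<in> carrier (end_ring R M)" using c[OF _ h] by simp
      show "restrict (pin M m j) (carrier M) \<in> carrier ?H" using b by simp
    qed
    then show "msum ?H m (\<lambda>j. hom_map M (\<lambda>v. v j) h \<odot>\<^bsub>?H\<^esub> restrict (pin M m j) (carrier M)) \<in> mod_hom R M (power_mod M m)"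
      by simp
    fix u assume u: "u \<in> carrier M"
    have hu: "h u \<in> carrier (power_mod M m)" by (rule mod_hom_closed[OF h u])
    have "msum ?H m (\<lambda>j. hom_map M (\<lambda>v. v j) h \<odot>\<^bsub>?H\<^esub> restrict (pin M m j) (carrier M)) u =
      msum (power_mod M m) m (\<lambda>j. pin M m j (h u j))"
      unfolding msum_hom_module[OF u] by (rule msum_cong) (use u power_modD[OF hu] in simp)
    then show "h u = msum ?H m (\<lambda>j. hom_map M (\<lambda>v. v j) h \<odot>\<^bsub>?H\<^esub> restrict (pin M m j) (carrier M)) u"
      using pin_decomp[OF M hu] by simp
  qed
  then have "dual_basis (end_ring R M) ?H m (\<lambda>j. restrict (pin M m j) (carrier M)) (\<lambda>j. hom_map M (\<lambda>v. v j))"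
    unfolding dual_basis_def using b hom_coordinate_lin[OF M] by simp
  then show ?thesis unfolding fgp_def using H by blast
qed

context gor_hom
begin

text \<open>The kernel \<open>L\<close> of the first cover \<open>\<pi>\<close> sits between two
  short exact sequences, and each of them contributes one to the bound \<open>p + l\<close> for the
  second syzygy.\<close>

lemma pd_le_end_ring:
  assumes p: "pd_le (end_ring A M) p (hom_module A M E)" and n: "2 \<le> n" and X: "fg_module (end_ring A M) X"
  shows "pd_le (end_ring A M) (n + p) X"
proof -
  let ?B = "end_ring A M" and ?P = "\<lambda>m. power_mod M m" and ?H = "\<lambda>m. hom_module A M (power_mod M m)"
  interpret M: left_module A M by (rule M_left)
  have XL: "left_module ?B X" by (rule fg_left_module[OF X])
  interpret X: left_module ?B X by (rule XL)
  obtain m x where x: "\<forall>i<m. x i \<in> carrier X"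
    "\<forall>u\<in>carrier X. \<exists>c. (\<forall>i<m. c i \<in> carrier ?B) \<and> u = msum X m (\<lambda>i. c i \<odot>\<^bsub>X\<^esub> x i)"
    using X unfolding fg_iff fgen_def lcomb_gen_def by blast
  have P: "left_module A (?P j)" and Pfg: "fg_module A (?P j)" for j
    by (rule power_left_module[OF M_left], rule power_fg[OF M_fg])
  have H: "left_module ?B (?H j)" for j by (rule hom_module_left_module[OF M_left P])
  interpret Hm: left_module ?B "?H m" by (rule H)
  have H0: "pd_le ?B k (?H j)" for k j
    using hom_power_fgp[OF M_left, of j] pd_le_mono[of ?B 0 _ k] by (simp add: pd_le_0_iff)
  define \<pi> where "\<pi> h = msum X m (\<lambda>j. hom_map M (\<lambda>v. v j) h \<odot>\<^bsub>X\<^esub> x j)" for h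
  have \<pi>: "lin ?B (?H m) X \<pi>"
    unfolding \<pi>_def by (rule lin_msum[OF lin_coeff_smult[OF hom_coordinate_lin[OF M_left] XL] H XL]) (use x(1) in auto)
  have "carrier X \<subseteq> \<pi> ` carrier (?H m)"
  proof
    fix u assume "u \<in> carrier X"
    then obtain c where c: "\<forall>i<m. c i \<in> carrier ?B" "u = msum X m (\<lambda>i. c i \<odot>\<^bsub>X\<^esub> x i)" using x(2) by blast
    have cM: "c i \<in> mod_hom A M M" if "i < m" for i using c(1) that by simp
    define h where "h = (\<lambda>u\<in>carrier M. \<lambda>i\<in>{..<m}. c i u)"
    have h: "h \<in> mod_hom A M (?P m)"
      unfolding h_def by (rule lin_restrict[OF power_tuple_lin[OF M_left M_left mod_hom_linD[OF cM]] M_left])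
    have "hom_map M (\<lambda>v. v j) h = c j" if j: "j < m" for j
      by (rule mod_hom_eqI[OF hom_map_closed[OF power_proj_lin[OF j] M_left h] cM[OF j]]) (use j in \<open>simp add: h_def\<close>)
    then have "\<pi> h = u" unfolding \<pi>_def c(2) by (intro msum_cong) simp
    then show "u \<in> \<pi> ` carrier (?H m)" using h by (intro image_eqI[of u \<pi> h]) simp_all
  qed
  then have \<pi>s: "\<pi> ` carrier (?H m) = carrier X" using lin_closed[OF \<pi>] by blast
  define L where "L = ker (?H m) X \<pi>"
  have Lsub: "submodule L ?B (?H m)" unfolding L_def by (rule ker_submodule[OF \<pi> H XL])
  note LD = Hm.submoduleD[OF Lsub]
  have LM: "g \<in> mod_hom A M (?P m)" if "g \<in> L" for g using LD(1) that by auto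
  interpret Pm: left_module A "?P m" by (rule P)
  have "\<exists>s t. (\<forall>i<s. t i \<in> L) \<and> (\<forall>f\<in>L. \<exists>k. (\<forall>i<s. k i \<in> carrier K) \<and>
     (\<forall>x\<in>carrier M. f x = msum (?P m) s (\<lambda>i. \<phi> (k i) \<odot>\<^bsub>?P m\<^esub> t i x)))"
  proof (rule hom_subset_fgen[OF AA M_fg Pfg])
    show "lin A M (?P m) f" if "f \<in> L" for f by (rule mod_hom_linD[OF LM[OF that]])
    show "(\<lambda>x\<in>carrier M. \<zero>\<^bsub>?P m\<^esub>) \<in> L" using LD(2) by simp
    show "(\<lambda>x\<in>carrier M. f x \<oplus>\<^bsub>?P m\<^esub> g x) \<in> L" if "f \<in> L" "g \<in> L" for f g using LD(3)[OF that] by simp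
    \<comment> \<open>Multiplication by \<open>\<phi> k\<close> on \<open>M\<close> is an element of
      \<open>B\<close>, so \<open>L\<close> is closed under composition with it; linearity of
      \<open>f\<close> moves the scalar outside.\<close>
    show "(\<lambda>x\<in>carrier M. \<phi> k \<odot>\<^bsub>?P m\<^esub> f x) \<in> L" if k: "k \<in> carrier K" and f: "f \<in> L" for k f
    proof -
      let ?b = "restrict (\<lambda>x. \<phi> k \<odot>\<^bsub>M\<^esub> x) (carrier M)"
      have "?b \<in> carrier ?B" using lin_restrict[OF scalar_lin[OF AA M_left k] M_left] by simp
      from LD(4)[OF this f] have "(\<lambda>x\<in>carrier M. f (?b x)) \<in> L" by simp
      moreover have "(\<lambda>x\<in>carrier M. f (?b x)) = (\<lambda>x\<in>carrier M. \<phi> k \<odot>\<^bsub>?P m\<^esub> f x)"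
        using lin_smult[OF mod_hom_linD[OF LM[OF f]] artin_algebraD(6)[OF AA k]]
        by (auto simp: restrict_def fun_eq_iff)
      ultimately show ?thesis by simp
    qed
  qed
  then obtain s t where t: "\<And>i. i < s \<Longrightarrow> t i \<in> L" and gen: "\<forall>f\<in>L. \<exists>k. (\<forall>i<s. k i \<in> carrier K) \<and>
     (\<forall>x\<in>carrier M. f x = msum (?P m) s (\<lambda>i. \<phi> (k i) \<odot>\<^bsub>?P m\<^esub> t i x))" by blast
  have tl: "lin A M (?P m) (t i)" if "i < s" for i by (rule mod_hom_linD[OF LM[OF t[OF that]]])
  \<comment> \<open>With the generators of \<open>L\<close> as components, composition with
    \<open>f\<close> has image exactly \<open>L\<close>. It stays in \<open>L\<close> because
    \<open>L\<close> is a \<open>B\<close>-submodule, and a \<open>K\<close>-combination of the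
    \<open>t i\<close> is attained by scalar multiplications on \<open>M\<close>.\<close>
  define f where "f v = msum (?P m) s (\<lambda>i. t i (v i))" for v
  have f: "lin A (?P s) (?P m) f"
    unfolding f_def by (rule lin_msum[OF lin_comp[OF power_proj_lin tl] P P])
  interpret Hs: left_module ?B "?H s" by (rule H)
  have fL: "hom_map M f h \<in> L" if h: "h \<in> mod_hom A M (?P s)" for h
  proof -
    have c: "hom_map M (\<lambda>v. v i) h \<in> carrier ?B" if "i < s" for i
      using hom_map_closed[OF power_proj_lin[OF that] M_left h] by simp
    have "msum (?H m) s (\<lambda>i. hom_map M (\<lambda>v. v i) h \<odot>\<^bsub>?H m\<^esub> t i) \<in> L"
      by (rule Hm.msum_in_submodule[OF Lsub], rule LD(4)[OF c t])
    moreover have "hom_map M f h = msum (?H m) s (\<lambda>i. hom_map M (\<lambda>v. v i) h \<odot>\<^bsub>?H m\<^esub> t i)"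
    proof (rule mod_hom_eqI[OF hom_map_closed[OF f M_left h] LM[OF calculation]])
      fix u assume u: "u \<in> carrier M"
      show "hom_map M f h u = msum (?H m) s (\<lambda>i. hom_map M (\<lambda>v. v i) h \<odot>\<^bsub>?H m\<^esub> t i) u"
        unfolding msum_hom_module[OF u] using u by (simp add: f_def)
    qed
    ultimately show ?thesis by simp
  qed
  have fsurj: "\<exists>h\<in>mod_hom A M (?P s). hom_map M f h = g" if g: "g \<in> L" for g
  proof -
    obtain k where k: "\<forall>i<s. k i \<in> carrier K"
      "\<forall>x\<in>carrier M. g x = msum (?P m) s (\<lambda>i. \<phi> (k i) \<odot>\<^bsub>?P m\<^esub> t i x)" using gen g by blast
    define h where "h = (\<lambda>u\<in>carrier M. \<lambda>i\<in>{..<s}. \<phi> (k i) \<odot>\<^bsub>M\<^esub> u)"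
    have h: "h \<in> mod_hom A M (?P s)"
      unfolding h_def by (rule lin_restrict[OF power_tuple_lin[OF M_left M_left scalar_lin[OF AA M_left]] M_left]) (use k(1) in auto)
    have "hom_map M f h = g"
    proof (rule mod_hom_eqI[OF hom_map_closed[OF f M_left h] LM[OF g]])
      fix u assume u: "u \<in> carrier M"
      have "f (h u) = msum (?P m) s (\<lambda>i. \<phi> (k i) \<odot>\<^bsub>?P m\<^esub> t i u)"
        unfolding f_def by (rule msum_cong)
          (use u k(1) artin_algebraD(6)[OF AA] lin_smult[OF tl] in \<open>simp add: h_def\<close>)
      then show "hom_map M f h u = g u" using u k(2) by simp
    qed
    then show ?thesis using h by blast
  qed
  let ?L = "?H m\<lparr>carrier := L\<rparr>" and ?S = "?P s\<lparr>carrier := ker (?P s) (?P m) f\<rparr>"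
  have L: "left_module ?B ?L" by (rule Hm.submodule_left_module[OF Lsub])
  have Ssub: "submodule (ker (?P s) (?P m) f) A (?P s)" by (rule ker_submodule[OF f P P])
  have Sfg: "fg_module A ?S" by (rule fg_submodule[OF AA Pfg Ssub])
  have SL: "left_module A ?S" by (rule fg_left_module[OF Sfg])
  have incl: "lin A ?S (?P s) (\<lambda>x. x)" by (rule lin_incl) (auto simp: ker_def)
  \<comment> \<open>\<open>l\<close> bounds the number of approximations; the other two degrees pay
    for the image and the kernel of \<open>f\<close>, and come back as the two syzygies of
    \<open>X\<close>.\<close>
  obtain l where l: "n = Suc (Suc l)" using n by (metis Suc_le_D numeral_2_eq_2 Suc_le_mono)
  obtain c :: "_ \<Rightarrow> (nat \<Rightarrow> 'a) set" where c: "inj_on c (carrier (?P m))" using fg_small[OF Pfg] by blast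
  obtain c' :: "_ \<Rightarrow> (nat \<Rightarrow> 'a) set" where c': "inj_on c' (carrier (?P s))" using fg_small[OF Pfg] by blast
  have Pc: "L.cohom_above 0 (?P j)" for j
    by (rule L.cohom_above_power[OF M_left cohom_if_gorenstein_projective[OF M]])
  \<comment> \<open>The image of \<open>f\<close> is treated as a submodule of a power of
    \<open>M\<close>, which lowers the bound from \<open>n\<close> to \<open>Suc l\<close>; the
    cover of this image by the source of \<open>f\<close> lowers it to \<open>l\<close>.\<close>
  let ?N = "?P m\<lparr>carrier := f ` carrier (?P s)\<rparr>"
  have NL: "left_module A ?N" by (rule image_left_module[OF f P P])
  have Nc: "L.cohom_above (Suc l) ?N"
    by (rule L.cohom_above_sub[OF NL P lin_incl _ Pc c l]) (use lin_closed[OF f] in auto)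
  have "ses A (?P s\<lparr>carrier := ker (?P s) ?N f\<rparr>) (?P s) ?N (\<lambda>x. x) f"
    by (rule ses_ker[OF P NL lin_codom[OF f]]) simp_all
  moreover have "ker (?P s) ?N f = ker (?P s) (?P m) f" by (simp add: ker_def)
  ultimately have "L.cohom_above l ?S" using L.cohom_above_cover[OF _ Pc Nc c'] by simp
  from pd_le_hom[OF p Sfg this] have pS: "pd_le ?B (p + l) (hom_module A M ?S)" .
  have "ses ?B (hom_module A M ?S) (?H s) ?L (hom_map M (\<lambda>x. x)) (hom_map M f)"
  proof (rule sesI)
    show "left_module ?B (hom_module A M ?S)" by (rule hom_module_left_module[OF M_left SL])
    show "lin ?B (hom_module A M ?S) (?H s) (hom_map M (\<lambda>x. x))" by (rule hom_map_lin[OF incl M_left])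
    show "lin ?B (?H s) ?L (hom_map M f)" by (rule lin_codom[OF hom_map_lin[OF f M_left]]) (use fL in simp)
    show "inj_on (hom_map M (\<lambda>x. x)) (carrier (hom_module A M ?S))"
    proof (rule inj_onI)
      fix h k assume hk: "h \<in> carrier (hom_module A M ?S)" "k \<in> carrier (hom_module A M ?S)" "hom_map M (\<lambda>x. x) h = hom_map M (\<lambda>x. x) k"
      show "h = k"
      proof (rule mod_hom_eqI)
        show "h \<in> mod_hom A M ?S" "k \<in> mod_hom A M ?S" using hk by simp_all
        fix x assume "x \<in> carrier M"
        then show "h x = k x" using fun_cong[OF hk(3), of x] by simp
      qed
    qed
    show "\<exists>h\<in>carrier (?H s). hom_map M f h = g" if "g \<in> carrier ?L" for g using fsurj that by simp
  next
    fix h assume "h \<in> carrier (hom_module A M ?S)"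
    then have "h \<in> mod_hom A M ?S" by simp
    then show "hom_map M f (hom_map M (\<lambda>x. x) h) = \<zero>\<^bsub>?L\<^esub>"
      using mod_hom_closed[of h A M ?S] by (auto simp: hom_map_def restrict_def fun_eq_iff ker_def)
  next
    fix h assume "h \<in> carrier (?H s)" and z: "hom_map M f h = \<zero>\<^bsub>?L\<^esub>"
    then have h: "h \<in> mod_hom A M (?P s)" by simp
    have hS: "h u \<in> ker (?P s) (?P m) f" if "u \<in> carrier M" for u
      using fun_cong[OF z, of u] that mod_hom_closed[OF h that] by (simp add: ker_def)
    have hS': "h \<in> mod_hom A M ?S"
      using h lin_codom[OF mod_hom_linD[OF h] hS] by (simp add: mod_hom_lin)
    have "h = hom_map M (\<lambda>x. x) h"
      by (rule mod_hom_eqI[OF h hom_map_closed[OF lin_id M_left h]]) simp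
    then show "\<exists>u\<in>carrier (hom_module A M ?S). h = hom_map M (\<lambda>x. x) u" using hS' by auto
  qed (use H L in auto)
  from pd_le_quotient[OF this H0 pS] have pL: "pd_le ?B (Suc (p + l)) ?L" .
  have "ses ?B ?L (?H m) X (\<lambda>x. x) \<pi>" unfolding L_def by (rule ses_ker[OF H XL \<pi> \<pi>s])
  from pd_le_quotient[OF this H0 pL] show ?thesis by (simp add: l add.commute)
qed

end

lemma inj_dim_attained:
  assumes "inj_dim R X \<le> enat n"
  shows "\<exists>I d e. inj_coresolution R X n I d e"
proof -
  obtain m I d e where "m \<le> n" "inj_coresolution R X m I d e"
    using Inf_enat_le[OF assms[unfolded inj_dim_def]] by blast
  then have "inj_coresolution R X n I d e" unfolding inj_coresolution_def by simp
  then show ?thesis by blast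
qed

theorem theorem1p2:
  fixes K :: "('k, 'r) ring_scheme" and A :: "('a, 's) ring_scheme" and \<phi> :: "'k \<Rightarrow> 'a"
    and M :: "('a, 'm, 't) module_scheme" and E :: "('a, 'e, 'u) module_scheme" and n :: nat
  assumes "artin_algebra K \<phi> A"
    and "gorenstein_projective A M"
    and "cm_finite A"
    and "n_gorenstein_ring n A"
    and "n \<ge> 2"
    and "fg_module A E"
    and "GP A = add_closure A E"
  shows "gl_dim (end_ring A M) \<le> enat n + proj_dim (end_ring A M) (hom_module A M E)"
proof (cases "proj_dim (end_ring A M) (hom_module A M E)")
  \<comment> \<open>For infinite projective dimension the right-hand side is infinite, and the final
    \<open>simp\<close> settles that case.\<close>
  case (enat p)
  have G: "gorenstein_ring A" "inj_dim A (regular_mod A) \<le> enat n"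
    using assms(4) by (simp_all add: n_gorenstein_ring_def)
  obtain I d e where I: "inj_coresolution A (regular_mod A) n I d e" using inj_dim_attained[OF G(2)] by blast
  obtain r where "inj_dim (op_ring A) (regular_mod (op_ring A)) = enat r"
    using G(1) by (auto simp: gorenstein_ring_def)
  then obtain J \<delta> \<epsilon> where J: "inj_coresolution (op_ring A) (regular_mod (op_ring A)) r J \<delta> \<epsilon>"
    using inj_dim_attained[of "op_ring A" "regular_mod (op_ring A)" r] by auto
  interpret gor_hom K A \<phi> n I d e r J \<delta> \<epsilon> E M
    by (intro gor_hom.intro gor_algebra.intro gor_hom_axioms.intro assms I J)
  have "pd_le (end_ring A M) p (hom_module A M E)"
    unfolding proj_dim_le_iff[OF hom_module_left_module[OF M_left E_left], symmetric] enat by simp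
  then have "proj_dim (end_ring A M) X \<le> enat (n + p)" if "fg_module (end_ring A M) X" for X :: "('m \<Rightarrow> 'm) umod"
    using pd_le_end_ring[OF _ assms(5) that] proj_dim_le_iff[OF fg_left_module[OF that]] by blast
  then have "gl_dim (end_ring A M) \<le> enat (n + p)" unfolding gl_dim_def by (intro SUP_least) simp
  then show ?thesis by (simp add: enat)
qed simp

end
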